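(* Let $(\bar x,\bar y)$ be a local minimizer of the bilevel program (BP) and $u\in\mathbb R^n$. Suppose that the feasible map $\mathcal F(x)=\{y:g(x,y)\le0\}$ is RCR-regular at each $(\bar x,y)\in\mathrm{gph}\,S$ and satisfies RS at each $(\bar x,y)\in\mathrm{gph}\,S$ in direction $u$. Moreover assume that the restricted inf-compactness holds at $\bar x$ in direction $u$ (with compact set $\Omega_u$). Then the value function $V$ is directionally Lipschitz continuous and directionally differentiable at $\bar x$ in direction $u$ with $$V'(\bar x;u)=\min_{y\in S(\bar x;u)}\max_{\lambda\in\Lambda(\bar x,y)}\nabla_x\mathcal L(\bar x,y;\lambda)u,\qquad\partial V(\bar x;u)\subseteq\Theta(\bar x;u),$$ where $$\Theta(\bar x;u):=\bigcup_{\tilde y\in S(\bar x;u)\cap\Omega_u}\ \bigcup_{w\in\Sigma(\bar x,\tilde y,u)}\Big\{\nabla_xf(\bar x,\tilde y)+\nabla_xg(\bar x,\tilde y)^T\lambda_g\ :\ \lambda_g\in\Lambda(\bar x,\tilde y)\cap\{\nabla g(\bar x,\tilde y)(u,w)\}^\perp\Big\}.$$ Suppose further that $(u,v)\in C(\bar x,\bar y)$ and that there exists no nonzero vector $(\alpha,\nu_g,\nu_G)\in\mathbb R^{1+p+q}_+$ such that $$0\in\alpha\nabla f(\bar x,\bar y)-\alpha\,\mathrm{co}(\Theta(\bar x;u))\times\{0\}+\nabla g(\bar x,\bar y)^T\nu_g+\nabla G(\bar x,\bar y)^T\nu_G,$$ $$\nu_g\perp g(\bar x,\bar y),\ \nu_g\perp\nabla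 g(\bar x,\bar y)(u,v),\ \nu_G\perp G(\bar x,\bar y),\ \nu_G\perp\nabla G(\bar x,\bar y)(u,v),$$ and there exist sequences $t_k\downarrow0$, $(u^k,v^k)\to(u,v)$ with $\alpha(f(\bar x+t_ku^k,\bar y+t_kv^k)-V(\bar x+t_ku^k))>0$ if $\alpha>0$; $g_i(\bar x+t_ku^k,\bar y+t_kv^k)>0$ if $(\nu_g)_i>0$, $i\in I_g(\bar x,\bar y)$; and $G_i(\bar x+t_ku^k,\bar y+t_kv^k)>0$ if $(\nu_G)_i>0$, $i\in I_G(\bar x,\bar y)$. Then there exists $(\lambda_V,\lambda_g,\lambda_G)$ such that $$0\in\nabla F(\bar x,\bar y)+\lambda_V\nabla f(\bar x,\bar y)-\lambda_V\,\mathrm{co}(\Theta(\bar x;u))\times\{0\}+\nabla g(\bar x,\bar y)^T\lambda_g+\nabla G(\bar x,\bar y)^T\lambda_G,$$ $$\lambda_V\ge0,\ 0\le\lambda_g\perp g(\bar x,\bar y),\ \lambda_g\perp\nabla g(\bar x,\bar y)(u,v),\ 0\le\lambda_G\perp G(\bar x,\bar y),\ \lambda_G\perp\nabla G(\bar x,\bar y)(u,v).$$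
   Context: Let $F,f:\mathbb R^n\times\mathbb R^m\to\mathbb R$, $G:\mathbb R^n\times\mathbb R^m\to\mathbb R^q$, $g:\mathbb R^n\times\mathbb R^m\to\mathbb R^p$ be continuously differentiable. Let $S(x)$ be the set of optimal solutions of the lower level problem $\min_y f(x,y)$ s.t. $g(x,y)\le0$, and $V(x)=\inf_y\{f(x,y):g(x,y)\le0\}$. (BP): $\min_{x,y}F(x,y)$ s.t. $y\in S(x)$, $G(x,y)\le0$. $\mathrm{gph}$ denotes the graph, $\mathrm{co}$ the convex hull, $\{w\}^\perp$ the orthogonal complement. $I_g(x,y)=\{i:g_i(x,y)=0\}$, $I_G(x,y)=\{i:G_i(x,y)=0\}$; $\mathcal L(x,y;\lambda)=f(x,y)+g(x,y)^T\lambda$; $\Lambda(x,y)=\{\lambda\in\mathbb R^p:\nabla_y\mathcal L(x,y;\lambda)=0,\ g(x,y)^T\lambda=0,\ \lambda\ge0\}$; $\mathbb L(x,y;u)=\{w\in\mathbb R^m:\nabla g_i(x,y)(u,w)\le0\ \forall i\in I_g(x,y)\}$; $\Sigma(x,y,u):=\{w\in\mathbb L(x,y;u):V'(x;u)=\nabla f(x,y)(u,w)\}$; $S(\bar x;u)=\{y\in S(\bar x):\exists t_k\downarrow0,u^k\to u,y^k\to y,\ y^k\in S(\bar x+t_ku^k)\}$. $\mathbb B$ is the open unit ball, $\mathbb B_\epsilon(\cdot)$ the open ball of radius $\epsilon$. For a direction $d$ and $\epsilon,\delta>0$: $\mathcal V_{\epsilon,\delta}(d):=\{z\in\epsilon\mathbb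 B : \big\|\,\|d\|z-\|z\|d\,\big\|\le\delta\|z\|\|d\|\}$. $V'(\bar x;u)=\lim_{t\downarrow0}(V(\bar x+tu)-V(\bar x))/t$; $V$ is directionally differentiable at $\bar x$ in direction $u$ if this limit exists. $V$ is directionally Lipschitz continuous at $\bar x$ in direction $u$ if there are $L,\epsilon,\delta>0$ such that $V$ is finite and $|V(x)-V(x')|\le L\|x-x'\|$ for all $x,x'\in\bar x+\mathcal V_{\epsilon,\delta}(u)$. $(u,v)\in C(\bar x,\bar y)$ (critical cone) means $\nabla f(\bar x,\bar y)(u,v)\le V'(\bar x;u)$, $\nabla g_i(\bar x,\bar y)(u,v)\le0$ for $i\in I_g(\bar x,\bar y)$, $\nabla G_i(\bar x,\bar y)(u,v)\le0$ for $i\in I_G(\bar x,\bar y)$, and $\nabla F(\bar x,\bar y)(u,v)\le0$. Regular subdifferential: $\widehat\partial V(\bar x)=\{\xi:V(x)\ge V(\bar x)+\langle\xi,x-\bar x\rangle+o(\|x-\bar x\|)\}$. Directional limiting subdifferential: $\partial V(\bar x;u)=\{\xi:\exists t_k\downarrow0,u^k\to u,\xi^k\to\xi\text{ with }V(\bar x+t_ku^k)\to V(\bar x),\ \xi^k\in\widehat\partial V(\bar x+t_ku^k)\}$. RCR regularity of $\mathcal F$ at $(\bar x,\bar y)\in\mathrm{gph}\,\mathcal F$: there is $\delta>0$ such that for any $K\subseteq I_g(\bar x,\bar y)$ the family $\{\nabla_yg_j(x,y)\}_{j\in K}$ has the same rank at all $(x,y)\in\mathbb B_\delta(\bar x,\bar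 y)$. Robinson stability (RS) of $\mathcal F$ at $(\bar x,\bar y)\in\mathrm{gph}\,\mathcal F$ in direction $u$: there are $\kappa,\epsilon,\delta>0$ with $\mathrm{dist}(y,\mathcal F(x))\le\kappa\|g_+(x,y)\|$ for all $x\in\bar x+\mathcal V_{\epsilon,\delta}(u)$, $y\in\mathbb B_\epsilon(\bar y)$, where $g_+=\max\{0,g\}$ componentwise. Restricted inf-compactness at $\bar x$ in direction $u$ with compact set $\Omega_u\subseteq\mathbb R^m$: $V(\bar x)$ is finite and there are $\epsilon,\delta>0$ such that for all $x\in\bar x+\mathcal V_{\epsilon,\delta}(u)$ with $V(x)<V(\bar x)+\epsilon$ one has $S(x)\cap\Omega_u\ne\emptyset$. *)

theory Defs
  imports "HOL-Analysis.Analysis" "HOL-Library.Landau_Symbols"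
begin

section \<open>Differential calculus\<close>

text \<open>
  Functions on \<open>\<real>\<^sup>n \<times> \<real>\<^sup>m\<close> are uncurried, so that the product type carries the Euclidean norm of
  \<open>\<real>\<^sup>n\<^sup>+\<^sup>m\<close>. The number \<open>\<nabla>h(z)(u,w)\<close> (a vector if \<open>h\<close> is vector-valued) is
  \<open>frechet_derivative h (at z) (u, w)\<close>, and \<open>\<nabla>h(z)\<^sup>T \<nu>\<close> is
  \<open>adjoint (frechet_derivative h (at z)) \<nu>\<close>.
\<close>

definition cont_diff :: "('a::real_normed_vector \<Rightarrow> 'b::real_normed_vector) \<Rightarrow> bool" where
  "cont_diff h \<longleftrightarrow>
     (\<exists>h' :: 'a \<Rightarrow> 'a \<Rightarrow>\<^sub>L 'b. (\<forall>z. (h has_derivative blinfun_apply (h' z)) (at z)) \<and> continuous_on UNIV h')"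

definition grad :: "('a::real_inner \<Rightarrow> real) \<Rightarrow> 'a \<Rightarrow> 'a" where
  "grad h z = (THE D. GDERIV h z :> D)"

definition grad_x :: "('a::real_inner \<times> 'b \<Rightarrow> real) \<Rightarrow> 'a \<Rightarrow> 'b \<Rightarrow> 'a" where
  "grad_x h x y = grad (\<lambda>x'. h (x', y)) x"

definition grad_y :: "('a \<times> 'b::real_inner \<Rightarrow> real) \<Rightarrow> 'a \<Rightarrow> 'b \<Rightarrow> 'b" where
  "grad_y h x y = grad (\<lambda>y'. h (x, y')) y"

section \<open>Directional notions for extended-real-valued functions\<close>

definition is_minimum :: "'a::order set \<Rightarrow> 'a \<Rightarrow> bool" where
  "is_minimum A m \<longleftrightarrow> m \<in> A \<and> (\<forall>a\<in>A. m \<le> a)"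

definition is_maximum :: "'a::order set \<Rightarrow> 'a \<Rightarrow> bool" where
  "is_maximum A m \<longleftrightarrow> m \<in> A \<and> (\<forall>a\<in>A. a \<le> m)"

definition dir_nhd :: "real \<Rightarrow> real \<Rightarrow> 'a::real_normed_vector \<Rightarrow> 'a set" where
  "dir_nhd \<epsilon> \<delta> d =
     {z \<in> ball 0 \<epsilon>. norm (norm d *\<^sub>R z - norm z *\<^sub>R d) \<le> \<delta> * norm z * norm d}"

definition has_dir_deriv :: "('a::real_normed_vector \<Rightarrow> ereal) \<Rightarrow> ereal \<Rightarrow> 'a \<Rightarrow> 'a \<Rightarrow> bool" where
  "has_dir_deriv V D x u \<longleftrightarrow> ((\<lambda>t. (V (x + t *\<^sub>R u) - V x) / ereal t) \<longlongrightarrow> D) (at_right 0)"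

definition dir_deriv :: "('a::real_normed_vector \<Rightarrow> ereal) \<Rightarrow> 'a \<Rightarrow> 'a \<Rightarrow> ereal" where
  "dir_deriv V x u = (THE D. has_dir_deriv V D x u)"

definition dir_differentiable :: "('a::real_normed_vector \<Rightarrow> ereal) \<Rightarrow> 'a \<Rightarrow> 'a \<Rightarrow> bool" where
  "dir_differentiable V x u \<longleftrightarrow> (\<exists>d::real. has_dir_deriv V (ereal d) x u)"

definition dir_lipschitz :: "('a::real_normed_vector \<Rightarrow> ereal) \<Rightarrow> 'a \<Rightarrow> 'a \<Rightarrow> bool" where
  "dir_lipschitz V x u \<longleftrightarrow>
     (\<exists>L>0. \<exists>\<epsilon>>0. \<exists>\<delta>>0. \<forall>a \<in> (+) x ` dir_nhd \<epsilon> \<delta> u. \<bar>V a\<bar> \<noteq> \<infinity> \<and>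
        (\<forall>b \<in> (+) x ` dir_nhd \<epsilon> \<delta> u. \<bar>V a - V b\<bar> \<le> ereal (L * norm (a - b))))"

text \<open>The subdifferential is empty at points where the function is infinite.\<close>

definition regular_subdiff :: "('a::real_inner \<Rightarrow> ereal) \<Rightarrow> 'a \<Rightarrow> 'a set" where
  "regular_subdiff V x =
     {\<xi>. \<bar>V x\<bar> \<noteq> \<infinity> \<and>
         (\<exists>r \<in> o[at x](\<lambda>x'. norm (x' - x)).
            \<forall>\<^sub>F x' in at x. V x' \<ge> V x + ereal (\<xi> \<bullet> (x' - x) + r x'))}"

definition dir_limiting_subdiff :: "('a::real_inner \<Rightarrow> ereal) \<Rightarrow> 'a \<Rightarrow> 'a \<Rightarrow> 'a set" where
  "dir_limiting_subdiff V x u =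
     {\<xi>. \<exists>(t :: nat \<Rightarrow> real) us \<xi>s.
         (\<forall>k. t k > 0) \<and> t \<longlonglongrightarrow> 0 \<and> us \<longlonglongrightarrow> u \<and> \<xi>s \<longlonglongrightarrow> \<xi> \<and>
         (\<lambda>k. V (x + t k *\<^sub>R us k)) \<longlonglongrightarrow> V x \<and>
         (\<forall>k. \<xi>s k \<in> regular_subdiff V (x + t k *\<^sub>R us k))}"

section \<open>The lower level problem\<close>

definition gph :: "('a \<Rightarrow> 'b set) \<Rightarrow> ('a \<times> 'b) set" where
  "gph M = {(x, y). y \<in> M x}"

definition feas_map :: "('a \<times> 'b \<Rightarrow> real^'p) \<Rightarrow> 'a \<Rightarrow> 'b set" where
  "feas_map g x = {y. g (x, y) \<le> 0}"

definition sol_map :: "('a \<times> 'b \<Rightarrow> real) \<Rightarrow> ('a \<times> 'b \<Rightarrow> real^'p) \<Rightarrow> 'a \<Rightarrow> 'b set" where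
  "sol_map f g x = {y \<in> feas_map g x. \<forall>y' \<in> feas_map g x. f (x, y) \<le> f (x, y')}"

definition val_fun :: "('a \<times> 'b \<Rightarrow> real) \<Rightarrow> ('a \<times> 'b \<Rightarrow> real^'p) \<Rightarrow> 'a \<Rightarrow> ereal" where
  "val_fun f g x = (INF y \<in> feas_map g x. ereal (f (x, y)))"

definition active :: "('z \<Rightarrow> real^'p) \<Rightarrow> 'z \<Rightarrow> 'p set" where
  "active g z = {i. g z $ i = 0}"

definition lagrangian ::
    "('z \<Rightarrow> real) \<Rightarrow> ('z \<Rightarrow> real^'p) \<Rightarrow> real^'p \<Rightarrow> 'z \<Rightarrow> real" where
  "lagrangian f g \<mu> z = f z + g z \<bullet> \<mu>"

definition multipliers ::
    "('a \<times> 'b::real_inner \<Rightarrow> real) \<Rightarrow> ('a \<times> 'b \<Rightarrow> real^'p) \<Rightarrow> 'a \<Rightarrow> 'b \<Rightarrow> (real^'p) set" where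
  "multipliers f g x y =
     {\<mu>. grad_y (lagrangian f g \<mu>) x y = 0 \<and> g (x, y) \<bullet> \<mu> = 0 \<and> \<mu> \<ge> 0}"

definition lin_cone ::
    "('a::real_normed_vector \<times> 'b::real_normed_vector \<Rightarrow> real^'p) \<Rightarrow> 'a \<Rightarrow> 'b \<Rightarrow> 'a \<Rightarrow> 'b set" where
  "lin_cone g x y u =
     {w. \<forall>i \<in> active g (x, y). frechet_derivative g (at (x, y)) (u, w) $ i \<le> 0}"

definition Sigma_dir ::
    "('a::real_normed_vector \<times> 'b::real_normed_vector \<Rightarrow> real) \<Rightarrow> ('a \<times> 'b \<Rightarrow> real^'p) \<Rightarrow>
     'a \<Rightarrow> 'b \<Rightarrow> 'a \<Rightarrow> 'b set" where
  "Sigma_dir f g x y u =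
     {w \<in> lin_cone g x y u.
        dir_deriv (val_fun f g) x u = ereal (frechet_derivative f (at (x, y)) (u, w))}"

definition dir_sol ::
    "('a::real_normed_vector \<times> 'b::real_normed_vector \<Rightarrow> real) \<Rightarrow> ('a \<times> 'b \<Rightarrow> real^'p) \<Rightarrow>
     'a \<Rightarrow> 'a \<Rightarrow> 'b set" where
  "dir_sol f g x u =
     {y \<in> sol_map f g x. \<exists>(t :: nat \<Rightarrow> real) us ys.
        (\<forall>k. t k > 0) \<and> t \<longlonglongrightarrow> 0 \<and> us \<longlonglongrightarrow> u \<and> ys \<longlonglongrightarrow> y \<and>
        (\<forall>k. ys k \<in> sol_map f g (x + t k *\<^sub>R us k))}"

definition Theta ::
    "('a::euclidean_space \<times> 'b::euclidean_space \<Rightarrow> real) \<Rightarrow> ('a \<times> 'b \<Rightarrow> real^'p) \<Rightarrow>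
     'b set \<Rightarrow> 'a \<Rightarrow> 'a \<Rightarrow> 'a set" where
  "Theta f g \<Omega> x u =
     (\<Union>y \<in> dir_sol f g x u \<inter> \<Omega>. \<Union>w \<in> Sigma_dir f g x y u.
        {grad_x f x y + adjoint (frechet_derivative (\<lambda>x'. g (x', y)) (at x)) \<mu> | \<mu>.
           \<mu> \<in> multipliers f g x y \<inter> {frechet_derivative g (at (x, y)) (u, w)}\<^sup>\<bottom>})"

section \<open>Regularity conditions\<close>

definition RCR_regular ::
    "('a::euclidean_space \<times> 'b::euclidean_space \<Rightarrow> real^'p) \<Rightarrow> 'a \<Rightarrow> 'b \<Rightarrow> bool" where
  "RCR_regular g x y \<longleftrightarrow>
     (\<exists>\<delta>>0. \<forall>K \<subseteq> active g (x, y). \<exists>r. \<forall>(a, b) \<in> ball (x, y) \<delta>.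
        dim ((\<lambda>j. grad_y (\<lambda>z. g z $ j) a b) ` K) = r)"

text \<open>
  The distance to the empty set is \<open>+\<infinity>\<close> by convention, whereas \<open>infdist b {} = 0\<close>; hence the
  nonemptiness requirement.
\<close>

definition Robinson_stable ::
    "('a::euclidean_space \<times> 'b::euclidean_space \<Rightarrow> real^'p) \<Rightarrow> 'a \<Rightarrow> 'b \<Rightarrow> 'a \<Rightarrow> bool" where
  "Robinson_stable g x y u \<longleftrightarrow>
     (\<exists>\<kappa>>0. \<exists>\<epsilon>>0. \<exists>\<delta>>0. \<forall>a \<in> (+) x ` dir_nhd \<epsilon> \<delta> u. \<forall>b \<in> ball y \<epsilon>.
        feas_map g a \<noteq> {} \<and>
        infdist b (feas_map g a) \<le> \<kappa> * norm (\<chi> i. max 0 (g (a, b) $ i)))"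

definition restricted_inf_compact ::
    "('a::euclidean_space \<times> 'b::euclidean_space \<Rightarrow> real) \<Rightarrow> ('a \<times> 'b \<Rightarrow> real^'p) \<Rightarrow>
     'b set \<Rightarrow> 'a \<Rightarrow> 'a \<Rightarrow> bool" where
  "restricted_inf_compact f g \<Omega> x u \<longleftrightarrow>
     compact \<Omega> \<and> \<bar>val_fun f g x\<bar> \<noteq> \<infinity> \<and>
     (\<exists>\<epsilon>>0. \<exists>\<delta>>0. \<forall>a \<in> (+) x ` dir_nhd \<epsilon> \<delta> u.
        val_fun f g a < val_fun f g x + ereal \<epsilon> \<longrightarrow> sol_map f g a \<inter> \<Omega> \<noteq> {})"

section \<open>The bilevel program\<close>

definition bilevel_feasible ::
    "('a \<times> 'b \<Rightarrow> real) \<Rightarrow> ('a \<times> 'b \<Rightarrow> real^'p) \<Rightarrow> ('a \<times> 'b \<Rightarrow> real^'q) \<Rightarrow> ('a \<times> 'b) set" where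
  "bilevel_feasible f g G = {(x, y). y \<in> sol_map f g x \<and> G (x, y) \<le> 0}"

definition bilevel_local_min ::
    "('a::metric_space \<times> 'b::metric_space \<Rightarrow> real) \<Rightarrow> ('a \<times> 'b \<Rightarrow> real) \<Rightarrow> ('a \<times> 'b \<Rightarrow> real^'p) \<Rightarrow>
     ('a \<times> 'b \<Rightarrow> real^'q) \<Rightarrow> 'a \<Rightarrow> 'b \<Rightarrow> bool" where
  "bilevel_local_min F f g G x y \<longleftrightarrow>
     (x, y) \<in> bilevel_feasible f g G \<and>
     (\<exists>\<epsilon>>0. \<forall>z \<in> bilevel_feasible f g G \<inter> ball (x, y) \<epsilon>. F (x, y) \<le> F z)"

definition critical_cone ::
    "('a::real_normed_vector \<times> 'b::real_normed_vector \<Rightarrow> real) \<Rightarrow> ('a \<times> 'b \<Rightarrow> real) \<Rightarrow>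
     ('a \<times> 'b \<Rightarrow> real^'p) \<Rightarrow> ('a \<times> 'b \<Rightarrow> real^'q) \<Rightarrow> 'a \<Rightarrow> 'b \<Rightarrow> ('a \<times> 'b) set" where
  "critical_cone F f g G x y =
     {(u, v).
        ereal (frechet_derivative f (at (x, y)) (u, v)) \<le> dir_deriv (val_fun f g) x u \<and>
        (\<forall>i \<in> active g (x, y). frechet_derivative g (at (x, y)) (u, v) $ i \<le> 0) \<and>
        (\<forall>i \<in> active G (x, y). frechet_derivative G (at (x, y)) (u, v) $ i \<le> 0) \<and>
        frechet_derivative F (at (x, y)) (u, v) \<le> 0}"

end

theory Submission
  imports Defs
begin

text \<open>
  By Robinson stability and inf-compactness, \<open>f + C \<Sum>\<^sub>i max 0 g\<^sub>i\<close> with one constant \<open>C\<close> majorizes \<open>V\<close>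
  near the lower level solutions over a directional neighbourhood. Hence \<open>V\<close> is Lipschitz there, and
  separating a box of multipliers from a half line bounds every upper difference quotient of \<open>V\<close> by
  \<open>\<nabla>\<^sub>xL u\<close> for a multiplier bounded by \<open>C\<close>.

  The constant rank condition gives the matching lower bound. Suppose \<open>y\<^sub>k \<in> S(x + t\<^sub>k u\<^sub>k)\<close> tends to \<open>y\<close>.
  One wants \<open>w\<close> such that \<open>y\<^sub>k - t\<^sub>k w\<close> is feasible at \<open>x\<close> up to \<open>o(t\<^sub>k)\<close>, although \<open>(y\<^sub>k - y) / t\<^sub>k\<close> may be
  unbounded. This is a finite system of linear inequalities for \<open>w\<close>. If it has no solution, then a Farkas
  certificate of minimal support is a circuit of partial gradients, which by constant rank persists near
  \<open>(x, y)\<close>; integrating it along a segment in suitable coordinates contradicts the feasibility of \<open>y\<^sub>k\<close>.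

  Limits of the gradients \<open>\<nabla>\<^sub>xL\<close> at such \<open>y\<^sub>k\<close> with bounded multipliers lie in \<open>\<Theta>\<close>, and they control
  increments of \<open>V\<close> through a mean value theorem of Rolle type. For the bilevel program one minimizes a
  quadratic penalty near the ray in direction \<open>(u, v)\<close>: either the residual is an exact penalty there and
  the limiting multipliers are normal, or normalized multipliers converge to an excluded abnormal one.
\<close>

section \<open>Continuously differentiable functions and linear inequalities\<close>

text \<open>No Lipschitz bound on the solution map is available, so solutions y_k may leave y at a
  speed far above t_k. The lower estimates of \<open>V\<close> therefore compare y_k with the
  shifted point y_k - t_k w, where only differences of \<open>f\<close> and \<open>g\<close> between
  two nearby moving points matter; strict differentiability handles these. The same w annihilates
  the penalty term in the upper estimate along every other sequence, which forces all limits of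
  difference quotients to agree, also when the directions vary. The orthogonality in \<Theta> has
  this origin: a multiplier that is positive in the limit marks a constraint active along a whole
  tail, and on such constraints the derivative in direction (u, w) is exactly 0. The uniform
  constant matters because it bounds multipliers: \<Theta> allows unbounded ones, whereas limits
  with bounded ones form a compact set whose convex hull can be separated from a point. In the
  bilevel part every auxiliary minimizer has to stay within o(t) of the ray, since otherwise both
  the direction and the orthogonality conditions are lost.\<close>

definition C1 :: "('z::euclidean_space \<Rightarrow> real) \<Rightarrow> ('z \<Rightarrow> 'z) \<Rightarrow> bool" where
  "C1 h dh \<longleftrightarrow> (\<forall>z. (h has_derivative (\<lambda>k. dh z \<bullet> k)) (at z)) \<and> continuous_on UNIV dh"

lemma C1_has_derivative: "C1 h dh \<Longrightarrow> (h has_derivative (\<lambda>k. dh z \<bullet> k)) (at z within A)"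
  unfolding C1_def by (blast intro: has_derivative_at_withinI)

lemma C1_continuous: "C1 h dh \<Longrightarrow> continuous_on A h"
  by (meson C1_has_derivative has_derivative_continuous_on)

lemma C1_tendsto: "C1 h dh \<Longrightarrow> (X \<longlongrightarrow> z) F' \<Longrightarrow> ((\<lambda>k. h (X k)) \<longlongrightarrow> h z) F'"
  using C1_continuous[of h dh UNIV] by (metis UNIV_I continuous_on_eq_continuous_at isCont_tendsto_compose open_UNIV)

lemma C1_grad_tendsto: "C1 h dh \<Longrightarrow> (X \<longlongrightarrow> z) F' \<Longrightarrow> ((\<lambda>k. dh (X k)) \<longlongrightarrow> dh z) F'"
  unfolding C1_def by (metis UNIV_I continuous_on_eq_continuous_at isCont_tendsto_compose open_UNIV)

lemma C1_mean_value:
  assumes "C1 h dh"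
  obtains p where "p \<in> closed_segment a b" "h b - h a = dh p \<bullet> (b - a)"
proof -
  let ?\<gamma> = "\<lambda>s::real. a + s *\<^sub>R (b - a)"
  have "((\<lambda>s. h (?\<gamma> s)) has_derivative (\<lambda>s. dh (?\<gamma> x) \<bullet> (s *\<^sub>R (b - a)))) (at x within {0..1})" for x
  proof (rule has_derivative_compose[where g = h and f = ?\<gamma>, OF _ C1_has_derivative[OF assms]])
    show "(?\<gamma> has_derivative (\<lambda>s. s *\<^sub>R (b - a))) (at x within {0..1})"
      by (auto intro!: derivative_eq_intros)
  qed
  then have "\<exists>x\<in>{0<..<1}. h (?\<gamma> 1) - h (?\<gamma> 0) = dh (?\<gamma> x) \<bullet> ((1 - 0) *\<^sub>R (b - a))"
    by (intro mvt_simple) auto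
  then obtain x where x: "0 < x" "x < 1" and eq: "h b - h a = dh (?\<gamma> x) \<bullet> (b - a)" by auto
  show ?thesis
    by (rule that[OF _ eq]) (use x in \<open>auto simp: closed_segment_def algebra_simps intro!: exI[of _ x]\<close>)
qed

lemma segment_tendsto:
  fixes p :: "nat \<Rightarrow> 'a::real_normed_vector"
  assumes "\<And>k. p k \<in> closed_segment (a k) (b k)" "a \<longlonglongrightarrow> z" "b \<longlonglongrightarrow> z"
  shows "p \<longlonglongrightarrow> z"
proof (rule Lim_null_comparison[THEN LIM_zero_cancel])
  have "norm (p k - z) \<le> norm (a k - z) + norm (b k - z)" for k
  proof -
    obtain s where s: "0 \<le> s" "s \<le> 1" "p k = (1 - s) *\<^sub>R a k + s *\<^sub>R b k"
      using assms(1)[of k] by (auto simp: closed_segment_def)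
    have "p k - z = (1 - s) *\<^sub>R (a k - z) + s *\<^sub>R (b k - z)" unfolding s by (simp add: algebra_simps)
    then have "norm (p k - z) \<le> (1 - s) * norm (a k - z) + s * norm (b k - z)"
      by (metis norm_triangle_ineq norm_scaleR abs_of_nonneg s(1,2) diff_ge_0_iff_ge)
    also have "\<dots> \<le> 1 * norm (a k - z) + 1 * norm (b k - z)"
      by (intro add_mono mult_right_mono) (use s in auto)
    finally show ?thesis by simp
  qed
  then show "\<forall>\<^sub>F k in sequentially. norm (p k - z) \<le> norm (a k - z) + norm (b k - z)" by simp
  show "(\<lambda>k. norm (a k - z) + norm (b k - z)) \<longlonglongrightarrow> 0"
    using tendsto_add[OF tendsto_norm_zero[OF LIM_zero[OF assms(2)]] tendsto_norm_zero[OF LIM_zero[OF assms(3)]]]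
    by simp
qed

text \<open>The mean value points between \<open>a k\<close> and \<open>b k\<close> are squeezed to
  \<open>z\<close>, so continuity of the gradient suffices although both end points move.\<close>

lemma C1_strict_derivative:
  assumes "C1 h dh" "a \<longlonglongrightarrow> z" "b \<longlonglongrightarrow> z" "(\<lambda>k. (b k - a k) /\<^sub>R t k) \<longlonglongrightarrow> \<delta>"
  shows "(\<lambda>k. (h (b k) - h (a k)) / t k) \<longlonglongrightarrow> dh z \<bullet> \<delta>"
proof -
  have "\<exists>p. p \<in> closed_segment (a k) (b k) \<and> h (b k) - h (a k) = dh p \<bullet> (b k - a k)" for k
    using C1_mean_value[OF assms(1)] by metis
  then obtain p where p: "\<And>k. p k \<in> closed_segment (a k) (b k)"
    and eq: "\<And>k. h (b k) - h (a k) = dh (p k) \<bullet> (b k - a k)" by metis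
  have "p \<longlonglongrightarrow> z" by (rule segment_tendsto[OF p assms(2,3)])
  then have "(\<lambda>k. dh (p k) \<bullet> ((b k - a k) /\<^sub>R t k)) \<longlonglongrightarrow> dh z \<bullet> \<delta>"
    by (intro tendsto_inner C1_grad_tendsto[OF assms(1)] assms(4))
  then show ?thesis by (simp add: eq divide_inverse mult.commute)
qed

lemma C1_lipschitz_on_compact:
  assumes "C1 h dh" "compact K" "convex K"
  obtains L where "L > 0" "\<And>a b. a \<in> K \<Longrightarrow> b \<in> K \<Longrightarrow> \<bar>h a - h b\<bar> \<le> L * norm (a - b)"
proof -
  have "compact (dh ` K)"
    using assms(1,2) unfolding C1_def by (meson compact_continuous_image continuous_on_subset subset_UNIV)
  then obtain L where L: "L > 0" "\<And>x. x \<in> K \<Longrightarrow> norm (dh x) \<le> L"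
    by (metis bounded_pos compact_imp_bounded imageI)
  show ?thesis
  proof (rule that[OF L(1)])
    fix a b assume ab: "a \<in> K" "b \<in> K"
    obtain p where p: "p \<in> closed_segment b a" "h a - h b = dh p \<bullet> (a - b)"
      using C1_mean_value[OF assms(1)] by metis
    then have "p \<in> K" using ab assms(3) closed_segment_subset by blast
    have "\<bar>h a - h b\<bar> \<le> norm (dh p) * norm (a - b)" unfolding p by (rule Cauchy_Schwarz_ineq2)
    also have "\<dots> \<le> L * norm (a - b)" by (intro mult_right_mono L \<open>p \<in> K\<close>) auto
    finally show "\<bar>h a - h b\<bar> \<le> L * norm (a - b)" .
  qed
qed

text \<open>The minimality of the support is what makes the relation unique up to scaling.\<close>

lemma farkas_circuit:
  fixes A :: "'i \<Rightarrow> 'a::euclidean_space" and b :: "'i \<Rightarrow> real"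
  assumes fin: "finite N" and infeas: "\<not> (\<exists>w. \<forall>i\<in>N. A i \<bullet> w \<le> b i)"
  obtains C c where "C \<subseteq> N" "\<And>i. i \<in> C \<Longrightarrow> c i > 0" "(\<Sum>i\<in>C. c i *\<^sub>R A i) = 0"
    "(\<Sum>i\<in>C. c i * b i) < 0"
    "\<And>d. (\<Sum>i\<in>C. d i *\<^sub>R A i) = 0 \<Longrightarrow> \<exists>r. \<forall>i\<in>C. d i = r * c i"
proof -
  \<comment> \<open>Appending the right-hand side as a last coordinate turns a certificate of
    infeasibility into membership of \<open>(0, -1)\<close> in the cone generated by the lifted
    rows.\<close>
  define B where "B = (\<lambda>i. (A i, b i))"
  define K where "K = convex_cone hull (B ` N)"
  define rep where "rep = (\<lambda>C c. C \<subseteq> N \<and> (\<forall>i\<in>C. c i \<ge> 0) \<and> (\<Sum>i\<in>C. c i *\<^sub>R B i) = (0, -1::real))"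
  have K: "convex K" "closed K" "conic K" "0 \<in> K"
    unfolding K_def using fin by (auto simp: convex_convex_cone_hull closed_convex_cone_hull
        conic_convex_cone_hull convex_cone_hull_contains_0)
  \<comment> \<open>A closed cone that misses \<open>(0, -1)\<close> can be separated from it; the
    normal \<open>(a, s)\<close> has \<open>s > 0\<close> and is nonnegative on all generators, so
    \<open>- (a /\<^sub>R s)\<close> would solve the system.\<close>
  have "(0, -1) \<in> K"
  proof (rule ccontr)
    assume "(0, -1) \<notin> K"
    then obtain a s \<beta> where sep: "(a, s) \<bullet> (0, -1) < \<beta>" "\<And>x. x \<in> K \<Longrightarrow> (a, s) \<bullet> x > \<beta>"
      using separating_hyperplane_closed_point[OF K(1,2)] by (metis prod.exhaust)
    have "\<beta> < 0" using sep(2)[OF K(4)] by simp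
    then have s: "s > 0" using sep(1) by simp
    have "(a, s) \<bullet> B i \<ge> 0" if "i \<in> N" for i
    proof (rule ccontr)
      assume neg: "\<not> (a, s) \<bullet> B i \<ge> 0"
      let ?r = "\<beta> / ((a, s) \<bullet> B i)"
      have "B i \<in> K" unfolding K_def by (intro hull_inc imageI that)
      then have "?r *\<^sub>R B i \<in> K" using K(3) neg \<open>\<beta> < 0\<close>
        by (intro conic_mul) (auto simp: divide_nonpos_neg)
      from sep(2)[OF this] neg show False by simp
    qed
    then have "- (a \<bullet> A i) \<le> s * b i" if "i \<in> N" for i
      using that by (force simp: B_def)
    then have "\<forall>i\<in>N. A i \<bullet> (- (a /\<^sub>R s)) \<le> b i"
      using s by (auto simp: inner_commute field_simps)
    with infeas show False by blast
  qed
  also have "K = {\<Sum>i\<in>N. c i *\<^sub>R B i | c. \<forall>i\<in>N. c i \<ge> 0}" (is "_ = ?M")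
  proof
    show "K \<subseteq> ?M" unfolding K_def
    proof (rule hull_minimal)
      show "B ` N \<subseteq> ?M"
      proof
        fix x assume "x \<in> B ` N"
        then obtain j where j: "j \<in> N" "x = B j" by auto
        have "x = (\<Sum>i\<in>N. (if i = j then 1 else 0) *\<^sub>R B i)"
          using j fin by (subst sum.cong[OF refl, where h = "\<lambda>i. if i = j then B i else 0"]) auto
        then show "x \<in> ?M" by (auto intro!: exI[of _ "\<lambda>i. if i = j then 1 else 0"])
      qed
      show "convex_cone ?M" unfolding convex_cone_iff
      proof (intro conjI ballI allI impI)
        show "0 \<in> ?M" by (auto intro!: exI[of _ "\<lambda>_. 0"])
        fix x assume "x \<in> ?M"
        then obtain c where c: "x = (\<Sum>i\<in>N. c i *\<^sub>R B i)" "\<forall>i\<in>N. c i \<ge> 0" by auto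
        { fix y assume "y \<in> ?M"
          then obtain c' where c': "y = (\<Sum>i\<in>N. c' i *\<^sub>R B i)" "\<forall>i\<in>N. c' i \<ge> 0" by auto
          show "x + y \<in> ?M" using c c'
            by (auto intro!: exI[of _ "\<lambda>i. c i + c' i"] simp: scaleR_left_distrib sum.distrib) }
        fix r :: real assume "r \<ge> 0"
        then show "r *\<^sub>R x \<in> ?M" using c
          by (auto intro!: exI[of _ "\<lambda>i. r * c i"] simp: scaleR_right.sum)
      qed
    qed
    show "?M \<subseteq> K"
    proof
      fix x assume "x \<in> ?M"
      then obtain c where c: "x = (\<Sum>i\<in>N. c i *\<^sub>R B i)" "\<forall>i\<in>N. c i \<ge> 0" by auto
      have "convex_cone K" using K by (auto simp: convex_cone_def)
      have "(\<Sum>i\<in>M. c i *\<^sub>R B i) \<in> K" if "M \<subseteq> N" for M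
        using finite_subset[OF that fin] that
      proof (induction M rule: finite_induct)
        case (insert i M)
        have "B i \<in> K" unfolding K_def by (intro hull_inc imageI) (use insert in auto)
        then show ?case using insert c \<open>convex_cone K\<close>
          by (auto intro!: convex_cone_add convex_cone_scaleR)
      qed (simp add: K)
      then show "x \<in> K" unfolding c(1) by blast
    qed
  qed
  finally obtain c0 where "rep N c0" by (auto simp: rep_def)
  then obtain C where C: "\<exists>c. rep C c" "\<And>C'. \<exists>c. rep C' c \<Longrightarrow> card C \<le> card C'"
    using ex_has_least_nat[of "\<lambda>C. \<exists>c. rep C c" N card] by blast
  then obtain c where c: "rep C c" by blast
  then have CN: "C \<subseteq> N" and cnn: "\<And>i. i \<in> C \<Longrightarrow> c i \<ge> 0"
    and csum: "(\<Sum>i\<in>C. c i *\<^sub>R B i) = (0, -1::real)" by (auto simp: rep_def)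
  have finC: "finite C" using CN fin finite_subset by blast
  have shrink: False if "rep C c'" "j \<in> C" "c' j = 0" for c' j
  proof -
    have "(\<Sum>i\<in>C. c' i *\<^sub>R B i) = (\<Sum>i\<in>C-{j}. c' i *\<^sub>R B i)"
      using that finC by (simp add: sum.remove)
    then have "rep (C - {j}) c'" using that by (auto simp: rep_def)
    then have "card C \<le> card (C - {j})" using C(2) by blast
    then show False using that finC by (metis card_Diff1_less linorder_not_less)
  qed
  have cpos: "c i > 0" if "i \<in> C" for i
    using shrink[OF c that] cnn[OF that] by fastforce
  \<comment> \<open>Subtracting the largest multiple of \<open>e\<close> that keeps all coefficients
    nonnegative makes one of them vanish, which minimality of the support forbids. So a lifted
    relation has no positive coefficient and, by passing to its negative, no negative one
    either.\<close>
  have nodep: "\<not> e i > 0" if e: "(\<Sum>i\<in>C. e i *\<^sub>R B i) = 0" and "i \<in> C" for e i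
  proof
    assume "e i > 0"
    let ?P = "{i \<in> C. e i > 0}"
    define \<theta> where "\<theta> = Min ((\<lambda>i. c i / e i) ` ?P)"
    have ne: "?P \<noteq> {}" "finite ?P" using \<open>e i > 0\<close> \<open>i \<in> C\<close> finC by auto
    then have "\<theta> \<in> (\<lambda>i. c i / e i) ` ?P" unfolding \<theta>_def by (intro Min_in) auto
    then obtain j where j: "j \<in> C" "e j > 0" "\<theta> = c j / e j" by auto
    have \<theta>0: "\<theta> \<ge> 0" using j cpos by (simp add: less_imp_le)
    have "c i - \<theta> * e i \<ge> 0" if "i \<in> C" for i
    proof (cases "e i > 0")
      case True
      then have "\<theta> \<le> c i / e i" unfolding \<theta>_def using ne that by (intro Min_le) auto
      then show ?thesis using True by (simp add: field_simps)
    next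
      case False
      then have "\<theta> * e i \<le> 0" using \<theta>0 by (simp add: mult_nonneg_nonpos)
      then show ?thesis using cpos[OF that] by linarith
    qed
    moreover have "(\<Sum>i\<in>C. (c i - \<theta> * e i) *\<^sub>R B i) = (0, -1)"
    proof -
      have "(\<Sum>i\<in>C. (c i - \<theta> * e i) *\<^sub>R B i) = (\<Sum>i\<in>C. c i *\<^sub>R B i) - \<theta> *\<^sub>R (\<Sum>i\<in>C. e i *\<^sub>R B i)"
        by (simp add: scaleR_left_diff_distrib sum_subtractf scaleR_right.sum)
      then show ?thesis using csum e by simp
    qed
    ultimately have "rep C (\<lambda>i. c i - \<theta> * e i)" using CN by (auto simp: rep_def)
    from shrink[OF this j(1)] show False using j(2,3) by simp
  qed
  have cA: "(\<Sum>i\<in>C. c i *\<^sub>R A i) = 0" and cb: "(\<Sum>i\<in>C. c i * b i) = -1"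
    using arg_cong[OF csum, of fst] arg_cong[OF csum, of snd] by (auto simp: B_def fst_sum snd_sum)
  show ?thesis
  proof (rule that[OF CN cpos cA])
    show "(\<Sum>i\<in>C. c i * b i) < 0" using cb by simp
    fix d assume d: "(\<Sum>i\<in>C. d i *\<^sub>R A i) = 0"
    \<comment> \<open>The certificate has value -1, so adding \<open>s\<close> times it to
      \<open>d\<close> cancels the last coordinate. The lifted relation \<open>?e\<close> must then
      vanish, that is, \<open>d\<close> is \<open>-s\<close> times \<open>c\<close>.\<close>
    define s where "s = (\<Sum>i\<in>C. d i * b i)"
    let ?e = "\<lambda>i. d i + s * c i"
    have "(\<Sum>i\<in>C. ?e i *\<^sub>R A i) = (\<Sum>i\<in>C. d i *\<^sub>R A i) + s *\<^sub>R (\<Sum>i\<in>C. c i *\<^sub>R A i)"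
      by (simp add: scaleR_left_distrib sum.distrib scaleR_right.sum)
    moreover have "(\<Sum>i\<in>C. ?e i * b i) = s + s * (\<Sum>i\<in>C. c i * b i)"
      by (simp add: s_def distrib_right sum.distrib sum_distrib_left mult.assoc)
    ultimately have e0: "(\<Sum>i\<in>C. ?e i *\<^sub>R B i) = 0"
      using d cA cb by (simp add: B_def prod_eq_iff fst_sum snd_sum)
    then have e1: "(\<Sum>i\<in>C. (- ?e i) *\<^sub>R B i) = 0"
      using sum_negf[of "\<lambda>i. ?e i *\<^sub>R B i" C] by (simp only: scaleR_minus_left minus_zero)
    have "?e i = 0" if "i \<in> C" for i
      using nodep[OF e0 that] nodep[OF e1 that] by linarith
    then have "\<forall>i\<in>C. d i = (-s) * c i" by (simp add: eq_neg_iff_add_eq_0)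
    then show "\<exists>r. \<forall>i\<in>C. d i = r * c i" by blast
  qed simp
qed

text \<open>Over multipliers in \<open>[0, C]\<close> a linear function is maximized by taking
  \<open>C\<close> exactly where its coefficient is positive, so the right-hand side of
  \<open>bound\<close> is a support function of the set of values of the two sums. The bound thus
  says that no hyperplane separates this set from the half line above \<open>D\<close> over the
  origin.\<close>

lemma box_multiplier:
  fixes A :: "'i \<Rightarrow> 'a::euclidean_space" and a :: "'i \<Rightarrow> real" and \<phi> :: 'a
  assumes fin: "finite I" and C: "C \<ge> 0"
    and bound: "\<And>w. D \<le> \<phi> \<bullet> w + C * (\<Sum>i\<in>I. max 0 (A i \<bullet> w + a i))"
  obtains \<mu> where "\<And>i. 0 \<le> \<mu> i" "\<And>i. \<mu> i \<le> C" "\<And>i. i \<notin> I \<Longrightarrow> \<mu> i = 0" "\<phi> + (\<Sum>i\<in>I. \<mu> i *\<^sub>R A i) = 0"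
    "D \<le> (\<Sum>i\<in>I. \<mu> i * a i)"
proof -
  define seg where "seg = (\<lambda>i. (\<lambda>s. s *\<^sub>R (A i, a i)) ` {0..C})"
  define Z where "Z = (\<lambda>J. {(\<phi>, 0::real) + (\<Sum>i\<in>J. \<mu> i *\<^sub>R (A i, a i)) | \<mu>. \<forall>i\<in>J. \<mu> i \<in> {0..C}})"
  have segs: "compact (seg i)" "convex (seg i)" for i
    unfolding seg_def
    by (auto intro!: compact_continuous_image continuous_intros convex_linear_image
        simp: linear_scaleR_left linear_iff scaleR_left_distrib distrib_right)
  \<comment> \<open>\<open>Z J\<close> is a translated sum of segments, so compactness and convexity
    follow by adding one segment at a time.\<close>
  have Z: "compact (Z J) \<and> convex (Z J)" if "J \<subseteq> I" for J
    using finite_subset[OF that fin]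
  proof (induction J rule: finite_induct)
    case empty then show ?case by (simp add: Z_def)
  next
    case (insert j J)
    have "Z (insert j J) = {x + y | x y. x \<in> Z J \<and> y \<in> seg j}"
    proof (intro equalityI subsetI)
      fix x assume "x \<in> Z (insert j J)"
      then obtain \<mu> where "\<forall>i\<in>insert j J. \<mu> i \<in> {0..C}"
        "x = (\<phi>, 0) + (\<Sum>i\<in>insert j J. \<mu> i *\<^sub>R (A i, a i))" by (auto simp: Z_def)
      then show "x \<in> {x + y | x y. x \<in> Z J \<and> y \<in> seg j}" using insert
        by (intro CollectI exI[of _ "(\<phi>, 0) + (\<Sum>i\<in>J. \<mu> i *\<^sub>R (A i, a i))"] exI[of _ "\<mu> j *\<^sub>R (A j, a j)"])
          (auto simp: Z_def seg_def algebra_simps simp del: scaleR_Pair)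
    next
      fix z assume "z \<in> {x + y | x y. x \<in> Z J \<and> y \<in> seg j}"
      then obtain x y where z: "z = x + y" "x \<in> Z J" "y \<in> seg j" by blast
      then obtain \<mu> s where \<mu>: "\<forall>i\<in>J. \<mu> i \<in> {0..C}" "x = (\<phi>, 0) + (\<Sum>i\<in>J. \<mu> i *\<^sub>R (A i, a i))"
        and s: "s \<in> {0..C}" "y = s *\<^sub>R (A j, a j)" by (auto simp: Z_def seg_def)
      have "(\<Sum>i\<in>J. (\<mu>(j := s)) i *\<^sub>R (A i, a i)) = (\<Sum>i\<in>J. \<mu> i *\<^sub>R (A i, a i))"
        by (rule sum.cong) (use insert in auto)
      then show "z \<in> Z (insert j J)" using insert \<mu> s z(1) unfolding Z_def
        by (intro CollectI exI[of _ "\<mu>(j := s)"])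
          (auto simp: algebra_simps simp del: scaleR_Pair)
    qed
    moreover have "{x + y | x y. x \<in> Z J \<and> y \<in> seg j} = (\<Union>x\<in>Z J. \<Union>y\<in>seg j. {x + y})" by blast
    ultimately show ?case using insert segs[of j] compact_sums[of "Z J" "seg j"] convex_sums[of "Z J" "seg j"] by simp
  qed
  define T where "T = {0::'a} \<times> {D..}"
  have T: "closed T" "convex T" unfolding T_def by (auto intro: closed_Times convex_Times)
  have "(\<phi>, 0) + (\<Sum>i\<in>I. 0 *\<^sub>R (A i, a i)) \<in> Z I"
    unfolding Z_def using C by (intro CollectI exI[of _ "\<lambda>_. 0"]) simp
  then have "Z I \<noteq> {}" by blast
  have "Z I \<inter> T \<noteq> {}"
  proof
    assume "Z I \<inter> T = {}"
    then obtain w r \<beta> where sep: "\<And>x. x \<in> Z I \<Longrightarrow> (w, r) \<bullet> x < \<beta>" "\<And>x. x \<in> T \<Longrightarrow> (w, r) \<bullet> x > \<beta>"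
      using separating_hyperplane_compact_closed[of "Z I" T] Z[of I] T \<open>Z I \<noteq> {}\<close>
      by (metis order_refl prod.exhaust)
    \<comment> \<open>\<open>?S w r\<close> is the support function of \<open>Z I\<close> at
      \<open>(w, r)\<close>; the multiplier chosen in the next step attains it.\<close>
    let ?S = "\<lambda>w r. \<phi> \<bullet> w + C * (\<Sum>i\<in>I. max 0 (A i \<bullet> w + r * a i))"
    have up: "?S w r < \<beta>"
    proof -
      define \<mu> where "\<mu> = (\<lambda>i. if A i \<bullet> w + r * a i > 0 then C else 0)"
      have "(\<phi>, 0) + (\<Sum>i\<in>I. \<mu> i *\<^sub>R (A i, a i)) \<in> Z I"
        unfolding Z_def using C by (auto simp: \<mu>_def simp del: scaleR_Pair)
      from sep(1)[OF this] have "\<phi> \<bullet> w + (\<Sum>i\<in>I. \<mu> i * (A i \<bullet> w + r * a i)) < \<beta>"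
        by (simp add: inner_add_right inner_sum_right inner_commute distrib_left sum.distrib fst_sum snd_sum
            sum_distrib_left mult.left_commute)
      moreover have "(\<Sum>i\<in>I. \<mu> i * (A i \<bullet> w + r * a i)) = C * (\<Sum>i\<in>I. max 0 (A i \<bullet> w + r * a i))"
        unfolding sum_distrib_left by (rule sum.cong) (auto simp: \<mu>_def)
      ultimately show ?thesis by simp
    qed
    have low: "r * s > \<beta>" if "s \<ge> D" for s using sep(2)[of "(0, s)"] that by (auto simp: T_def)
    \<comment> \<open>The half line is unbounded above, so a functional bounded below on it cannot
      decrease along it.\<close>
    have "r \<ge> 0"
    proof (rule ccontr)
      assume "\<not> r \<ge> 0"
      then have "r * max D (\<beta> / r) \<le> r * (\<beta> / r)" by (intro mult_left_mono_neg) auto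
      then show False using low[of "max D (\<beta> / r)"] \<open>\<not> r \<ge> 0\<close> by simp
    qed
    show False
    proof (cases "r = 0")
      case False
      with \<open>r \<ge> 0\<close> have "r > 0" by simp
      have "r * ?S (w /\<^sub>R r) 1 = \<phi> \<bullet> w + C * (\<Sum>i\<in>I. r * max 0 (A i \<bullet> (w /\<^sub>R r) + a i))"
        using \<open>r > 0\<close> by (simp add: distrib_left sum_distrib_left mult.left_commute)
      also have "\<dots> = ?S w r"
        using \<open>r > 0\<close> by (simp add: max_mult_distrib_left distrib_left mult.assoc[symmetric])
      finally have "r * ?S (w /\<^sub>R r) 1 < r * D" using up low[of D] by simp
      moreover have "r * D \<le> r * ?S (w /\<^sub>R r) 1" using bound[of "w /\<^sub>R r"] \<open>r > 0\<close> by (intro mult_left_mono) auto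
      ultimately show False by linarith
    next
      \<comment> \<open>A horizontal normal is excluded by moving far along \<open>w\<close>: the
        slope \<open>?S w 0\<close> is below \<open>\<beta> < 0\<close>, while the offsets
        \<open>a i\<close> contribute at most the constant \<open>q\<close>.\<close>
      case True
      then have b0: "\<beta> < 0" using low[of D] by simp
      define q where "q = C * (\<Sum>i\<in>I. max 0 (a i))"
      have "D \<le> s * \<beta> + q" if "s > 0" for s
      proof -
        have sub: "max 0 (s * x + y) \<le> s * max 0 x + max 0 y" for x y
        proof -
          have "s * x \<le> s * max 0 x" "0 \<le> s * max 0 x" using that by (auto intro!: mult_left_mono)
          moreover have "y \<le> max 0 y" "0 \<le> max 0 y" by auto
          ultimately show ?thesis by (intro max.boundedI) linarith+
        qed
        have "D \<le> \<phi> \<bullet> (s *\<^sub>R w) + C * (\<Sum>i\<in>I. max 0 (A i \<bullet> (s *\<^sub>R w) + a i))" by (rule bound)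
        also have "\<dots> \<le> \<phi> \<bullet> (s *\<^sub>R w) + C * (\<Sum>i\<in>I. s * max 0 (A i \<bullet> w) + max 0 (a i))"
          using C sub by (intro add_left_mono mult_left_mono sum_mono) auto
        also have "\<dots> = s * ?S w 0 + q"
          by (simp add: q_def sum.distrib distrib_left sum_distrib_left mult.left_commute)
        also have "\<dots> \<le> s * \<beta> + q" using up True that by simp
        finally show ?thesis .
      qed
      moreover have "(\<bar>D\<bar> + \<bar>q\<bar> + 1) / - \<beta> > 0" using b0 by (intro divide_pos_pos) linarith+
      ultimately have "D \<le> (\<bar>D\<bar> + \<bar>q\<bar> + 1) / - \<beta> * \<beta> + q" by blast
      also have "\<dots> = - (\<bar>D\<bar> + \<bar>q\<bar> + 1) + q" using b0 by simp
      finally show False by linarith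
    qed
  qed
  then obtain \<mu> where \<mu>: "\<forall>i\<in>I. \<mu> i \<in> {0..C}" "(\<phi>, 0) + (\<Sum>i\<in>I. \<mu> i *\<^sub>R (A i, a i)) \<in> T"
    by (auto simp: Z_def)
  have sums: "(\<Sum>i\<in>I. (if i \<in> I then \<mu> i else 0) *\<^sub>R A i) = (\<Sum>i\<in>I. \<mu> i *\<^sub>R A i)"
    "(\<Sum>i\<in>I. (if i \<in> I then \<mu> i else 0) * a i) = (\<Sum>i\<in>I. \<mu> i * a i)" by (auto intro: sum.cong)
  have "fst ((\<phi>, 0) + (\<Sum>i\<in>I. \<mu> i *\<^sub>R (A i, a i))) = 0" "snd ((\<phi>, 0) + (\<Sum>i\<in>I. \<mu> i *\<^sub>R (A i, a i))) \<ge> D"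
    using \<mu>(2) by (simp_all only: T_def mem_Times_iff singleton_iff atLeast_iff)
  then show ?thesis
    by (intro that[of "\<lambda>i. if i \<in> I then \<mu> i else 0", unfolded sums])
      (use \<mu> C in \<open>auto simp: fst_sum snd_sum\<close>)
qed

section \<open>The relaxed constant rank condition\<close>

text \<open>Independence in terms of coefficients also makes the family injective, so each
  coordinate function extends to a linear functional on the whole space; \<open>adjoint L 1\<close>
  is the vector that represents it.\<close>

lemma dual_family:
  fixes A :: "'i \<Rightarrow> 'a::euclidean_space"
  assumes fin: "finite R" and ind: "\<And>d. (\<Sum>i\<in>R. d i *\<^sub>R A i) = 0 \<Longrightarrow> \<forall>i\<in>R. d i = 0"
  obtains B where "\<And>i j. i \<in> R \<Longrightarrow> j \<in> R \<Longrightarrow> A i \<bullet> B j = (if i = j then 1 else 0)"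
proof -
  have inj: "inj_on A R"
  proof (rule inj_onI, rule ccontr)
    fix i j assume ij: "i \<in> R" "j \<in> R" "A i = A j" "i \<noteq> j"
    let ?d = "\<lambda>k. if k = i then 1 else if k = j then - 1 else 0 :: real"
    have "(\<Sum>k\<in>R. ?d k *\<^sub>R A k) = (\<Sum>k\<in>{i, j}. ?d k *\<^sub>R A k)"
      using ij fin by (intro sum.mono_neutral_right) auto
    also have "\<dots> = 0" using ij by simp
    finally show False using ind[of ?d] ij by auto
  qed
  have indep: "independent (A ` R)"
  proof (rule independent_if_scalars_zero)
    fix e x assume e: "(\<Sum>x\<in>A ` R. e x *\<^sub>R x) = 0" and x: "x \<in> A ` R"
    have "(\<Sum>i\<in>R. e (A i) *\<^sub>R A i) = 0" using e by (simp add: sum.reindex[OF inj])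
    then show "e x = 0" using ind[of "\<lambda>i. e (A i)"] x by blast
  qed (use fin in simp)
  have "\<exists>b. \<forall>i\<in>R. A i \<bullet> b = (if i = j then 1 else 0)" if "j \<in> R" for j
  proof -
    obtain L :: "'a \<Rightarrow> real" where L: "linear L" "\<forall>x\<in>A ` R. L x = (if x = A j then 1 else 0)"
      using linear_independent_extend[OF indep, of "\<lambda>x. if x = A j then 1 else 0 :: real"] by blast
    have "A i \<bullet> adjoint L 1 = (if i = j then 1 else 0)" if "i \<in> R" for i
      using adjoint_works[OF L(1), of "A i" 1] L(2) that \<open>j \<in> R\<close> inj by (auto simp: inj_on_eq_iff)
    then show ?thesis by blast
  qed
  then obtain B where "\<forall>j\<in>R. \<forall>i\<in>R. A i \<bullet> B j = (if i = j then 1 else 0)"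
    by metis
  then show ?thesis using that[of B] by blast
qed

text \<open>The dimension sees only the image, whereas a relation counts indices, so a repeated
  vector already is a dependency. An independent family would have a dual one, hence be injective
  and span a space of dimension \<open>card C\<close>.\<close>

lemma dependency_of_dim:
  fixes A :: "'i \<Rightarrow> 'a::euclidean_space"
  assumes fin: "finite C" and dim: "dim (A ` C) < card C"
  obtains d where "(\<Sum>i\<in>C. d i *\<^sub>R A i) = 0" "\<exists>i\<in>C. d i \<noteq> 0"
proof -
  have "\<exists>d. (\<Sum>i\<in>C. d i *\<^sub>R A i) = 0 \<and> (\<exists>i\<in>C. d i \<noteq> 0)"
  proof (rule ccontr)
    assume "\<not> ?thesis"
    then have ind: "\<And>d. (\<Sum>i\<in>C. d i *\<^sub>R A i) = 0 \<Longrightarrow> \<forall>i\<in>C. d i = 0" by blast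
    obtain B where B: "\<And>i j. i \<in> C \<Longrightarrow> j \<in> C \<Longrightarrow> A i \<bullet> B j = (if i = j then 1 else 0)"
      using dual_family[OF fin ind] by metis
    have inj: "inj_on A C"
      by (rule inj_onI) (metis B zero_neq_one)
    have "independent (A ` C)"
    proof (rule independent_if_scalars_zero)
      fix e x assume e: "(\<Sum>x\<in>A ` C. e x *\<^sub>R x) = 0" and x: "x \<in> A ` C"
      have "(\<Sum>i\<in>C. e (A i) *\<^sub>R A i) = 0" using e by (simp add: sum.reindex[OF inj])
      then show "e x = 0" using ind[of "\<lambda>i. e (A i)"] x by blast
    qed (use fin in simp)
    then have "dim (A ` C) = card C" using inj by (simp add: dim_eq_card_independent card_image)
    with dim show False by simp
  qed
  then show ?thesis using that by blast
qed

text \<open>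
  In the coordinates \<open>(x, \<eta>)\<close> with \<open>\<eta> = y + (\<Sum>i\<in>R. (g\<^sub>i - A\<^sub>i \<bullet> y) B\<^sub>i)\<close>, where \<open>A\<^sub>i\<close> are the partial
  gradients at the base point and \<open>B\<close> is dual to \<open>A\<close>, every \<open>g\<^sub>i\<close> with \<open>i \<in> R\<close> is the linear
  function \<open>A\<^sub>i \<bullet> \<eta>\<close>. The point \<open>p\<close> comes from the mean value theorem for the remaining \<open>g\<^sub>j\<close> on the
  segment that joins the base point to \<open>z\<close> in these coordinates.
\<close>

lemma simultaneous_mean_value:
  fixes g :: "'i \<Rightarrow> 'a::euclidean_space \<times> 'b::euclidean_space \<Rightarrow> real"
  assumes C1: "\<And>i. C1 (g i) (dg i)" and fin: "finite R"
    and ind: "\<And>d. (\<Sum>i\<in>R. d i *\<^sub>R snd (dg i z0)) = 0 \<Longrightarrow> \<forall>i\<in>R. d i = 0"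
    and zero: "\<And>i. i \<in> R \<Longrightarrow> g i z0 = 0" "g j z0 = 0" and \<delta>: "\<delta> > 0"
  shows "\<forall>\<^sub>F z in nhds z0. \<exists>p\<in>ball z0 \<delta>. \<exists>w. \<forall>i\<in>insert j R. dg i p \<bullet> (fst z - fst z0, w) = g i z"
proof -
  define A where "A = (\<lambda>i. snd (dg i z0))"
  obtain B where B: "\<And>i j. i \<in> R \<Longrightarrow> j \<in> R \<Longrightarrow> A i \<bullet> B j = (if i = j then 1 else 0)"
    using dual_family[OF fin, of A] ind unfolding A_def by metis
  define \<Psi> where "\<Psi> = (\<lambda>z. (fst z, snd z + (\<Sum>i\<in>R. (g i z - A i \<bullet> snd z) *\<^sub>R B i)))"
  define D where "D = (\<lambda>z k. (fst k, snd k + (\<Sum>i\<in>R. (dg i z \<bullet> k - A i \<bullet> snd k) *\<^sub>R B i)))"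
  have derD: "(\<Psi> has_derivative D z) (at z)" for z
  proof -
    have gd: "(g i has_derivative (\<lambda>k. dg i z \<bullet> k)) (at z)" for i by (rule C1_has_derivative[OF C1])
    show ?thesis unfolding \<Psi>_def D_def
      by (rule derivative_eq_intros gd refl)+
        (auto simp: fun_eq_iff intro!: derivative_eq_intros gd)
  qed
  define \<Psi>' where "\<Psi>' = (\<lambda>z. Blinfun (D z))"
  have blD: "bounded_linear (D z)" for z using derD by (rule has_derivative_bounded_linear)
  have app: "blinfun_apply (\<Psi>' z) = D z" for z
    unfolding \<Psi>'_def by (rule bounded_linear_Blinfun_apply[OF blD])
  have contg: "continuous_on UNIV (dg i)" for i using C1[of i] unfolding C1_def by blast
  have cont: "continuous_on UNIV \<Psi>'"
    by (rule continuous_on_blinfun_componentwise)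
      (auto simp: app D_def intro!: continuous_intros continuous_on_subset[OF contg])
  \<comment> \<open>At the base point the terms \<open>A i \<bullet> snd k\<close> cancel, so the
    derivative of the coordinate map is a shear along the vectors \<open>B i\<close> and has an
    explicit left inverse.\<close>
  define inv0 where "inv0 = Blinfun (\<lambda>k::'a \<times> 'b. (fst k, snd k - (\<Sum>i\<in>R. (fst (dg i z0) \<bullet> fst k) *\<^sub>R B i)))"
  have bl: "bounded_linear (\<lambda>k::'a \<times> 'b. (fst k, snd k - (\<Sum>i\<in>R. (fst (dg i z0) \<bullet> fst k) *\<^sub>R B i)))"
    by (intro bounded_linear_intros)
  have inv0: "inv0 o\<^sub>L \<Psi>' z0 = id_blinfun"
  proof (rule blinfun_eqI)
    fix k :: "'a \<times> 'b"
    have "dg i z0 \<bullet> k = fst (dg i z0) \<bullet> fst k + A i \<bullet> snd k" for i by (simp add: A_def inner_prod_def)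
    then show "blinfun_apply (inv0 o\<^sub>L \<Psi>' z0) k = blinfun_apply id_blinfun k"
      by (simp add: app inv0_def bounded_linear_Blinfun_apply[OF bl] D_def)
  qed
  obtain U V \<Gamma> \<Gamma>' where U: "open U" "U \<subseteq> ball z0 \<delta>" "z0 \<in> U" and V: "open V" "\<Psi> z0 \<in> V"
    and hom: "homeomorphism U V \<Psi> \<Gamma>"
    and \<Gamma>': "\<And>y. y \<in> V \<Longrightarrow> (\<Gamma> has_derivative (\<Gamma>' y)) (at y)"
      "\<And>y. y \<in> V \<Longrightarrow> \<Gamma>' y = inv (blinfun_apply (\<Psi>' (\<Gamma> y)))"
      "\<And>y. y \<in> V \<Longrightarrow> bij (blinfun_apply (\<Psi>' (\<Gamma> y)))"
    using inverse_function_theorem[of "ball z0 \<delta>" \<Psi> \<Psi>' z0 inv0] derD app inv0 \<delta>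
      continuous_on_subset[OF cont] by (metis centre_in_ball open_ball subset_UNIV)
  obtain r where r: "r > 0" "ball (\<Psi> z0) r \<subseteq> V" using V openE by blast
  have "isCont \<Psi> z0" using derD has_derivative_continuous by blast
  then have "\<forall>\<^sub>F z in nhds z0. \<Psi> z \<in> ball (\<Psi> z0) r"
    using r(1) unfolding isCont_def tendsto_at_iff_tendsto_nhds
    by (auto simp: dist_commute dest!: tendstoD)
  moreover have "\<forall>\<^sub>F z in nhds z0. z \<in> U" using U by (simp add: eventually_nhds_in_open)
  ultimately show ?thesis
  proof eventually_elim
    case (elim z)
    let ?\<gamma> = "\<lambda>s::real. \<Psi> z0 + s *\<^sub>R (\<Psi> z - \<Psi> z0)"
    let ?\<Delta> = "\<Psi> z - \<Psi> z0"
    have inV: "?\<gamma> s \<in> V" if "0 \<le> s" "s \<le> 1" for s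
    proof -
      have "norm (s *\<^sub>R ?\<Delta>) \<le> norm ?\<Delta>" using that by (simp add: mult_left_le_one_le)
      also have "\<dots> < r" using elim(1) by (simp add: dist_norm norm_minus_commute)
      finally show ?thesis using r(2) by (auto simp: dist_norm)
    qed
    have \<Gamma>\<Psi>: "\<Gamma> (\<Psi> z) = z" "\<Gamma> (\<Psi> z0) = z0"
      using hom elim(2) U(3) by (auto simp: homeomorphism_def)
    have "((\<lambda>s. g j (\<Gamma> (?\<gamma> s))) has_derivative (\<lambda>s. dg j (\<Gamma> (?\<gamma> x)) \<bullet> \<Gamma>' (?\<gamma> x) (s *\<^sub>R ?\<Delta>))) (at x within {0..1})"
      if "0 \<le> x" "x \<le> 1" for x
    proof -
      have "(?\<gamma> has_derivative (\<lambda>s. s *\<^sub>R ?\<Delta>)) (at x within {0..1})"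
        by (auto intro!: derivative_eq_intros)
      from has_derivative_compose[OF has_derivative_compose[OF this \<Gamma>'(1)[OF inV[OF that]]] C1_has_derivative[OF C1]]
      show ?thesis .
    qed
    \<comment> \<open>Only \<open>g j\<close> needs a mean value point. One point serves all indices
      because the functions with index in \<open>R\<close> are affine along the segment.\<close>
    then have "\<exists>x\<in>{0<..<1}. g j (\<Gamma> (?\<gamma> 1)) - g j (\<Gamma> (?\<gamma> 0)) = dg j (\<Gamma> (?\<gamma> x)) \<bullet> \<Gamma>' (?\<gamma> x) ((1 - 0) *\<^sub>R ?\<Delta>)"
      by (intro mvt_simple) auto
    then obtain x where x: "0 < x" "x < 1" and eq: "g j z = dg j (\<Gamma> (?\<gamma> x)) \<bullet> \<Gamma>' (?\<gamma> x) ?\<Delta>"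
      by (auto simp: \<Gamma>\<Psi> zero)
    let ?p = "\<Gamma> (?\<gamma> x)" and ?k = "\<Gamma>' (?\<gamma> x) ?\<Delta>"
    have xV: "?\<gamma> x \<in> V" using inV x by simp
    then have "?p \<in> U" using hom by (auto simp: homeomorphism_def)
    then have p: "?p \<in> ball z0 \<delta>" using U(2) by blast
    have Dk: "D ?p ?k = ?\<Delta>"
      using \<Gamma>'(2,3)[OF xV] by (simp add: app bij_is_surj surj_f_inv_f)
    have fstk: "fst ?k = fst z - fst z0" using arg_cong[OF Dk, of fst] by (simp add: D_def \<Psi>_def)
    \<comment> \<open>\<open>A i\<close> reads off the coordinate with index \<open>i\<close>: by
      duality the correction replaces \<open>A i \<bullet> c\<close> by \<open>e i\<close>.\<close>
    have coord: "A i \<bullet> (c + (\<Sum>l\<in>R. (e l - A l \<bullet> c) *\<^sub>R B l)) = e i" if "i \<in> R" for i c and e :: "'i \<Rightarrow> real"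
    proof -
      have "(\<Sum>l\<in>R. (e l - A l \<bullet> c) * (A i \<bullet> B l)) = (\<Sum>l\<in>R. if l = i then e l - A l \<bullet> c else 0)"
        by (rule sum.cong) (use B that in auto)
      then show ?thesis using that fin by (simp add: inner_add_right inner_sum_right)
    qed
    have "dg i ?p \<bullet> ?k = g i z" if "i \<in> R" for i
    proof -
      have "dg i ?p \<bullet> ?k = A i \<bullet> snd (D ?p ?k)" unfolding D_def snd_conv by (rule coord[OF that, symmetric])
      also have "\<dots> = A i \<bullet> snd (\<Psi> z) - A i \<bullet> snd (\<Psi> z0)" by (simp add: Dk inner_diff_right)
      also have "\<dots> = g i z - g i z0" unfolding \<Psi>_def snd_conv using coord[OF that] by simp
      finally show ?thesis using zero that by simp
    qed
    moreover have "?k = (fst z - fst z0, snd ?k)" using fstk by (metis prod.collapse)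
    ultimately have "\<forall>i\<in>insert j R. dg i ?p \<bullet> (fst z - fst z0, snd ?k) = g i z" using eq by auto
    then show ?case using p by blast
  qed
qed

section \<open>Persistence of circuits under constant rank, and almost feasible directions\<close>

lemma eventually_subsequence:
  fixes Q :: "nat \<Rightarrow> nat \<Rightarrow> bool"
  assumes "\<And>n. \<forall>\<^sub>F k in sequentially. Q n k"
  obtains s where "strict_mono s" "\<And>n. Q n (s n)"
proof -
  obtain N where N: "\<And>n k. k \<ge> N n \<Longrightarrow> Q n k"
    using assms unfolding eventually_sequentially by metis
  \<comment> \<open>Adding up the thresholds makes the indices strictly increasing while each still
    exceeds the threshold of its level.\<close>
  define s where "s = (\<lambda>n. \<Sum>i\<le>n. Suc (N i))"
  show ?thesis
  proof (rule that)
    show "strict_mono s" unfolding s_def by (rule strict_monoI_Suc) simp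
    fix n
    have "Suc (N n) \<le> s n" unfolding s_def by (rule member_le_sum[of n "{..n}" "\<lambda>i. Suc (N i)"]) auto
    then have "N n \<le> s n" by simp
    then show "Q n (s n)" by (rule N)
  qed
qed

text \<open>The rank deficit of the circuit at \<open>z0\<close> persists on the ball, so the mean
  value points \<open>p n\<close> carry relations \<open>e n\<close>; normalized ones converge along
  a subsequence to a positive multiple of \<open>c\<close> by uniqueness. Summing the mean value
  equations with weights \<open>e n\<close> cancels the uncontrolled components \<open>w n\<close>
  in the second variable, so the possibly unbounded quotients of \<open>snd (z k)\<close>
  disappear.\<close>

lemma circuit_limit_inequality:
  fixes g :: "'i::finite \<Rightarrow> 'a::euclidean_space \<times> 'b::euclidean_space \<Rightarrow> real"
  assumes C1: "\<And>i. C1 (g i) (dg i)"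
    and zero: "\<And>i. i \<in> C \<Longrightarrow> g i z0 = 0" and j: "j \<in> C"
    and rank: "\<delta> > 0" "\<And>z. z \<in> ball z0 \<delta> \<Longrightarrow> dim ((\<lambda>i. snd (dg i z)) ` C) = q"
    and c0: "\<And>i. i \<in> C \<Longrightarrow> c i \<noteq> 0" and dep: "(\<Sum>i\<in>C. c i *\<^sub>R snd (dg i z0)) = 0"
    and uniq: "\<And>d. (\<Sum>i\<in>C. d i *\<^sub>R snd (dg i z0)) = 0 \<Longrightarrow> \<exists>r. \<forall>i\<in>C. d i = r * c i"
    and z: "z \<longlonglongrightarrow> z0" and t: "\<And>k. t k > 0" and u: "(\<lambda>k. (fst (z k) - fst z0) /\<^sub>R t k) \<longlonglongrightarrow> u"
    and pos: "\<And>i k. i \<in> C \<Longrightarrow> c i > 0 \<Longrightarrow> g i (z k) \<le> 0"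
    and neg: "\<And>i. i \<in> C \<Longrightarrow> c i < 0 \<Longrightarrow> (\<lambda>k. g i (z k) / t k) \<longlonglongrightarrow> \<gamma> i"
  shows "(\<Sum>i\<in>C. c i * (fst (dg i z0) \<bullet> u)) \<le> (\<Sum>i\<in>{i\<in>C. c i < 0}. c i * \<gamma> i)"
proof -
  define R where "R = C - {j}"
  \<comment> \<open>A relation that avoids the index \<open>j\<close> extends by 0 to a multiple of
    \<open>c\<close> that vanishes at \<open>j\<close>, hence is trivial.\<close>
  have ind: "\<forall>i\<in>R. d i = 0" if "(\<Sum>i\<in>R. d i *\<^sub>R snd (dg i z0)) = 0" for d
  proof -
    have "(\<Sum>i\<in>C. (d(j := 0)) i *\<^sub>R snd (dg i z0)) = (\<Sum>i\<in>R. (d(j := 0)) i *\<^sub>R snd (dg i z0))"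
      using j by (simp add: R_def sum.remove)
    also have "\<dots> = (\<Sum>i\<in>R. d i *\<^sub>R snd (dg i z0))" by (rule sum.cong) (auto simp: R_def)
    finally have "(\<Sum>i\<in>C. (d(j := 0)) i *\<^sub>R snd (dg i z0)) = 0" using that by simp
    from uniq[OF this] obtain r where r: "\<And>i. i \<in> C \<Longrightarrow> (d(j := 0)) i = r * c i" by blast
    have "r = 0" using r[OF j] c0[OF j] by simp
    show ?thesis
    proof
      fix i assume "i \<in> R"
      then show "d i = 0" using r[of i] \<open>r = 0\<close> by (simp add: R_def)
    qed
  qed
  \<comment> \<open>The vector of index \<open>j\<close> depends on the others at \<open>z0\<close>,
    so the rank there is at most \<open>card R\<close>; constancy transports this deficit to the
    whole ball.\<close>
  have dimlt: "dim ((\<lambda>i. snd (dg i z)) ` C) < card C" if "z \<in> ball z0 \<delta>" for z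
  proof -
    have "snd (dg j z0) \<in> span ((\<lambda>i. snd (dg i z0)) ` R)"
    proof -
      have "c j *\<^sub>R snd (dg j z0) = - (\<Sum>i\<in>R. c i *\<^sub>R snd (dg i z0))"
        using dep j by (simp add: R_def sum.remove eq_neg_iff_add_eq_0)
      then have "(1 / c j) *\<^sub>R (c j *\<^sub>R snd (dg j z0)) = (1 / c j) *\<^sub>R - (\<Sum>i\<in>R. c i *\<^sub>R snd (dg i z0))"
        by simp
      then have "snd (dg j z0) = (1 / c j) *\<^sub>R - (\<Sum>i\<in>R. c i *\<^sub>R snd (dg i z0))"
        using c0[OF j] by simp
      moreover have "\<dots> \<in> span ((\<lambda>i. snd (dg i z0)) ` R)"
        by (intro span_scale span_neg span_sum span_base imageI)
      ultimately show ?thesis by simp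
    qed
    then have "dim ((\<lambda>i. snd (dg i z0)) ` C) \<le> dim ((\<lambda>i. snd (dg i z0)) ` R)"
      using j by (intro subset_le_dim) (auto simp: R_def intro: span_base)
    also have "\<dots> \<le> card R" by (meson card_image_le dim_le_card' finite finite_imageI order_trans)
    also have "\<dots> < card C" unfolding R_def using j by (intro card_Diff1_less) auto
    finally show ?thesis using rank(2)[OF that] rank(2)[of z0] rank(1) by simp
  qed
  \<comment> \<open>The radii \<open>1 / Suc n\<close> make the mean value points converge to
    \<open>z0\<close>; the minimum with \<open>\<delta>\<close> keeps them where the rank is
    known.\<close>
  have ev: "\<forall>\<^sub>F k in sequentially. \<exists>p\<in>ball z0 (min \<delta> (1 / Suc n)). \<exists>w. \<forall>i\<in>C. dg i p \<bullet> (fst (z k) - fst z0, w) = g i (z k)" for n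
  proof -
    have "insert j R = C" using j by (auto simp: R_def)
    moreover have "\<forall>\<^sub>F z in nhds z0. \<exists>p\<in>ball z0 (min \<delta> (1 / Suc n)). \<exists>w. \<forall>i\<in>insert j R. dg i p \<bullet> (fst z - fst z0, w) = g i z"
      by (rule simultaneous_mean_value[OF C1]) (use ind zero j rank in \<open>auto simp: R_def\<close>)
    ultimately show ?thesis using z by (auto simp: filterlim_iff)
  qed
  obtain s where s: "strict_mono s"
    and ex: "\<And>n. \<exists>p\<in>ball z0 (min \<delta> (1 / Suc n)). \<exists>w. \<forall>i\<in>C. dg i p \<bullet> (fst (z (s n)) - fst z0, w) = g i (z (s n))"
    using eventually_subsequence[where Q = "\<lambda>n k. \<exists>p\<in>ball z0 (min \<delta> (1 / Suc n)). \<exists>w. \<forall>i\<in>C. dg i p \<bullet> (fst (z k) - fst z0, w) = g i (z k)", OF ev]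
    by blast
  obtain p w where p: "\<And>n. p n \<in> ball z0 (min \<delta> (1 / Suc n))"
    and eq: "\<And>n i. i \<in> C \<Longrightarrow> dg i (p n) \<bullet> (fst (z (s n)) - fst z0, w n) = g i (z (s n))"
    using ex by metis
  have "p \<longlonglongrightarrow> z0"
  proof (rule metric_LIMSEQ_I)
    fix r :: real assume "r > 0"
    then obtain N where N: "1 / Suc N < r" using nat_approx_posE by blast
    show "\<exists>no. \<forall>n\<ge>no. dist (p n) z0 < r"
    proof (intro exI[of _ N] allI impI)
      fix n assume "n \<ge> N"
      then have "1 / real (Suc n) \<le> 1 / real (Suc N)" by (simp add: frac_le)
      then show "dist (p n) z0 < r" using p[of n] N by (simp add: dist_commute)
    qed
  qed
  \<comment> \<open>Unit norm yields a nonzero limit by compactness; the sign convention rules out a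
    negative multiple of \<open>c\<close> in the limit.\<close>
  have "\<exists>e::real^'i. norm e = 1 \<and> (\<forall>i. i \<notin> C \<longrightarrow> e $ i = 0) \<and> (\<Sum>i\<in>C. e $ i *\<^sub>R snd (dg i (p n))) = 0
    \<and> (\<Sum>i\<in>C. e $ i * c i) \<ge> 0" for n
  proof -
    obtain d i where d: "(\<Sum>i\<in>C. d i *\<^sub>R snd (dg i (p n))) = 0" "i \<in> C" "d i \<noteq> 0"
    proof -
      have "p n \<in> ball z0 \<delta>" using p[of n] by simp
      from dependency_of_dim[OF finite dimlt[OF this]] show ?thesis using that by blast
    qed
    define e0 :: "real^'i" where "e0 = (\<chi> i. if i \<in> C then d i else 0)"
    have e0i: "e0 $ i = d i" if "i \<in> C" for i using that by (simp add: e0_def)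
    have "e0 \<noteq> 0" using d(2,3) e0i[of i] by auto
    have D: "(\<Sum>i\<in>C. (r * e0 $ i) *\<^sub>R snd (dg i (p n))) = 0" for r
    proof -
      have "(\<Sum>i\<in>C. (r * e0 $ i) *\<^sub>R snd (dg i (p n))) = r *\<^sub>R (\<Sum>i\<in>C. d i *\<^sub>R snd (dg i (p n)))"
        by (simp add: e0i scaleR_right.sum)
      then show ?thesis using d(1) by simp
    qed
    define e where "e = (if (\<Sum>i\<in>C. e0 $ i * c i) \<ge> 0 then 1 else - 1) *\<^sub>R (e0 /\<^sub>R norm e0)"
    have "norm e = 1" using \<open>e0 \<noteq> 0\<close> by (simp add: e_def)
    moreover have "(\<Sum>i\<in>C. e $ i * c i) \<ge> 0"
    proof -
      have "(\<Sum>i\<in>C. e $ i * c i) = (if (\<Sum>i\<in>C. e0 $ i * c i) \<ge> 0 then 1 else - 1) * inverse (norm e0) * (\<Sum>i\<in>C. e0 $ i * c i)"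
        by (simp add: e_def sum_distrib_left sum_negf mult.assoc)
      then show ?thesis by (auto simp: mult_nonneg_nonpos)
    qed
    moreover have "(\<Sum>i\<in>C. e $ i *\<^sub>R snd (dg i (p n))) = 0"
      using D[of "(if (\<Sum>i\<in>C. e0 $ i * c i) \<ge> 0 then 1 else - 1) * inverse (norm e0)"]
      by (simp add: e_def mult.assoc)
    moreover have "e $ i = 0" if "i \<notin> C" for i using that by (simp add: e_def e0_def)
    ultimately show ?thesis by blast
  qed
  then obtain e :: "nat \<Rightarrow> real^'i" where e: "\<And>n. norm (e n) = 1" "\<And>n i. i \<notin> C \<Longrightarrow> e n $ i = 0"
    "\<And>n. (\<Sum>i\<in>C. e n $ i *\<^sub>R snd (dg i (p n))) = 0" "\<And>n. (\<Sum>i\<in>C. e n $ i * c i) \<ge> 0" by metis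
  have "\<forall>n. e n \<in> sphere 0 1" using e(1) by simp
  then obtain e1 \<rho> where e1: "e1 \<in> sphere (0::real^'i) 1" and \<rho>: "strict_mono (\<rho>::nat\<Rightarrow>nat)" and "(e \<circ> \<rho>) \<longlonglongrightarrow> e1"
    using seq_compactE[OF compact_imp_seq_compact[OF compact_sphere[of "0::real^'i" 1]]] by metis
  then have elim: "(\<lambda>n. e (\<rho> n) $ i) \<longlonglongrightarrow> e1 $ i" for i
    using tendsto_vec_nth[OF \<open>(e \<circ> \<rho>) \<longlonglongrightarrow> e1\<close>, of i] by (simp add: o_def)
  have plim: "(\<lambda>n. p (\<rho> n)) \<longlonglongrightarrow> z0"
    using LIMSEQ_subseq_LIMSEQ[OF \<open>p \<longlonglongrightarrow> z0\<close> \<rho>] by (simp add: o_def)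
  have sr: "strict_mono (\<lambda>n. s (\<rho> n))" using s \<rho> by (simp add: strict_mono_def)
  have "(\<lambda>n. \<Sum>i\<in>C. e (\<rho> n) $ i *\<^sub>R snd (dg i (p (\<rho> n)))) \<longlonglongrightarrow> (\<Sum>i\<in>C. e1 $ i *\<^sub>R snd (dg i z0))"
    by (intro tendsto_sum tendsto_scaleR tendsto_snd elim C1_grad_tendsto[OF C1] plim)
  then have "(\<Sum>i\<in>C. e1 $ i *\<^sub>R snd (dg i z0)) = 0"
    unfolding e(3) by (simp add: LIMSEQ_const_iff)
  then obtain r where r: "\<And>i. i \<in> C \<Longrightarrow> e1 $ i = r * c i" using uniq by metis
  have "(\<lambda>n. e (\<rho> n) $ i) \<longlonglongrightarrow> 0" if "i \<notin> C" for i using e(2) that by simp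
  then have e1out: "e1 $ i = 0" if "i \<notin> C" for i using LIMSEQ_unique elim that by blast
  have "r \<noteq> 0"
  proof
    assume "r = 0"
    then have "e1 $ i = 0" for i using r e1out by (cases "i \<in> C") auto
    then have "e1 = 0" by (simp add: vec_eq_iff)
    then show False using e1 by simp
  qed
  moreover have "r \<ge> 0"
  proof -
    have "(\<lambda>n. \<Sum>i\<in>C. e (\<rho> n) $ i * c i) \<longlonglongrightarrow> (\<Sum>i\<in>C. e1 $ i * c i)"
      by (intro tendsto_sum tendsto_mult tendsto_const elim)
    then have "0 \<le> (\<Sum>i\<in>C. e1 $ i * c i)"
      by (rule LIMSEQ_le_const) (use e(4) in blast)
    also have "\<dots> = r * (\<Sum>i\<in>C. c i * c i)" by (simp add: r sum_distrib_left mult.assoc)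
    finally have "0 \<le> r * (\<Sum>i\<in>C. c i * c i)" .
    moreover have "(\<Sum>i\<in>C. c i * c i) > 0" using c0 j
      by (intro sum_pos2[of C j]) (auto simp: zero_less_mult_iff linorder_neq_iff)
    ultimately show ?thesis by (simp add: zero_le_mult_iff)
  qed
  ultimately have "r > 0" by simp
  define T where "T = (\<lambda>n i. e (\<rho> n) $ i * (g i (z (s (\<rho> n))) / t (s (\<rho> n))))"
  have left: "(\<lambda>n. \<Sum>i\<in>C. T n i) \<longlonglongrightarrow> (\<Sum>i\<in>C. e1 $ i * (fst (dg i z0) \<bullet> u))"
  proof -
    have "(\<lambda>n. (fst (z (s (\<rho> n))) - fst z0) /\<^sub>R t (s (\<rho> n))) \<longlonglongrightarrow> u"
      using LIMSEQ_subseq_LIMSEQ[OF u sr] by (simp add: o_def)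
    then have "(\<lambda>n. \<Sum>i\<in>C. e (\<rho> n) $ i * (fst (dg i (p (\<rho> n))) \<bullet> ((fst (z (s (\<rho> n))) - fst z0) /\<^sub>R t (s (\<rho> n)))))
      \<longlonglongrightarrow> (\<Sum>i\<in>C. e1 $ i * (fst (dg i z0) \<bullet> u))"
      by (intro tendsto_sum tendsto_mult tendsto_inner tendsto_fst elim C1_grad_tendsto[OF C1] plim)
    \<comment> \<open>The weights form a relation among the partial gradients in the second
      variable, so their inner products with \<open>w\<close> add up to zero.\<close>
    moreover have "(\<Sum>i\<in>C. e (\<rho> n) $ i * (fst (dg i (p (\<rho> n))) \<bullet> ((fst (z (s (\<rho> n))) - fst z0) /\<^sub>R t (s (\<rho> n))))) = (\<Sum>i\<in>C. T n i)" for n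
    proof -
      let ?n = "\<rho> n" and ?t = "inverse (t (s (\<rho> n)))"
      have "(\<Sum>i\<in>C. e ?n $ i * g i (z (s ?n)))
          = (\<Sum>i\<in>C. e ?n $ i * (fst (dg i (p ?n)) \<bullet> (fst (z (s ?n)) - fst z0))) + (\<Sum>i\<in>C. e ?n $ i *\<^sub>R snd (dg i (p ?n))) \<bullet> w ?n"
        by (simp add: eq[symmetric] inner_prod_def distrib_left sum.distrib inner_sum_left)
      then have E: "(\<Sum>i\<in>C. e ?n $ i * g i (z (s ?n))) = (\<Sum>i\<in>C. e ?n $ i * (fst (dg i (p ?n)) \<bullet> (fst (z (s ?n)) - fst z0)))"
        by (simp add: e(3))
      have "(\<Sum>i\<in>C. T n i) = ?t * (\<Sum>i\<in>C. e ?n $ i * g i (z (s ?n)))"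
        by (simp add: T_def sum_distrib_left divide_inverse mult_ac)
      also have "\<dots> = (\<Sum>i\<in>C. e ?n $ i * (fst (dg i (p ?n)) \<bullet> ((fst (z (s ?n)) - fst z0) /\<^sub>R t (s ?n))))"
        unfolding E by (simp add: sum_distrib_left mult_ac)
      finally show ?thesis by simp
    qed
    ultimately show ?thesis by simp
  qed
  have right: "(\<lambda>n. \<Sum>i\<in>{i\<in>C. c i < 0}. T n i) \<longlonglongrightarrow> (\<Sum>i\<in>{i\<in>C. c i < 0}. e1 $ i * \<gamma> i)"
    unfolding T_def
  proof (intro tendsto_sum tendsto_mult elim)
    fix i assume "i \<in> {i\<in>C. c i < 0}"
    then show "(\<lambda>n. g i (z (s (\<rho> n))) / t (s (\<rho> n))) \<longlonglongrightarrow> \<gamma> i"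
      using LIMSEQ_subseq_LIMSEQ[OF neg sr] by (simp add: o_def)
  qed
  have "\<forall>\<^sub>F n in sequentially. \<forall>i\<in>C. c i > 0 \<longrightarrow> e (\<rho> n) $ i > 0"
  proof (intro eventually_ball_finite finite ballI)
    fix i assume i: "i \<in> C"
    show "\<forall>\<^sub>F n in sequentially. c i > 0 \<longrightarrow> e (\<rho> n) $ i > 0"
    proof (cases "c i > 0")
      case True
      then have "e1 $ i > 0" using r[OF i] \<open>r > 0\<close> by simp
      from order_tendstoD(1)[OF elim this] show ?thesis by eventually_elim simp
    qed simp
  qed
  then have "\<forall>\<^sub>F n in sequentially. (\<Sum>i\<in>C. T n i) \<le> (\<Sum>i\<in>{i\<in>C. c i < 0}. T n i)"
  proof eventually_elim
    case (elim n)
    have "T n i \<le> 0" if "i \<in> C" "\<not> c i < 0" for i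
    proof -
      have ci: "c i > 0" using c0 that by force
      then have "g i (z (s (\<rho> n))) / t (s (\<rho> n)) \<le> 0" using pos[OF that(1)] t by (simp add: divide_nonpos_pos)
      then show ?thesis unfolding T_def using elim ci that by (intro mult_nonneg_nonpos) (auto intro: less_imp_le)
    qed
    then have "(\<Sum>i\<in>C - {i\<in>C. c i < 0}. T n i) \<le> 0" by (intro sum_nonpos) auto
    moreover have "(\<Sum>i\<in>C. T n i) = (\<Sum>i\<in>C - {i\<in>C. c i < 0}. T n i) + (\<Sum>i\<in>{i\<in>C. c i < 0}. T n i)"
      by (rule sum.subset_diff) auto
    ultimately show ?case by simp
  qed
  then have "(\<Sum>i\<in>C. e1 $ i * (fst (dg i z0) \<bullet> u)) \<le> (\<Sum>i\<in>{i\<in>C. c i < 0}. e1 $ i * \<gamma> i)"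
    by (intro tendsto_le[OF _ right left]) auto
  then have "r * (\<Sum>i\<in>C. c i * (fst (dg i z0) \<bullet> u)) \<le> r * (\<Sum>i\<in>{i\<in>C. c i < 0}. c i * \<gamma> i)"
    by (simp add: r sum_distrib_left mult.assoc)
  then show ?thesis using \<open>r > 0\<close> by simp
qed

text \<open>Scaled constraint values that tend to minus infinity impose no lower bound on the
  derivative along \<open>(u, w)\<close>. The others have limits \<open>\<gamma> i\<close>, and
  \<open>w\<close> is sought with derivative between \<open>\<gamma> i\<close> and 0. In an
  infeasibility certificate upper bounds carry positive and lower bounds negative signs; its
  negative value is the difference of the two sides of \<open>circuit_limit_inequality\<close>,
  which that inequality makes nonnegative.\<close>

lemma rcr_direction:
  fixes g :: "'i::finite \<Rightarrow> 'a::euclidean_space \<times> 'b::euclidean_space \<Rightarrow> real"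
  assumes C1: "\<And>i. C1 (g i) (dg i)" and \<delta>: "\<delta> > 0"
    and rank: "\<And>K. K \<subseteq> {i. g i z0 = 0} \<Longrightarrow> \<exists>q. \<forall>z\<in>ball z0 \<delta>. dim ((\<lambda>i. snd (dg i z)) ` K) = q"
    and z: "z \<longlonglongrightarrow> z0" and t: "\<And>k. t k > 0" and u: "(\<lambda>k. (fst (z k) - fst z0) /\<^sub>R t k) \<longlonglongrightarrow> u"
    and feas: "\<And>i k. g i (z k) \<le> 0"
  obtains r w where "strict_mono (r :: nat \<Rightarrow> nat)" "\<And>i. g i z0 = 0 \<Longrightarrow> dg i z0 \<bullet> (u, w) \<le> 0"
    "\<And>i \<epsilon>. g i z0 = 0 \<Longrightarrow> \<epsilon> > 0 \<Longrightarrow> \<forall>\<^sub>F k in sequentially. g i (z (r k)) \<le> t (r k) * (dg i z0 \<bullet> (u, w) + \<epsilon>)"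
proof -
  define I where "I = {i. g i z0 = 0}"
  define x where "x = (\<lambda>k i. g i (z k) / t k)"
  have x0: "x k i \<le> 0" for k i using feas t by (simp add: x_def divide_nonpos_pos)
  \<comment> \<open>The map \<open>x / (1 - x)\<close> compresses the nonpositive half line into
    \<open>(-1, 0]\<close>, so that a convergent subsequence exists even for unbounded quotients;
    the limit -1 stands for minus infinity.\<close>
  define y :: "nat \<Rightarrow> real^'i" where "y = (\<lambda>k. \<chi> i. x k i / (1 - x k i))"
  have yi: "y k $ i = x k i / (1 - x k i)" for k i by (simp add: y_def)
  have xy: "x k i = y k $ i / (1 + y k $ i)" for k i
    using x0[of k i] by (simp add: yi field_simps add_divide_distrib)
  have "y k \<in> cbox (\<chi> i. -1) (\<chi> i. 0)" for k
  proof -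
    have "1 - x k i > 0" for i using x0[of k i] by linarith
    then have "- 1 \<le> y k $ i \<and> y k $ i \<le> 0" for i
      using x0[of k i] by (simp add: yi pos_le_divide_eq pos_divide_le_eq)
    then show ?thesis by (simp add: mem_box_cart)
  qed
  then obtain s r where s: "s \<in> cbox (\<chi> i. -1) (\<chi> i. 0)" and r: "strict_mono (r::nat\<Rightarrow>nat)" and "(y \<circ> r) \<longlonglongrightarrow> s"
    using seq_compactE[OF compact_imp_seq_compact[OF compact_cbox[of "(\<chi> i. -1)::real^'i" "\<chi> i. 0"]], of y] by metis
  then have ylim: "(\<lambda>k. y (r k) $ i) \<longlonglongrightarrow> s $ i" for i
    using tendsto_vec_nth[of "y \<circ> r" s sequentially i] by (simp add: o_def)
  define J where "J = {i\<in>I. s $ i > -1}"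
  define \<gamma> where "\<gamma> = (\<lambda>i. s $ i / (1 + s $ i))"
  have limJ: "(\<lambda>k. x (r k) i) \<longlonglongrightarrow> \<gamma> i" if "i \<in> J" for i
    unfolding xy \<gamma>_def using that by (intro tendsto_intros ylim) (auto simp: J_def)
  have limI: "\<forall>\<^sub>F k in sequentially. x (r k) i < M" if "i \<in> I - J" "M < 0" for i M
  proof -
    have "s $ i \<ge> -1" using s by (simp add: mem_box_cart)
    then have "s $ i = -1" using that by (auto simp: J_def)
    moreover have "-1 < M / (1 - M)" using that(2) by (simp add: pos_less_divide_eq)
    ultimately have "\<forall>\<^sub>F k in sequentially. y (r k) $ i < M / (1 - M)"
      using order_tendstoD(2)[OF ylim, of i "M / (1 - M)"] by simp
    then show ?thesis
    proof eventually_elim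
      case (elim k)
      then have "x (r k) i * (1 - M) < M * (1 - x (r k) i)"
        using x0[of "r k" i] that(2) by (simp add: yi pos_divide_less_eq pos_less_divide_eq)
      then show ?case by (simp add: algebra_simps)
    qed
  qed
  \<comment> \<open>\<open>Inl i\<close> encodes the upper bound 0 and \<open>Inr i\<close> the
    lower bound \<open>\<gamma> i\<close> for the derivative of constraint \<open>i\<close>, with
    the known part in \<open>u\<close> moved to the right-hand side \<open>b\<close>.\<close>
  define A where "A = case_sum (\<lambda>i. snd (dg i z0)) (\<lambda>i. - snd (dg i z0))"
  define b where "b = case_sum (\<lambda>i. - (fst (dg i z0) \<bullet> u)) (\<lambda>i. fst (dg i z0) \<bullet> u - \<gamma> i)"
  define N where "N = Inl ` I \<union> Inr ` J"
  have "\<exists>w. \<forall>m\<in>N. A m \<bullet> w \<le> b m"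
  proof (rule ccontr)
    assume infeas: "\<not> ?thesis"
    obtain C c where C: "C \<subseteq> N" "\<And>m. m \<in> C \<Longrightarrow> c m > 0" "(\<Sum>m\<in>C. c m *\<^sub>R A m) = 0"
      "(\<Sum>m\<in>C. c m * b m) < 0"
      "\<And>d. (\<Sum>m\<in>C. d m *\<^sub>R A m) = 0 \<Longrightarrow> \<exists>r. \<forall>m\<in>C. d m = r * c m"
      by (rule farkas_circuit[OF finite infeas], rule that)
    define \<pi> :: "'i + 'i \<Rightarrow> 'i" where "\<pi> = case_sum id id"
    define \<sigma> :: "'i + 'i \<Rightarrow> real" where "\<sigma> = case_sum (\<lambda>_. 1) (\<lambda>_. - 1)"
    have \<pi>\<sigma>[simp]: "\<pi> (Inl i) = i" "\<pi> (Inr i) = i" "\<sigma> (Inl i) = 1" "\<sigma> (Inr i) = - 1" for i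
      by (simp_all add: \<pi>_def \<sigma>_def)
    have \<sigma>\<sigma>: "\<sigma> m * \<sigma> m = 1" for m by (cases m) auto
    have A\<pi>: "A m = \<sigma> m *\<^sub>R snd (dg (\<pi> m) z0)" for m by (cases m) (auto simp: A_def)
    \<comment> \<open>If both bounds of one constraint occurred, they would form the whole circuit
      with equal weights, and the value \<open>- (c (Inr i) * \<gamma> i)\<close> would be
      nonnegative.\<close>
    have inj: "inj_on \<pi> C"
    proof (rule ccontr)
      assume "\<not> inj_on \<pi> C"
      then obtain i where i: "Inl i \<in> C" "Inr i \<in> C"
        unfolding inj_on_def by (metis \<pi>\<sigma>(1,2) sum.exhaust)
      let ?d = "\<lambda>m. if m = Inl i \<or> m = Inr i then 1 else 0 :: real"
      have sub: "(\<Sum>m\<in>C. ?d m *\<^sub>R F m) = F (Inl i) + F (Inr i)" for F :: "'i + 'i \<Rightarrow> 'b"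
      proof -
        have "(\<Sum>m\<in>C. ?d m *\<^sub>R F m) = (\<Sum>m\<in>{Inl i, Inr i}. ?d m *\<^sub>R F m)"
          by (rule sum.mono_neutral_right) (use i in auto)
        then show ?thesis by simp
      qed
      have "(\<Sum>m\<in>C. ?d m *\<^sub>R A m) = 0" unfolding sub by (simp add: A_def)
      from C(5)[OF this] obtain \<rho> where \<rho>: "\<And>m. m \<in> C \<Longrightarrow> ?d m = \<rho> * c m" by blast
      have "\<rho> \<noteq> 0" using \<rho>[OF i(1)] by auto
      have "C = {Inl i, Inr i}"
      proof (rule ccontr)
        assume "C \<noteq> {Inl i, Inr i}"
        then obtain m where "m \<in> C" "m \<noteq> Inl i" "m \<noteq> Inr i" using i by blast
        then show False using \<rho>[of m] C(2)[of m] \<open>\<rho> \<noteq> 0\<close> by simp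
      qed
      moreover have "c (Inl i) = c (Inr i)"
        using \<rho>[OF i(1)] \<rho>[OF i(2)] \<open>\<rho> \<noteq> 0\<close> mult_left_cancel[of \<rho> "c (Inl i)" "c (Inr i)"] by simp
      ultimately have "(\<Sum>m\<in>C. c m * b m) = - (c (Inr i) * \<gamma> i)"
        by (simp add: b_def algebra_simps)
      moreover have "i \<in> J" using i(2) C(1) by (auto simp: N_def)
      then have "\<gamma> i \<le> 0" using limJ x0 by (meson LIMSEQ_le_const2)
      ultimately show False using C(2)[OF i(2)] C(4) by (simp add: mult_le_0_iff zero_less_mult_iff)
    qed
    \<comment> \<open>The circuit becomes a signed relation over constraint indices, positive for
      upper and negative for lower bounds.\<close>
    define c' where "c' = (\<lambda>i. \<sigma> (inv_into C \<pi> i) * c (inv_into C \<pi> i))"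
    have c': "c' (\<pi> m) = \<sigma> m * c m" if "m \<in> C" for m
      using inv_into_f_f[OF inj that] by (simp add: c'_def)
    have sumC: "(\<Sum>i\<in>\<pi> ` C. F i) = (\<Sum>m\<in>C. F (\<pi> m))" for F :: "'i \<Rightarrow> 'z::comm_monoid_add"
      using sum.reindex[OF inj, of F] by (simp add: o_def)
    have "C \<noteq> {}" using C(4) by auto
    then obtain j where j: "j \<in> \<pi> ` C" by blast
    have zero: "g i z0 = 0" if "i \<in> \<pi> ` C" for i
      using that C(1) by (auto simp: N_def I_def J_def)
    then obtain q where q: "\<And>z. z \<in> ball z0 \<delta> \<Longrightarrow> dim ((\<lambda>i. snd (dg i z)) ` \<pi> ` C) = q"
      using rank[of "\<pi> ` C"] by blast
    have "(\<Sum>i\<in>\<pi> ` C. c' i * (fst (dg i z0) \<bullet> u)) \<le> (\<Sum>i\<in>{i\<in>\<pi> ` C. c' i < 0}. c' i * \<gamma> i)"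
    proof (rule circuit_limit_inequality[OF C1 zero j \<delta> q])
      show "(\<lambda>k. (fst (z (r k)) - fst z0) /\<^sub>R t (r k)) \<longlonglongrightarrow> u"
        using LIMSEQ_subseq_LIMSEQ[OF u r] by (simp add: o_def)
      show "(\<lambda>k. z (r k)) \<longlonglongrightarrow> z0" using LIMSEQ_subseq_LIMSEQ[OF z r] by (simp add: o_def)
      show "c' i \<noteq> 0" if i: "i \<in> \<pi> ` C" for i
      proof -
        obtain m where "m \<in> C" "i = \<pi> m" using i by blast
        then show ?thesis using c'[of m] C(2)[of m] \<sigma>\<sigma>[of m] by auto
      qed
      have "(\<Sum>i\<in>\<pi> ` C. c' i *\<^sub>R snd (dg i z0)) = (\<Sum>m\<in>C. c m *\<^sub>R A m)"
        unfolding sumC by (rule sum.cong) (simp_all add: c' A\<pi> mult.commute)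
      then show "(\<Sum>i\<in>\<pi> ` C. c' i *\<^sub>R snd (dg i z0)) = 0" using C(3) by simp
      show "\<exists>\<rho>. \<forall>i\<in>\<pi> ` C. d i = \<rho> * c' i" if d: "(\<Sum>i\<in>\<pi> ` C. d i *\<^sub>R snd (dg i z0)) = 0" for d
      proof -
        have "(\<Sum>m\<in>C. (\<sigma> m * d (\<pi> m)) *\<^sub>R A m) = (\<Sum>i\<in>\<pi> ` C. d i *\<^sub>R snd (dg i z0))"
          unfolding sumC
        proof (rule sum.cong[OF refl])
          fix m
          have "(\<sigma> m * d (\<pi> m)) *\<^sub>R A m = (\<sigma> m * \<sigma> m * d (\<pi> m)) *\<^sub>R snd (dg (\<pi> m) z0)" by (simp add: A\<pi> mult_ac)
          then show "(\<sigma> m * d (\<pi> m)) *\<^sub>R A m = d (\<pi> m) *\<^sub>R snd (dg (\<pi> m) z0)" by (simp add: \<sigma>\<sigma>)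
        qed
        then obtain \<rho> where \<rho>: "\<And>m. m \<in> C \<Longrightarrow> \<sigma> m * d (\<pi> m) = \<rho> * c m" using C(5)[of "\<lambda>m. \<sigma> m * d (\<pi> m)"] d by auto
        have "d (\<pi> m) = \<rho> * c' (\<pi> m)" if "m \<in> C" for m
        proof -
          have "d (\<pi> m) = \<sigma> m * (\<sigma> m * d (\<pi> m))" using \<sigma>\<sigma>[of m] by (simp add: mult.assoc[symmetric])
          then show ?thesis using \<rho>[OF that] c'[OF that] by simp
        qed
        then show ?thesis by blast
      qed
      show "g i (z (r k)) \<le> 0" for i k by (rule feas)
      show "t (r k) > 0" for k by (rule t)
      show "(\<lambda>k. g i (z (r k)) / t (r k)) \<longlonglongrightarrow> \<gamma> i" if "i \<in> \<pi> ` C" "c' i < 0" for i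
      proof -
        obtain m where m: "m \<in> C" "i = \<pi> m" using \<open>i \<in> \<pi> ` C\<close> by blast
        then have "m = Inr i" using c'[of m] C(2)[of m] \<open>c' i < 0\<close> by (cases m) auto
        then have "i \<in> J" using m(1) C(1) by (auto simp: N_def)
        from limJ[OF this] show ?thesis by (simp add: x_def)
      qed
    qed auto
    moreover have "(\<Sum>i\<in>{i\<in>\<pi> ` C. c' i < 0}. c' i * \<gamma> i) = (\<Sum>i\<in>\<pi> ` C. if c' i < 0 then c' i * \<gamma> i else 0)"
      by (simp add: sum.inter_filter)
    ultimately have "(\<Sum>m\<in>C. c' (\<pi> m) * (fst (dg (\<pi> m) z0) \<bullet> u)) \<le> (\<Sum>m\<in>C. if c' (\<pi> m) < 0 then c' (\<pi> m) * \<gamma> (\<pi> m) else 0)"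
      by (simp only: sumC)
    moreover have "(\<Sum>m\<in>C. c m * b m) = (\<Sum>m\<in>C. if c' (\<pi> m) < 0 then c' (\<pi> m) * \<gamma> (\<pi> m) else 0)
        - (\<Sum>m\<in>C. c' (\<pi> m) * (fst (dg (\<pi> m) z0) \<bullet> u))"
      unfolding sum_subtractf[symmetric]
    proof (rule sum.cong[OF refl])
      fix m assume "m \<in> C"
      then show "c m * b m = (if c' (\<pi> m) < 0 then c' (\<pi> m) * \<gamma> (\<pi> m) else 0) - c' (\<pi> m) * (fst (dg (\<pi> m) z0) \<bullet> u)"
        using c'[of m] C(2)[of m] by (cases m) (auto simp: b_def algebra_simps)
    qed
    ultimately show False using C(4) by linarith
  qed
  then obtain w where w: "\<And>m. m \<in> N \<Longrightarrow> A m \<bullet> w \<le> b m" by blast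
  have wI: "dg i z0 \<bullet> (u, w) \<le> 0" if "i \<in> I" for i
    using w[of "Inl i"] that by (simp add: N_def A_def b_def inner_prod_def)
  have wJ: "\<gamma> i \<le> dg i z0 \<bullet> (u, w)" if "i \<in> J" for i
    using w[of "Inr i"] that by (simp add: N_def A_def b_def inner_prod_def)
  show ?thesis
  proof (rule that[OF r, of w])
    fix i assume "g i z0 = 0"
    then have i: "i \<in> I" by (simp add: I_def)
    then show "dg i z0 \<bullet> (u, w) \<le> 0" by (rule wI)
    fix \<epsilon> :: real assume \<epsilon>: "\<epsilon> > 0"
    let ?M = "dg i z0 \<bullet> (u, w) + \<epsilon>"
    have "\<forall>\<^sub>F k in sequentially. x (r k) i < ?M"
    proof (cases "i \<in> J")
      case True
      then show ?thesis using order_tendstoD(2)[OF limJ[OF True]] wJ[OF True] \<epsilon> by auto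
    next
      case False
      \<comment> \<open>Here the quotient tends to minus infinity; \<open>min\<close> supplies the
        negative threshold that \<open>limI\<close> expects, whatever the sign of
        \<open>?M\<close>.\<close>
      have "\<forall>\<^sub>F k in sequentially. x (r k) i < min (- 1) ?M"
        by (rule limI) (use i False in auto)
      then show ?thesis by eventually_elim simp
    qed
    then show "\<forall>\<^sub>F k in sequentially. g i (z (r k)) \<le> t (r k) * ?M"
      by eventually_elim (use t in \<open>simp add: x_def pos_divide_less_eq mult.commute less_imp_le\<close>)
  qed
qed

section \<open>Directional neighbourhoods and exact penalization of the lower level problem\<close>

lemma zero_in_dir_nhd: "\<epsilon> > 0 \<Longrightarrow> 0 \<in> dir_nhd \<epsilon> \<delta> d"
  by (simp add: dir_nhd_def)

lemma dir_nhd_mono: "\<epsilon> \<le> \<epsilon>' \<Longrightarrow> \<delta> \<le> \<delta>' \<Longrightarrow> dir_nhd \<epsilon> \<delta> d \<subseteq> dir_nhd \<epsilon>' \<delta>' d"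
  unfolding dir_nhd_def by (fastforce intro: order_trans mult_right_mono)

text \<open>For \<open>d = 0\<close> the angular condition is void and only the radius counts.
  Otherwise \<open>\<epsilon> / (norm d + 1)\<close> controls the length, and
  \<open>\<delta> * norm d / (2 + \<delta>)\<close> solves
  \<open>2 * \<eta> = \<delta> * (norm d - \<eta>)\<close>, which balances the angular error against
  a lower bound for the norm of \<open>w\<close>.\<close>

lemma dir_nhd_sector:
  assumes "\<epsilon> > 0" "\<delta> > 0"
  obtains \<eta> where "\<eta> > 0" "\<And>t w. 0 \<le> t \<Longrightarrow> t < \<eta> \<Longrightarrow> norm (w - d) < \<eta> \<Longrightarrow> t *\<^sub>R w \<in> dir_nhd \<epsilon> \<delta> d"
proof -
  define \<eta> where "\<eta> = (if d = 0 then min 1 \<epsilon> else min (min 1 (\<epsilon> / (norm d + 1))) (\<delta> * norm d / (2 + \<delta>)))"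
  have \<eta>: "\<eta> > 0" "\<eta> \<le> 1" using assms by (auto simp: \<eta>_def add_nonneg_pos)
  show ?thesis
  proof (rule that[OF \<eta>(1)])
    fix t w assume t: "0 \<le> t" "t < \<eta>" and w: "norm (w - d) < \<eta>"
    have wd: "norm w \<le> norm d + norm (w - d)" using norm_triangle_ineq[of d "w - d"] by simp
    have small: "t * norm w < \<epsilon>"
    proof (cases "d = 0")
      case True
      then have "t * norm w \<le> t * 1" using w \<eta>(2) t by (intro mult_left_mono) auto
      then show ?thesis using t True by (simp add: \<eta>_def)
    next
      case False
      have "t * norm w \<le> t * (norm d + 1)" using wd w \<eta>(2) t by (intro mult_left_mono) auto
      also have "\<dots> < \<eta> * (norm d + 1)" using t by (intro mult_strict_right_mono) (auto simp: add_nonneg_pos)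
      also have "\<dots> \<le> \<epsilon> / (norm d + 1) * (norm d + 1)"
        using False by (intro mult_right_mono) (auto simp: \<eta>_def)
      also have "\<dots> = \<epsilon>" using norm_ge_zero[of d] by (simp add: add_nonneg_eq_0_iff)
      finally show ?thesis .
    qed
    have "norm (norm d *\<^sub>R w - norm w *\<^sub>R d) \<le> \<delta> * norm w * norm d"
    proof (cases "d = 0")
      case False
      have "norm d *\<^sub>R w - norm w *\<^sub>R d = norm d *\<^sub>R (w - d) + (norm d - norm w) *\<^sub>R d"
        by (simp add: algebra_simps)
      then have "norm (norm d *\<^sub>R w - norm w *\<^sub>R d) \<le> norm d * norm (w - d) + \<bar>norm d - norm w\<bar> * norm d"
        by (metis norm_triangle_ineq norm_scaleR abs_norm_cancel)
      also have "\<dots> \<le> norm d * norm (w - d) + norm (w - d) * norm d"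
        using norm_triangle_ineq3[of d w] by (intro add_left_mono mult_right_mono) (auto simp: norm_minus_commute)
      also have "\<dots> \<le> (2 * \<eta>) * norm d"
        using w mult_right_mono[of "norm (w - d)" \<eta> "norm d"] by (simp add: mult.commute)
      also have "\<dots> \<le> (\<delta> * norm w) * norm d"
      proof (rule mult_right_mono)
        have "\<eta> * (2 + \<delta>) \<le> \<delta> * norm d / (2 + \<delta>) * (2 + \<delta>)"
          using False assms by (intro mult_right_mono) (auto simp: \<eta>_def)
        then have "\<eta> * (2 + \<delta>) \<le> \<delta> * norm d" using assms by simp
        moreover have "norm d - \<eta> \<le> norm w" using w norm_triangle_ineq3[of d w] by (simp add: norm_minus_commute)
        then have "\<delta> * (norm d - \<eta>) \<le> \<delta> * norm w" using assms by (intro mult_left_mono) auto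
        ultimately show "2 * \<eta> \<le> \<delta> * norm w" by (simp add: algebra_simps)
      qed simp
      finally show ?thesis .
    qed simp
    then have "t * norm (norm d *\<^sub>R w - norm w *\<^sub>R d) \<le> t * (\<delta> * norm w * norm d)"
      using t by (intro mult_left_mono) auto
    moreover have "norm d *\<^sub>R (t *\<^sub>R w) - norm (t *\<^sub>R w) *\<^sub>R d = t *\<^sub>R (norm d *\<^sub>R w - norm w *\<^sub>R d)"
      using t by (simp add: algebra_simps)
    ultimately have "norm (norm d *\<^sub>R (t *\<^sub>R w) - norm (t *\<^sub>R w) *\<^sub>R d) \<le> \<delta> * norm (t *\<^sub>R w) * norm d"
      using t by (simp add: mult_ac)
    then show "t *\<^sub>R w \<in> dir_nhd \<epsilon> \<delta> d" using small t by (simp add: dir_nhd_def)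
  qed
qed

lemma mem_translate_iff: "a \<in> (+) x ` A \<longleftrightarrow> a - x \<in> A" for x :: "'a::ab_group_add"
  by (force simp: image_iff)

text \<open>Kept apart from the form \<open>x + t k *\<^sub>R s k\<close>: sequences obtained by
  contradiction from shrinking neighbourhoods come without step sizes, and terms equal to
  \<open>x\<close> may occur.\<close>

definition approaches :: "(nat \<Rightarrow> 'a::real_normed_vector) \<Rightarrow> 'a \<Rightarrow> 'a \<Rightarrow> bool" where
  "approaches a x d \<longleftrightarrow> (\<forall>\<epsilon>>0. \<forall>\<delta>>0. \<forall>\<^sub>F n in sequentially. a n \<in> (+) x ` dir_nhd \<epsilon> \<delta> d)"

lemma approachesD: "approaches a x d \<Longrightarrow> \<epsilon> > 0 \<Longrightarrow> \<delta> > 0 \<Longrightarrow> \<forall>\<^sub>F n in sequentially. a n \<in> (+) x ` dir_nhd \<epsilon> \<delta> d"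
  by (simp add: approaches_def)

lemma approaches_tendsto: "approaches a x d \<Longrightarrow> a \<longlonglongrightarrow> x"
proof (rule tendstoI)
  fix e :: real assume "approaches a x d" "e > 0"
  then have "\<forall>\<^sub>F n in sequentially. a n \<in> (+) x ` dir_nhd e 1 d" by (simp add: approachesD)
  then show "\<forall>\<^sub>F n in sequentially. dist (a n) x < e"
    by eventually_elim (auto simp: mem_translate_iff dir_nhd_def dist_norm norm_minus_commute)
qed

lemma approaches_subseq: "approaches a x d \<Longrightarrow> strict_mono r \<Longrightarrow> approaches (\<lambda>n. a (r n)) x d"
  unfolding approaches_def using eventually_subseq by blast

lemma approaches_sector:
  assumes "\<And>k. t k \<ge> 0" "t \<longlonglongrightarrow> 0" "w \<longlonglongrightarrow> d"
  shows "approaches (\<lambda>k. x + t k *\<^sub>R w k) x d"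
  unfolding approaches_def
proof (intro allI impI)
  fix \<epsilon> \<delta> :: real assume "\<epsilon> > 0" "\<delta> > 0"
  then obtain \<eta> where \<eta>: "\<eta> > 0" "\<And>t w. 0 \<le> t \<Longrightarrow> t < \<eta> \<Longrightarrow> norm (w - d) < \<eta> \<Longrightarrow> t *\<^sub>R w \<in> dir_nhd \<epsilon> \<delta> d"
    using dir_nhd_sector by metis
  have "\<forall>\<^sub>F k in sequentially. t k < \<eta>" using order_tendstoD(2)[OF assms(2) \<eta>(1)] .
  moreover have "\<forall>\<^sub>F k in sequentially. norm (w k - d) < \<eta>"
    using tendstoD[OF assms(3) \<eta>(1)] by (simp add: dist_norm)
  ultimately show "\<forall>\<^sub>F k in sequentially. x + t k *\<^sub>R w k \<in> (+) x ` dir_nhd \<epsilon> \<delta> d"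
    by eventually_elim (use assms(1) \<eta>(2) in auto)
qed

lemma approaches_shrinking:
  assumes "\<And>n. a n \<in> (+) x ` dir_nhd (1 / Suc n) (1 / Suc n) d"
  shows "approaches a x d"
  unfolding approaches_def
proof (intro allI impI)
  fix \<epsilon> \<delta> :: real assume "\<epsilon> > 0" "\<delta> > 0"
  then obtain N where N: "1 / real (Suc N) < min \<epsilon> \<delta>" using nat_approx_posE[of "min \<epsilon> \<delta>"] by auto
  have "a n \<in> (+) x ` dir_nhd \<epsilon> \<delta> d" if "n \<ge> N" for n
  proof -
    have "1 / real (Suc n) \<le> 1 / real (Suc N)" using that by (simp add: frac_le)
    then have "1 / real (Suc n) \<le> \<epsilon>" "1 / real (Suc n) \<le> \<delta>" using N by linarith+
    from image_mono[OF dir_nhd_mono[OF this]] show ?thesis using assms[of n] by (rule subsetD)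
  qed
  then show "\<forall>\<^sub>F n in sequentially. a n \<in> (+) x ` dir_nhd \<epsilon> \<delta> d"
    unfolding eventually_sequentially by blast
qed

text \<open>The sum of positive parts dominates the Euclidean norm of Robinson stability and splits
  into components, so that its directional derivative is again a sum and its multipliers range over
  a box.\<close>

definition viol :: "('z \<Rightarrow> real^'p) \<Rightarrow> 'z \<Rightarrow> real" where
  "viol g z = (\<Sum>i\<in>UNIV. max 0 (g z $ i))"

lemma viol_nonneg: "viol g z \<ge> 0"
  unfolding viol_def by (intro sum_nonneg) auto

lemma viol_eq_0: "g z \<le> 0 \<Longrightarrow> viol g z = 0"
  unfolding viol_def less_eq_vec_def by (intro sum.neutral) (auto simp: max_def intro: antisym)

lemma feas_map_iff: "y \<in> feas_map g x \<longleftrightarrow> (\<forall>i. g (x, y) $ i \<le> 0)"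
  by (simp add: feas_map_def less_eq_vec_def)

lemma sol_mapD:
  assumes "y \<in> sol_map f g x"
  shows "\<And>i. g (x, y) $ i \<le> 0" "val_fun f g x = ereal (f (x, y))" "viol g (x, y) = 0"
proof -
  have y: "y \<in> feas_map g x" "\<And>y'. y' \<in> feas_map g x \<Longrightarrow> f (x, y) \<le> f (x, y')"
    using assms by (auto simp: sol_map_def)
  show "\<And>i. g (x, y) $ i \<le> 0" using y(1) by (simp add: feas_map_iff)
  show "val_fun f g x = ereal (f (x, y))" unfolding val_fun_def
    by (rule antisym[OF INF_lower[OF y(1)] INF_greatest]) (simp add: y(2))
  show "viol g (x, y) = 0" using y(1) by (simp add: feas_map_def viol_eq_0)
qed

lemma val_fun_le: "y \<in> feas_map g x \<Longrightarrow> val_fun f g x \<le> ereal (f (x, y))"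
  unfolding val_fun_def by (rule INF_lower)

lemma sol_mapI: "y \<in> feas_map g x \<Longrightarrow> ereal (f (x, y)) \<le> val_fun f g x \<Longrightarrow> y \<in> sol_map f g x"
  unfolding sol_map_def using order_trans[of "ereal (f (x, y))" "val_fun f g x", OF _ val_fun_le] by simp

section \<open>Exact penalization under Robinson stability and inf-compactness\<close>

locale lower_level =
  fixes f :: "'a::euclidean_space \<times> 'b::euclidean_space \<Rightarrow> real" and df
    and g :: "'a \<times> 'b \<Rightarrow> real^'p" and dg :: "'p \<Rightarrow> 'a \<times> 'b \<Rightarrow> 'a \<times> 'b"
    and xb u :: 'a and yb :: 'b and \<Omega> :: "'b set"
  assumes f: "C1 f df" and g: "\<And>i. C1 (\<lambda>z. g z $ i) (dg i)"
    and yb: "yb \<in> sol_map f g xb"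
    and rcr: "\<And>y. y \<in> sol_map f g xb \<Longrightarrow> RCR_regular g xb y"
    and rs: "\<And>y. y \<in> sol_map f g xb \<Longrightarrow> Robinson_stable g xb y u"
    and ric: "restricted_inf_compact f g \<Omega> xb u"
begin

lemma viol_tendsto: "(X \<longlongrightarrow> z) F' \<Longrightarrow> ((\<lambda>k. viol g (X k)) \<longlongrightarrow> viol g z) F'"
  unfolding viol_def by (intro tendsto_sum tendsto_max tendsto_const C1_tendsto[OF g])

text \<open>Projecting onto the feasible set costs at most \<open>\<kappa>\<close> times the constraint violation.\<close>

lemma penalty_local:
  assumes y: "y \<in> sol_map f g xb"
  obtains C \<epsilon> \<delta> where "C \<ge> 0" "\<epsilon> > 0" "\<delta> > 0"
    "\<And>b y'. b \<in> (+) xb ` dir_nhd \<epsilon> \<delta> u \<Longrightarrow> y' \<in> ball y \<epsilon> \<Longrightarrow> val_fun f g b \<le> ereal (f (b, y') + C * viol g (b, y'))"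
proof -
  obtain \<kappa> \<epsilon>1 \<delta>1 where \<kappa>: "\<kappa> > 0" "\<epsilon>1 > 0" "\<delta>1 > 0"
    and RS: "\<And>a b. a \<in> (+) xb ` dir_nhd \<epsilon>1 \<delta>1 u \<Longrightarrow> b \<in> ball y \<epsilon>1 \<Longrightarrow>
        feas_map g a \<noteq> {} \<and> infdist b (feas_map g a) \<le> \<kappa> * norm (\<chi> i. max 0 (g (a, b) $ i))"
    using rs[OF y] unfolding Robinson_stable_def by metis
  \<comment> \<open>Radius 3 is enough: \<open>b\<close> stays within 1 of \<open>xb\<close>,
    \<open>y'\<close> within 1 of \<open>y\<close>, and the projection of \<open>y'\<close> moves by
    less than 1 once the violation is small.\<close>
  obtain L where L: "L > 0" "\<And>a b. a \<in> cball (xb, y) 3 \<Longrightarrow> b \<in> cball (xb, y) 3 \<Longrightarrow> \<bar>f a - f b\<bar> \<le> L * norm (a - b)"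
    using C1_lipschitz_on_compact[OF f compact_cball convex_cball] by metis
  have "((\<lambda>z. \<kappa> * viol g z) \<longlongrightarrow> \<kappa> * viol g (xb, y)) (nhds (xb, y))"
    by (intro tendsto_mult tendsto_const viol_tendsto filterlim_ident)
  then have "\<forall>\<^sub>F z in nhds (xb, y). \<kappa> * viol g z < 1"
    by (rule order_tendstoD(2)) (use sol_mapD(3)[OF y] in simp)
  then obtain \<rho> where \<rho>: "\<rho> > 0" "\<And>z. dist z (xb, y) < \<rho> \<Longrightarrow> \<kappa> * viol g z < 1"
    unfolding eventually_nhds_metric by blast
  define \<epsilon> where "\<epsilon> = min (min \<epsilon>1 1) (\<rho> / 2)"
  have \<epsilon>: "\<epsilon> > 0" "\<epsilon> \<le> \<epsilon>1" "\<epsilon> \<le> 1" "\<epsilon> \<le> \<rho> / 2" using \<kappa> \<rho> by (auto simp: \<epsilon>_def)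
  show ?thesis
  proof (rule that[of "L * \<kappa>" \<epsilon> \<delta>1])
    fix b y' assume b: "b \<in> (+) xb ` dir_nhd \<epsilon> \<delta>1 u" and y': "y' \<in> ball y \<epsilon>"
    have b1: "b \<in> (+) xb ` dir_nhd \<epsilon>1 \<delta>1 u" using b dir_nhd_mono[OF \<epsilon>(2) order_refl] by blast
    have bd: "dist b xb < \<epsilon>" using b by (auto simp: mem_translate_iff dir_nhd_def dist_norm norm_minus_commute)
    have y'd: "dist y' y < \<epsilon>" using y' by (simp add: dist_commute)
    have dist_pair: "dist (a, c) (xb, y) \<le> dist a xb + dist c y" for a c
      unfolding dist_prod_def by (simp add: real_sqrt_le_mono sqrt_sum_squares_le_sum)
    have F: "feas_map g b \<noteq> {}" and id: "infdist y' (feas_map g b) \<le> \<kappa> * norm (\<chi> i. max 0 (g (b, y') $ i))"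
      using RS[OF b1, of y'] y' \<epsilon>(2) by auto
    have "closed (feas_map g b)"
    proof -
      have "continuous_on UNIV (\<lambda>y. g (b, y) $ i)" for i
        by (rule continuous_on_compose2[OF C1_continuous[OF g, of UNIV]]) (auto intro!: continuous_intros)
      then have "closed {y. \<forall>i. g (b, y) $ i \<le> 0}"
        by (intro closed_Collect_all closed_Collect_le continuous_on_const)
      moreover have "feas_map g b = {y. \<forall>i. g (b, y) $ i \<le> 0}" by (auto simp: feas_map_iff)
      ultimately show ?thesis by simp
    qed
    then obtain y2 where y2: "y2 \<in> feas_map g b" "infdist y' (feas_map g b) = dist y' y2"
      using infdist_attains_inf[OF _ F] by blast
    have "norm (\<chi> i. max 0 (g (b, y') $ i)) \<le> viol g (b, y')"
      using norm_le_l1_cart[of "\<chi> i. max 0 (g (b, y') $ i)"] by (simp add: viol_def)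
    then have d2: "dist y' y2 \<le> \<kappa> * viol g (b, y')"
      using id y2(2) \<kappa>(1) mult_left_mono[of "norm (\<chi> i. max 0 (g (b, y') $ i))" "viol g (b, y')" \<kappa>] by linarith
    have "dist (b, y') (xb, y) < \<rho>" using dist_pair[of b y'] bd y'd \<epsilon>(4) by linarith
    then have "dist y' y2 < 1" using d2 \<rho>(2) by fastforce
    then have "dist y2 y < 2" using dist_triangle[of y2 y y'] y'd \<epsilon>(3) by (simp add: dist_commute)
    then have "(b, y2) \<in> cball (xb, y) 3" "(b, y') \<in> cball (xb, y) 3"
      using dist_pair[of b y2] dist_pair[of b y'] bd y'd \<epsilon>(3) by (auto simp: dist_commute)
    then have "\<bar>f (b, y2) - f (b, y')\<bar> \<le> L * norm ((b, y2) - (b, y'))" by (rule L(2))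
    also have "norm ((b, y2) - (b, y')) = dist y' y2" by (simp add: dist_norm norm_minus_commute norm_Pair)
    also have "L * dist y' y2 \<le> L * (\<kappa> * viol g (b, y'))" using d2 L(1) by (intro mult_left_mono) auto
    finally have "f (b, y2) \<le> f (b, y') + L * \<kappa> * viol g (b, y')" by simp
    then show "val_fun f g b \<le> ereal (f (b, y') + L * \<kappa> * viol g (b, y'))"
      using val_fun_le[OF y2(1), of f] by (metis ereal_less_eq(3) order_trans)
  qed (use L \<kappa> \<epsilon> in auto)
qed

text \<open>The penalty at \<open>yb\<close> bounds the optimal values at \<open>a n\<close> from
  above by quantities that tend to \<open>f (xb, yb)\<close>. This replaces upper semicontinuity of
  the value function, so every limit of solutions is optimal.\<close>

lemma sol_limit:
  assumes a: "approaches a xb u" and y: "\<And>n. y n \<in> sol_map f g (a n)" "y \<longlonglongrightarrow> y0"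
  shows "y0 \<in> sol_map f g xb"
proof (rule sol_mapI)
  have lim: "(\<lambda>n. (a n, y n)) \<longlonglongrightarrow> (xb, y0)"
    using approaches_tendsto[OF a] y(2) by (rule tendsto_Pair)
  have "g (xb, y0) $ i \<le> 0" for i
    by (rule LIMSEQ_le_const2[OF C1_tendsto[OF g lim]]) (use sol_mapD(1)[OF y(1)] in blast)
  then show "y0 \<in> feas_map g xb" by (simp add: feas_map_iff)
  obtain C \<epsilon> \<delta> where C: "C \<ge> 0" "\<epsilon> > 0" "\<delta> > 0"
    "\<And>b y'. b \<in> (+) xb ` dir_nhd \<epsilon> \<delta> u \<Longrightarrow> y' \<in> ball yb \<epsilon> \<Longrightarrow> val_fun f g b \<le> ereal (f (b, y') + C * viol g (b, y'))"
    using penalty_local[OF yb] by metis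
  have lim2: "(\<lambda>n. (a n, yb)) \<longlonglongrightarrow> (xb, yb)"
    using approaches_tendsto[OF a] tendsto_const by (rule tendsto_Pair)
  have "\<forall>\<^sub>F n in sequentially. f (a n, y n) \<le> f (a n, yb) + C * viol g (a n, yb)"
    using approachesD[OF a C(2,3)]
  proof eventually_elim
    case (elim n)
    then show ?case using C(4)[of "a n" yb] sol_mapD(2)[OF y(1)] C(2) by simp
  qed
  moreover have "(\<lambda>n. f (a n, yb) + C * viol g (a n, yb)) \<longlonglongrightarrow> f (xb, yb) + C * viol g (xb, yb)"
    by (intro tendsto_add tendsto_mult tendsto_const C1_tendsto[OF f lim2] viol_tendsto lim2)
  ultimately have "f (xb, y0) \<le> f (xb, yb) + C * viol g (xb, yb)"
    using tendsto_le[OF sequentially_bot _ C1_tendsto[OF f lim]] by blast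
  then show "ereal (f (xb, y0)) \<le> val_fun f g xb" using sol_mapD[OF yb] by simp
qed

text \<open>The local constants become uniform by compactness of \<open>\<Omega>\<close>: if all
  choices failed, the solutions \<open>y\<close> at which they fail would accumulate at a point that
  \<open>sol_limit\<close> makes a solution at \<open>xb\<close>, and its local penalty contradicts
  the failures. The balls are centred at solutions for the nearby parameters \<open>a\<close>, since
  that is where difference quotients are formed later.\<close>

lemma penalty:
  obtains C \<epsilon> \<delta> where "C \<ge> 0" "\<epsilon> > 0" "\<delta> > 0"
    "\<And>a. a \<in> (+) xb ` dir_nhd \<epsilon> \<delta> u \<Longrightarrow> sol_map f g a \<inter> \<Omega> \<noteq> {}"
    "\<And>a y b y'. a \<in> (+) xb ` dir_nhd \<epsilon> \<delta> u \<Longrightarrow> y \<in> sol_map f g a \<inter> \<Omega> \<Longrightarrow> b \<in> (+) xb ` dir_nhd \<epsilon> \<delta> u \<Longrightarrow>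
      y' \<in> ball y \<epsilon> \<Longrightarrow> val_fun f g b \<le> ereal (f (b, y') + C * viol g (b, y'))"
proof -
  obtain \<epsilon>1 \<delta>1 where ric1: "compact \<Omega>" "\<epsilon>1 > 0" "\<delta>1 > 0"
    "\<And>a. a \<in> (+) xb ` dir_nhd \<epsilon>1 \<delta>1 u \<Longrightarrow> val_fun f g a < val_fun f g xb + ereal \<epsilon>1 \<Longrightarrow> sol_map f g a \<inter> \<Omega> \<noteq> {}"
    using ric unfolding restricted_inf_compact_def by metis
  \<comment> \<open>Comparison with the fixed point \<open>yb\<close> keeps the value below the
    threshold of inf-compactness.\<close>
  have sol: "\<forall>\<^sub>F n in sequentially. sol_map f g (a n) \<inter> \<Omega> \<noteq> {}" if a: "approaches a xb u" for a
  proof -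
    obtain C \<epsilon> \<delta> where C: "C \<ge> 0" "\<epsilon> > 0" "\<delta> > 0"
      "\<And>b y'. b \<in> (+) xb ` dir_nhd \<epsilon> \<delta> u \<Longrightarrow> y' \<in> ball yb \<epsilon> \<Longrightarrow> val_fun f g b \<le> ereal (f (b, y') + C * viol g (b, y'))"
      using penalty_local[OF yb] by metis
    have lim2: "(\<lambda>n. (a n, yb)) \<longlonglongrightarrow> (xb, yb)"
      using approaches_tendsto[OF a] tendsto_const by (rule tendsto_Pair)
    have "(\<lambda>n. f (a n, yb) + C * viol g (a n, yb)) \<longlonglongrightarrow> f (xb, yb) + C * viol g (xb, yb)"
      by (intro tendsto_add tendsto_mult tendsto_const C1_tendsto[OF f lim2] viol_tendsto lim2)
    then have "\<forall>\<^sub>F n in sequentially. f (a n, yb) + C * viol g (a n, yb) < f (xb, yb) + \<epsilon>1"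
      by (rule order_tendstoD(2)) (use sol_mapD(3)[OF yb] ric1(2) in simp)
    with approachesD[OF a C(2,3)] approachesD[OF a ric1(2,3)] show ?thesis
    proof eventually_elim
      case (elim n)
      have "val_fun f g (a n) \<le> ereal (f (a n, yb) + C * viol g (a n, yb))" using C elim(1) by simp
      also have "\<dots> < ereal (f (xb, yb) + \<epsilon>1)" using elim(3) by simp
      also have "\<dots> = val_fun f g xb + ereal \<epsilon>1" using sol_mapD(2)[OF yb] by simp
      finally show ?case using ric1(4) elim(2) by blast
    qed
  qed
  define N where "N = (\<lambda>n. (+) xb ` dir_nhd (1 / real (Suc n)) (1 / real (Suc n)) u)"
  let ?bad = "\<lambda>n a y b y'. y \<in> sol_map f g a \<and> y \<in> \<Omega> \<and> b \<in> N n \<and> y' \<in> ball y (1 / real (Suc n))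
      \<and> \<not> val_fun f g b \<le> ereal (f (b, y') + real (Suc n) * viol g (b, y'))"
  have "\<exists>n. \<forall>a\<in>N n. sol_map f g a \<inter> \<Omega> \<noteq> {} \<and> (\<forall>y b y'. \<not> ?bad n a y b y')"
  proof (rule ccontr)
    assume "\<not> ?thesis"
    then have "\<forall>n. \<exists>a. a \<in> N n \<and> (sol_map f g a \<inter> \<Omega> = {} \<or> (\<exists>y b y'. ?bad n a y b y'))" by blast
    from choice[OF this] obtain a where a: "\<And>n. a n \<in> N n"
      and bad: "\<And>n. sol_map f g (a n) \<inter> \<Omega> = {} \<or> (\<exists>y b y'. ?bad n (a n) y b y')" by blast
    have ap: "approaches a xb u" by (rule approaches_shrinking) (rule a[unfolded N_def])
    \<comment> \<open>Solutions in \<open>\<Omega>\<close> exist along any such sequence, so beyond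
      \<open>n0\<close> only a failing penalty inequality remains.\<close>
    obtain n0 where n0: "\<And>n. n \<ge> n0 \<Longrightarrow> sol_map f g (a n) \<inter> \<Omega> \<noteq> {}"
      using sol[OF ap] unfolding eventually_sequentially by blast
    have ex: "\<exists>y b y'. ?bad (n + n0) (a (n + n0)) y b y'" for n
      using bad[of "n + n0"] n0[of "n + n0"] by simp
    then obtain y b y' where y: "\<And>n. ?bad (n + n0) (a (n + n0)) (y n) (b n) (y' n)" by metis
    obtain y0 r where y0: "y0 \<in> \<Omega>" and r: "strict_mono r" and "(y \<circ> r) \<longlonglongrightarrow> y0"
      using seq_compactE[OF compact_imp_seq_compact[OF ric1(1)], of y] y by metis
    then have ylim: "(\<lambda>n. y (r n)) \<longlonglongrightarrow> y0" by (simp add: o_def)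
    have r0: "strict_mono (\<lambda>n. r n + n0)" using r by (simp add: strict_mono_def)
    have S0: "y0 \<in> sol_map f g xb"
      by (rule sol_limit[OF approaches_subseq[OF ap r0] _ ylim]) (use y in blast)
    have bN: "b (r n) \<in> N n" for n
    proof -
      have "1 / real (Suc (r n + n0)) \<le> 1 / real (Suc n)"
        using seq_suble[OF r, of n] by (intro frac_le) auto
      from image_mono[OF dir_nhd_mono[OF this this]] have "N (r n + n0) \<subseteq> N n" by (simp only: N_def)
      then show ?thesis using y[of "r n"] by blast
    qed
    have bap: "approaches (\<lambda>n. b (r n)) xb u" by (rule approaches_shrinking) (rule bN[unfolded N_def])
    have y'lim: "(\<lambda>n. y' (r n)) \<longlonglongrightarrow> y0"
    proof -
      have "(\<lambda>n. y (r n) - y' (r n)) \<longlonglongrightarrow> 0"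
      proof (rule Lim_null_comparison)
        have "norm (y (r n) - y' (r n)) \<le> 1 / real (Suc n)" for n
        proof -
          have "1 / real (Suc (r n + n0)) \<le> 1 / real (Suc n)"
            using seq_suble[OF r, of n] by (intro frac_le) auto
          then show ?thesis using y[of "r n"] by (auto simp: dist_norm)
        qed
        then show "\<forall>\<^sub>F n in sequentially. norm (y (r n) - y' (r n)) \<le> 1 / real (Suc n)" by simp
        show "(\<lambda>n. 1 / real (Suc n)) \<longlonglongrightarrow> 0" using LIMSEQ_inverse_real_of_nat by (simp add: divide_inverse)
      qed
      from tendsto_diff[OF ylim this] show ?thesis by simp
    qed
    obtain C \<epsilon> \<delta> where C: "C \<ge> 0" "\<epsilon> > 0" "\<delta> > 0"
      "\<And>b y'. b \<in> (+) xb ` dir_nhd \<epsilon> \<delta> u \<Longrightarrow> y' \<in> ball y0 \<epsilon> \<Longrightarrow> val_fun f g b \<le> ereal (f (b, y') + C * viol g (b, y'))"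
      using penalty_local[OF S0] by metis
    have "\<forall>\<^sub>F n in sequentially. n \<ge> nat \<lceil>C\<rceil>" by (rule eventually_ge_at_top)
    with approachesD[OF bap C(2,3)] tendstoD[OF y'lim C(2)] have "\<forall>\<^sub>F n in sequentially. False"
    proof eventually_elim
      case (elim n)
      have "val_fun f g (b (r n)) \<le> ereal (f (b (r n), y' (r n)) + C * viol g (b (r n), y' (r n)))"
        using elim by (intro C(4)) (auto simp: dist_commute)
      \<comment> \<open>Once \<open>n\<close> exceeds the local constant, the inequality that is
        supposed to fail is weaker than the local one.\<close>
      also have "\<dots> \<le> ereal (f (b (r n), y' (r n)) + real (Suc (r n + n0)) * viol g (b (r n), y' (r n)))"
      proof -
        have "C \<le> real n" using elim(3) by linarith
        also have "\<dots> \<le> real (Suc (r n + n0))" using seq_suble[OF r, of n] by simp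
        finally show ?thesis by (simp add: mult_right_mono viol_nonneg)
      qed
      finally show ?case using y[of "r n"] by blast
    qed
    then show False by simp
  qed
  then obtain n where n: "\<forall>a\<in>N n. sol_map f g a \<inter> \<Omega> \<noteq> {} \<and> (\<forall>y b y'. \<not> ?bad n a y b y')" by blast
  have Nn: "(+) xb ` dir_nhd (1 / real (Suc n)) (1 / real (Suc n)) u = N n" by (simp only: N_def)
  show ?thesis
  proof (rule that[of "real (Suc n)" "1 / real (Suc n)" "1 / real (Suc n)", unfolded Nn])
    show "sol_map f g a \<inter> \<Omega> \<noteq> {}" if "a \<in> N n" for a using n that by blast
    show "val_fun f g b \<le> ereal (f (b, y') + real (Suc n) * viol g (b, y'))"
      if "a \<in> N n" "y \<in> sol_map f g a \<inter> \<Omega>" "b \<in> N n" "y' \<in> ball y (1 / real (Suc n))" for a y b y'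
      using n that by blast
  qed auto
qed

end

section \<open>The value function\<close>

text \<open>The constants of \<open>penalty\<close> become parameters, so that the multipliers that
  define \<open>W\<close> share the bound \<open>C\<close> and all estimates live on the one set
  \<open>N\<close>.\<close>

locale lower_level_penalty = lower_level f df g dg xb u yb \<Omega>
  for f :: "'a::euclidean_space \<times> 'b::euclidean_space \<Rightarrow> real" and df
    and g :: "'a \<times> 'b \<Rightarrow> real^'p" and dg xb u yb \<Omega> +
  fixes C \<epsilon> :: real and N :: "'a set" and \<delta> :: real
  assumes C: "C \<ge> 0" and \<epsilon>: "\<epsilon> > 0" and \<delta>: "\<delta> > 0" and N_def: "N = (+) xb ` dir_nhd \<epsilon> \<delta> u"
    and sol\<Omega>: "\<And>a. a \<in> N \<Longrightarrow> sol_map f g a \<inter> \<Omega> \<noteq> {}"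
    and pen: "\<And>a y b y'. a \<in> N \<Longrightarrow> y \<in> sol_map f g a \<inter> \<Omega> \<Longrightarrow> b \<in> N \<Longrightarrow> y' \<in> ball y \<epsilon> \<Longrightarrow>
      val_fun f g b \<le> ereal (f (b, y') + C * viol g (b, y'))"
begin

text \<open>Faithful only where the value is finite, in particular on \<open>N\<close>; infinite
  values become 0.\<close>

definition v :: "'a \<Rightarrow> real" where
  "v x = real_of_ereal (val_fun f g x)"

lemma compact_\<Omega>: "compact \<Omega>"
  using ric unfolding restricted_inf_compact_def by blast

lemma v_sol: "y \<in> sol_map f g a \<Longrightarrow> v a = f (a, y)"
  by (simp add: v_def sol_mapD(2))

lemma val_N: "a \<in> N \<Longrightarrow> val_fun f g a = ereal (v a)"
  using sol\<Omega>[of a] sol_mapD(2) by (fastforce simp: v_sol)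

lemma v_pen: "a \<in> N \<Longrightarrow> y \<in> sol_map f g a \<inter> \<Omega> \<Longrightarrow> b \<in> N \<Longrightarrow> y' \<in> ball y \<epsilon> \<Longrightarrow> v b \<le> f (b, y') + C * viol g (b, y')"
  using pen[of a y b y'] val_N[of b] by simp

lemma xb_N: "xb \<in> N"
  unfolding N_def mem_translate_iff using zero_in_dir_nhd[OF \<epsilon>] by simp

lemma approaches_N: "approaches a xb u \<Longrightarrow> \<forall>\<^sub>F n in sequentially. a n \<in> N"
  unfolding N_def by (rule approachesD[OF _ \<epsilon> \<delta>])

text \<open>A solution in \<open>\<Omega>\<close> for \<open>a\<close> serves as trial point for
  \<open>b\<close>: being feasible at \<open>a\<close>, it violates the constraints at
  \<open>b\<close> by at most a multiple of \<open>norm (a - b)\<close>. The ball \<open>K\<close>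
  contains \<open>N \<times> \<Omega>\<close> and is convex, which \<open>N\<close> need not
  be.\<close>

lemma v_lipschitz:
  obtains L where "L > 0" "\<And>a b. a \<in> N \<Longrightarrow> b \<in> N \<Longrightarrow> \<bar>v a - v b\<bar> \<le> L * norm (a - b)"
proof -
  obtain R where R: "\<And>y. y \<in> \<Omega> \<Longrightarrow> norm y \<le> R"
    using compact_imp_bounded[OF compact_\<Omega>] bounded_iff by metis
  define K where "K = cball (0::'a \<times> 'b) (norm xb + \<epsilon> + R)"
  have NK: "(a, y) \<in> K" if "a \<in> N" "y \<in> \<Omega>" for a y
  proof -
    have "norm (a - xb) < \<epsilon>" using that(1) by (simp add: N_def mem_translate_iff dir_nhd_def)
    then have "norm a \<le> norm xb + \<epsilon>" using norm_triangle_ineq2[of a xb] by simp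
    moreover have "norm (a, y) \<le> norm a + norm y" by (simp add: norm_Pair sqrt_sum_squares_le_sum)
    ultimately show ?thesis using R[OF that(2)] by (simp add: K_def)
  qed
  obtain Lf where Lf: "Lf > 0" "\<And>a b. a \<in> K \<Longrightarrow> b \<in> K \<Longrightarrow> \<bar>f a - f b\<bar> \<le> Lf * norm (a - b)"
    using C1_lipschitz_on_compact[OF f, of K] unfolding K_def by (metis compact_cball convex_cball)
  have "\<exists>L>0. \<forall>a\<in>K. \<forall>b\<in>K. \<bar>g a $ i - g b $ i\<bar> \<le> L * norm (a - b)" for i
    using C1_lipschitz_on_compact[OF g, of K i] unfolding K_def by (metis compact_cball convex_cball)
  then obtain Lg where Lg: "\<And>i. Lg i > 0" "\<And>i a b. a \<in> K \<Longrightarrow> b \<in> K \<Longrightarrow> \<bar>g a $ i - g b $ i\<bar> \<le> Lg i * norm (a - b)"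
    by metis
  define L where "L = Lf + C * (\<Sum>i\<in>UNIV. Lg i)"
  have one: "v b - v a \<le> L * norm (a - b)" if ab: "a \<in> N" "b \<in> N" for a b
  proof -
    obtain y where y: "y \<in> sol_map f g a" "y \<in> \<Omega>" using sol\<Omega>[OF ab(1)] by blast
    have n: "norm ((b, y) - (a, y)) = norm (a - b)" by (simp add: norm_Pair norm_minus_commute)
    have inK: "(a, y) \<in> K" "(b, y) \<in> K" using NK ab y by auto
    have "viol g (b, y) \<le> (\<Sum>i\<in>UNIV. Lg i * norm (a - b))" unfolding viol_def
    proof (rule sum_mono)
      fix i
      have "g (b, y) $ i - g (a, y) $ i \<le> Lg i * norm (a - b)"
        using Lg(2)[OF inK(2,1), of i] n by simp
      then show "max 0 (g (b, y) $ i) \<le> Lg i * norm (a - b)"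
        using sol_mapD(1)[OF y(1), of i] Lg(1)[of i] by simp
    qed
    then have "C * viol g (b, y) \<le> C * (\<Sum>i\<in>UNIV. Lg i) * norm (a - b)"
      using C by (simp add: mult_left_mono sum_distrib_right mult.assoc)
    moreover have "f (b, y) - f (a, y) \<le> Lf * norm (a - b)" using Lf(2)[OF inK(2,1)] n by simp
    moreover have "v b \<le> f (b, y) + C * viol g (b, y)" using v_pen[OF ab(1) _ ab(2)] y \<epsilon> by simp
    ultimately show ?thesis using v_sol[OF y(1)] by (simp add: L_def distrib_right)
  qed
  show ?thesis
  proof (rule that[of L])
    show "L > 0" unfolding L_def using Lf C Lg(1)
      by (intro add_pos_nonneg mult_nonneg_nonneg sum_nonneg) (auto intro: less_imp_le)
    show "\<bar>v a - v b\<bar> \<le> L * norm (a - b)" if "a \<in> N" "b \<in> N" for a b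
      using one[OF that] one[OF that(2,1)] by (simp add: norm_minus_commute)
  qed
qed

lemma v_continuous: "continuous_on N v"
proof -
  obtain L where L: "L > 0" "\<And>a b. a \<in> N \<Longrightarrow> b \<in> N \<Longrightarrow> \<bar>v a - v b\<bar> \<le> L * norm (a - b)"
    using v_lipschitz by metis
  show ?thesis
    unfolding continuous_on_iff
  proof (intro ballI allI impI)
    fix x e assume x: "x \<in> N" and e: "(e::real) > 0"
    show "\<exists>d>0. \<forall>x'\<in>N. dist x' x < d \<longrightarrow> dist (v x') (v x) < e"
    proof (intro exI[of _ "e / L"] conjI ballI impI)
      fix x' assume x': "x' \<in> N" "dist x' x < e / L"
      then have "L * norm (x' - x) < e" using L(1) by (simp add: dist_norm pos_less_divide_eq mult.commute)
      then show "dist (v x') (v x) < e" using L(2)[OF x'(1) x] by (simp add: dist_real_def)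
    qed (use e L in auto)
  qed
qed

text \<open>Dividing the penalty bound by the step gives the directional derivative of the penalized
  objective at a feasible point: inactive constraints vanish eventually, active ones contribute the
  positive part of their derivative. Base point, steps and lower quotients are left free because the
  lemma is applied to chords, to regular subgradients and to sequences approaching
  \<open>xb\<close>.\<close>

lemma penalty_quotient:
  assumes z: "\<And>i. g (a, y) $ i \<le> 0" and X: "X \<longlonglongrightarrow> a" "(\<lambda>k. (X k - a) /\<^sub>R \<sigma> k) \<longlonglongrightarrow> h"
    and \<sigma>: "\<And>k. \<sigma> k > 0" "\<sigma> \<longlonglongrightarrow> 0" and D: "D \<longlonglongrightarrow> D0"
    and bd: "\<forall>\<^sub>F k in sequentially. \<sigma> k * D k \<le> f (X k, y + \<sigma> k *\<^sub>R w) + C' * viol g (X k, y + \<sigma> k *\<^sub>R w) - f (a, y)"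
  shows "D0 \<le> df (a, y) \<bullet> (h, w) + C' * (\<Sum>i\<in>{i. g (a, y) $ i = 0}. max 0 (dg i (a, y) \<bullet> (h, w)))"
proof -
  define Z where "Z = (\<lambda>k. (X k, y + \<sigma> k *\<^sub>R w))"
  have Zlim: "Z \<longlonglongrightarrow> (a, y)"
    unfolding Z_def using tendsto_add[OF tendsto_const tendsto_scaleR[OF \<sigma>(2) tendsto_const[of w]], of y]
    by (intro tendsto_Pair X(1)) simp
  have quot: "(\<lambda>k. (Z k - (a, y)) /\<^sub>R \<sigma> k) \<longlonglongrightarrow> (h, w)"
  proof -
    have "(Z k - (a, y)) /\<^sub>R \<sigma> k = ((X k - a) /\<^sub>R \<sigma> k, w)" for k
      using \<sigma>(1)[of k] by (simp add: Z_def)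
    then show ?thesis by (simp add: tendsto_Pair X(2))
  qed
  have lf: "(\<lambda>k. (f (Z k) - f (a, y)) / \<sigma> k) \<longlonglongrightarrow> df (a, y) \<bullet> (h, w)"
    by (rule C1_strict_derivative[OF f tendsto_const Zlim quot])
  have lg: "(\<lambda>k. (g (Z k) $ i - g (a, y) $ i) / \<sigma> k) \<longlonglongrightarrow> dg i (a, y) \<bullet> (h, w)" for i
    by (rule C1_strict_derivative[OF g tendsto_const Zlim quot])
  let ?I = "{i. g (a, y) $ i = 0}"
  let ?m = "\<lambda>i. if i \<in> ?I then max 0 (dg i (a, y) \<bullet> (h, w)) else 0"
  have "(\<lambda>k. max 0 (g (Z k) $ i) / \<sigma> k) \<longlonglongrightarrow> ?m i" for i
  proof (cases "i \<in> ?I")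
    case True
    have "(\<lambda>k. max 0 ((g (Z k) $ i - g (a, y) $ i) / \<sigma> k)) \<longlonglongrightarrow> max 0 (dg i (a, y) \<bullet> (h, w))"
      by (intro tendsto_max tendsto_const lg)
    moreover have "max 0 ((g (Z k) $ i - g (a, y) $ i) / \<sigma> k) = max 0 (g (Z k) $ i) / \<sigma> k" for k
      using True \<sigma>(1)[of k] by (auto simp: max_def zero_le_divide_iff)
    ultimately show ?thesis using True by simp
  next
    case False
    then have "g (a, y) $ i < 0" using z[of i] by (simp add: order_less_le)
    from order_tendstoD(2)[OF C1_tendsto[OF g Zlim] this]
    have "\<forall>\<^sub>F k in sequentially. max 0 (g (Z k) $ i) / \<sigma> k = 0" by eventually_elim simp
    then show ?thesis using False by (simp add: tendsto_eventually)
  qed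
  then have "(\<lambda>k. \<Sum>i\<in>UNIV. max 0 (g (Z k) $ i) / \<sigma> k) \<longlonglongrightarrow> (\<Sum>i\<in>UNIV. ?m i)" by (rule tendsto_sum)
  moreover have "(\<Sum>i\<in>UNIV. ?m i) = (\<Sum>i\<in>?I. max 0 (dg i (a, y) \<bullet> (h, w)))"
    by (simp add: sum.If_cases)
  ultimately have "(\<lambda>k. viol g (Z k) / \<sigma> k) \<longlonglongrightarrow> (\<Sum>i\<in>?I. max 0 (dg i (a, y) \<bullet> (h, w)))"
    by (simp add: viol_def sum_divide_distrib)
  then have lim: "(\<lambda>k. (f (Z k) - f (a, y)) / \<sigma> k + C' * (viol g (Z k) / \<sigma> k))
      \<longlonglongrightarrow> df (a, y) \<bullet> (h, w) + C' * (\<Sum>i\<in>?I. max 0 (dg i (a, y) \<bullet> (h, w)))"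
    by (intro tendsto_add tendsto_mult tendsto_const lf)
  have "\<forall>\<^sub>F k in sequentially. D k \<le> (f (Z k) - f (a, y)) / \<sigma> k + C' * (viol g (Z k) / \<sigma> k)"
    using bd
  proof eventually_elim
    case (elim k)
    then have "D k \<le> (f (Z k) + C' * viol g (Z k) - f (a, y)) / \<sigma> k"
      using \<sigma>(1)[of k] by (simp add: Z_def pos_le_divide_eq mult.commute)
    then show ?case by (simp add: add_divide_distrib diff_divide_distrib)
  qed
  then show ?thesis by (rule tendsto_le[OF sequentially_bot lim D])
qed

text \<open>The bound \<open>c\<close> is the one that a penalty constant provides; it is what later
  lets multipliers converge along subsequences.\<close>

definition kkt :: "real \<Rightarrow> 'a \<times> 'b \<Rightarrow> real^'p \<Rightarrow> bool" where
  "kkt c z \<mu> \<longleftrightarrow> (\<forall>i. 0 \<le> \<mu> $ i \<and> \<mu> $ i \<le> c) \<and> (\<forall>i. g z $ i \<noteq> 0 \<longrightarrow> \<mu> $ i = 0)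
     \<and> snd (df z) + (\<Sum>i\<in>UNIV. \<mu> $ i *\<^sub>R snd (dg i z)) = 0"

definition Lx :: "'a \<times> 'b \<Rightarrow> real^'p \<Rightarrow> 'a" where
  "Lx z \<mu> = fst (df z) + (\<Sum>i\<in>UNIV. \<mu> $ i *\<^sub>R fst (dg i z))"

lemma kkt_of_bound:
  assumes "c \<ge> 0"
    and "\<And>w. D \<le> df z \<bullet> (h, w) + c * (\<Sum>i\<in>{i. g z $ i = 0}. max 0 (dg i z \<bullet> (h, w)))"
  obtains \<mu> where "kkt c z \<mu>" "D \<le> Lx z \<mu> \<bullet> h"
proof -
  let ?I = "{i. g z $ i = 0}"
  have bound: "D - fst (df z) \<bullet> h \<le> snd (df z) \<bullet> w + c * (\<Sum>i\<in>?I. max 0 (snd (dg i z) \<bullet> w + fst (dg i z) \<bullet> h))" for w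
    using assms(2)[of w] by (simp add: inner_prod_def add.commute)
  obtain \<mu> where \<mu>: "\<And>i. 0 \<le> \<mu> i" "\<And>i. \<mu> i \<le> c" "\<And>i. i \<notin> ?I \<Longrightarrow> \<mu> i = 0"
    "snd (df z) + (\<Sum>i\<in>?I. \<mu> i *\<^sub>R snd (dg i z)) = 0" "D - fst (df z) \<bullet> h \<le> (\<Sum>i\<in>?I. \<mu> i * (fst (dg i z) \<bullet> h))"
    by (rule box_multiplier[OF finite assms(1) bound], rule that)
  have "(\<Sum>i\<in>UNIV. \<mu> i *\<^sub>R snd (dg i z)) = (\<Sum>i\<in>?I. \<mu> i *\<^sub>R snd (dg i z))"
    by (rule sum.mono_neutral_right) (use \<mu>(3) in auto)
  moreover have "(\<Sum>i\<in>UNIV. \<mu> i * (fst (dg i z) \<bullet> h)) = (\<Sum>i\<in>?I. \<mu> i * (fst (dg i z) \<bullet> h))"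
    by (rule sum.mono_neutral_right) (use \<mu>(3) in auto)
  ultimately show ?thesis
    using \<mu> by (intro that[of "\<chi> i. \<mu> i"]) (auto simp: kkt_def Lx_def inner_add_left inner_sum_left)
qed

text \<open>With \<open>h\<close> free as well, the box lemma is applied on the product space with
  lower bound 0 and zero offsets. The two components of the resulting equation are
  \<open>Lx z \<mu> = \<xi>\<close> and stationarity in the second variable.\<close>

lemma kkt_of_full_bound:
  assumes "c \<ge> 0"
    and "\<And>h w. \<xi> \<bullet> h \<le> df z \<bullet> (h, w) + c * (\<Sum>i\<in>{i. g z $ i = 0}. max 0 (dg i z \<bullet> (h, w)))"
  obtains \<mu> where "kkt c z \<mu>" "Lx z \<mu> = \<xi>"
proof -
  let ?I = "{i. g z $ i = 0}"
  have bound: "0 \<le> (df z - (\<xi>, 0)) \<bullet> k + c * (\<Sum>i\<in>?I. max 0 (dg i z \<bullet> k + 0))" for k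
    using assms(2)[of "fst k" "snd k"] by (cases k) (simp add: inner_diff_left)
  obtain \<mu> where \<mu>: "\<And>i. 0 \<le> \<mu> i" "\<And>i. \<mu> i \<le> c" "\<And>i. i \<notin> ?I \<Longrightarrow> \<mu> i = 0"
    "df z - (\<xi>, 0) + (\<Sum>i\<in>?I. \<mu> i *\<^sub>R dg i z) = 0"
    by (rule box_multiplier[OF finite assms(1) bound], rule that)
  have "(\<Sum>i\<in>UNIV. \<mu> i *\<^sub>R dg i z) = (\<Sum>i\<in>?I. \<mu> i *\<^sub>R dg i z)"
    by (rule sum.mono_neutral_right) (use \<mu>(3) in auto)
  with \<mu>(4) have e: "df z - (\<xi>, 0) + (\<Sum>i\<in>UNIV. \<mu> i *\<^sub>R dg i z) = 0" by simp
  show ?thesis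
    using \<mu> arg_cong[OF e, of fst] arg_cong[OF e, of snd]
    by (intro that[of "\<chi> i. \<mu> i"]) (auto simp: kkt_def Lx_def fst_sum snd_sum algebra_simps)
qed

text \<open>A substitute for a subdifferential of the value function that is nonempty at every point
  of \<open>N\<close>, interior or not, and keeps track of solutions in \<open>\<Omega>\<close> and
  bounded multipliers.\<close>

definition W :: "'a \<Rightarrow> 'a set" where
  "W a = {Lx (a, y) \<mu> | y \<mu>. y \<in> sol_map f g a \<inter> \<Omega> \<and> kkt C (a, y) \<mu>}"

lemma eventually_ball:
  fixes y w :: 'b
  assumes "\<sigma> \<longlonglongrightarrow> 0" "e > 0"
  shows "\<forall>\<^sub>F k in sequentially. y + \<sigma> k *\<^sub>R w \<in> ball y e"
proof -
  have "(\<lambda>k. y + \<sigma> k *\<^sub>R w) \<longlonglongrightarrow> y + 0 *\<^sub>R w" by (intro tendsto_intros assms)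
  then show ?thesis using tendstoD[OF _ assms(2)] by (fastforce simp: dist_commute)
qed

text \<open>Rolle's argument: an upper Dini derivative of \<open>v\<close> is at least the slope where \<open>v\<close> minus the chord is minimal.\<close>

lemma value_mean_value:
  assumes seg: "closed_segment a b \<subseteq> N"
  obtains c \<xi> where "c \<in> closed_segment a b" "\<xi> \<in> W c" "v b - v a \<le> \<xi> \<bullet> (b - a)"
proof -
  define \<gamma> where "\<gamma> = (\<lambda>s::real. a + s *\<^sub>R (b - a))"
  define \<psi> where "\<psi> = (\<lambda>s. v (\<gamma> s) - s * (v b - v a))"
  have \<gamma>seg: "\<gamma> s \<in> closed_segment a b" if "s \<in> {0..1}" for s
    using that by (auto simp: \<gamma>_def closed_segment_def algebra_simps intro!: exI[of _ s])
  then have \<gamma>N: "\<gamma> s \<in> N" if "s \<in> {0..1}" for s using seg that by blast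
  have "continuous_on {0..1} (\<lambda>s. v (\<gamma> s))"
    by (rule continuous_on_compose2[OF v_continuous, where f = \<gamma>]) (use \<gamma>N in \<open>auto simp: \<gamma>_def intro!: continuous_intros\<close>)
  then have "continuous_on {0..1} \<psi>" unfolding \<psi>_def by (intro continuous_intros)
  then obtain s0 where s0: "s0 \<in> {0..1}" "\<And>s. s \<in> {0..1} \<Longrightarrow> \<psi> s0 \<le> \<psi> s"
    using continuous_attains_inf[of "{0..1::real}" \<psi>] by auto
  have "\<psi> 0 = \<psi> 1" by (simp add: \<psi>_def \<gamma>_def)
  \<comment> \<open>Equal end values allow a minimizer other than 1, so that forward steps from
    \<open>s1\<close> stay in the interval.\<close>
  then have "\<exists>s1. 0 \<le> s1 \<and> s1 < 1 \<and> (\<forall>s\<in>{0..1}. \<psi> s1 \<le> \<psi> s)"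
    using s0 by (intro exI[of _ "if s0 = 1 then 0 else s0"]) auto
  then obtain s1 where s1: "0 \<le> s1" "s1 < 1" "\<And>s. s \<in> {0..1} \<Longrightarrow> \<psi> s1 \<le> \<psi> s" by blast
  let ?c = "\<gamma> s1" and ?h = "b - a"
  have c: "?c \<in> N" using \<gamma>N s1 by simp
  then obtain y where y: "y \<in> sol_map f g ?c" "y \<in> \<Omega>" using sol\<Omega> by blast
  \<comment> \<open>The factor \<open>1 - s1\<close> keeps \<open>s1 + \<sigma> k\<close> in the
    unit interval for every \<open>k\<close>.\<close>
  define \<sigma> where "\<sigma> = (\<lambda>k. (1 - s1) / real (Suc k))"
  have \<sigma>: "\<sigma> k > 0" "\<sigma> k \<le> 1 - s1" for k
    using s1 mult_left_mono[of 1 "real (Suc k)" "1 - s1"] by (auto simp: \<sigma>_def pos_divide_le_eq)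
  have \<sigma>0: "\<sigma> \<longlonglongrightarrow> 0"
    using tendsto_mult[OF tendsto_const[of "1 - s1"] LIMSEQ_inverse_real_of_nat] by (simp add: \<sigma>_def divide_inverse)
  have X: "?c + \<sigma> k *\<^sub>R ?h = \<gamma> (s1 + \<sigma> k)" for k by (simp add: \<gamma>_def algebra_simps)
  have "v b - v a \<le> df (?c, y) \<bullet> (?h, w) + C * (\<Sum>i\<in>{i. g (?c, y) $ i = 0}. max 0 (dg i (?c, y) \<bullet> (?h, w)))" for w
  proof (rule penalty_quotient[where X = "\<lambda>k. ?c + \<sigma> k *\<^sub>R ?h" and \<sigma> = \<sigma> and D = "\<lambda>_. v b - v a"])
    show "(\<lambda>k. ?c + \<sigma> k *\<^sub>R ?h) \<longlonglongrightarrow> ?c"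
      using tendsto_add[OF tendsto_const tendsto_scaleR[OF \<sigma>0 tendsto_const[of ?h]], of ?c] by simp
    have "(?c + \<sigma> k *\<^sub>R ?h - ?c) /\<^sub>R \<sigma> k = ?h" for k using \<sigma>(1)[of k] by simp
    then show "(\<lambda>k. (?c + \<sigma> k *\<^sub>R ?h - ?c) /\<^sub>R \<sigma> k) \<longlonglongrightarrow> ?h" by simp
    show "\<forall>\<^sub>F k in sequentially. \<sigma> k * (v b - v a)
        \<le> f (?c + \<sigma> k *\<^sub>R ?h, y + \<sigma> k *\<^sub>R w) + C * viol g (?c + \<sigma> k *\<^sub>R ?h, y + \<sigma> k *\<^sub>R w) - f (?c, y)"
      using eventually_ball[OF \<sigma>0 \<epsilon>, of y w]
    proof eventually_elim
      case (elim k)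
      have s: "s1 + \<sigma> k \<in> {0..1}" using \<sigma>[of k] s1 by auto
      have "\<sigma> k * (v b - v a) \<le> v (\<gamma> (s1 + \<sigma> k)) - v ?c"
        using s1(3)[OF s] by (simp add: \<psi>_def algebra_simps)
      moreover have "v (\<gamma> (s1 + \<sigma> k)) \<le> f (\<gamma> (s1 + \<sigma> k), y + \<sigma> k *\<^sub>R w) + C * viol g (\<gamma> (s1 + \<sigma> k), y + \<sigma> k *\<^sub>R w)"
        using v_pen[OF c _ \<gamma>N[OF s] elim] y by blast
      ultimately show ?case unfolding X using v_sol[OF y(1)] by linarith
    qed
  qed (use \<sigma> \<sigma>0 sol_mapD(1)[OF y(1)] in auto)
  from kkt_of_bound[OF C this] obtain \<mu> where \<mu>: "kkt C (?c, y) \<mu>" "v b - v a \<le> Lx (?c, y) \<mu> \<bullet> ?h" by blast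
  show ?thesis
    by (rule that[OF \<gamma>seg _ \<mu>(2)]) (use s1 y \<mu>(1) in \<open>auto simp: W_def\<close>)
qed

text \<open>A regular subgradient minorizes the value function in all directions \<open>h\<close>,
  which the ball inside \<open>N\<close> makes admissible, while the penalty majorizes it; together
  they give the bound for all \<open>h\<close> and \<open>w\<close>.\<close>

lemma regular_subdiff_subset_W:
  assumes a: "e > 0" "ball a e \<subseteq> N"
  shows "regular_subdiff (val_fun f g) a \<subseteq> W a"
proof
  fix \<xi> assume "\<xi> \<in> regular_subdiff (val_fun f g) a"
  then obtain r where r: "r \<in> o[at a](\<lambda>x'. norm (x' - a))"
    and ev: "\<forall>\<^sub>F x' in at a. val_fun f g x' \<ge> val_fun f g a + ereal (\<xi> \<bullet> (x' - a) + r x')"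
    by (auto simp: regular_subdiff_def)
  have aN: "a \<in> N" using a by auto
  then obtain y where y: "y \<in> sol_map f g a" "y \<in> \<Omega>" using sol\<Omega> by blast
  define \<sigma> where "\<sigma> = (\<lambda>k. inverse (real (Suc k)))"
  have \<sigma>: "\<sigma> k > 0" for k by (simp add: \<sigma>_def)
  have \<sigma>0: "\<sigma> \<longlonglongrightarrow> 0" unfolding \<sigma>_def by (rule LIMSEQ_inverse_real_of_nat)
  have "\<xi> \<bullet> h \<le> df (a, y) \<bullet> (h, w) + C * (\<Sum>i\<in>{i. g (a, y) $ i = 0}. max 0 (dg i (a, y) \<bullet> (h, w)))" for h w
  proof -
    let ?X = "\<lambda>k. a + \<sigma> k *\<^sub>R h"
    \<comment> \<open>The remainder is controlled only away from \<open>a\<close>, so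
      \<open>h = 0\<close>, for which all points \<open>?X k\<close> equal \<open>a\<close>, gets
      the quotient 0.\<close>
    define D where "D = (\<lambda>k. if h = 0 then 0 else \<xi> \<bullet> h + r (?X k) / \<sigma> k)"
    have Xa: "?X \<longlonglongrightarrow> a"
      using tendsto_add[OF tendsto_const tendsto_scaleR[OF \<sigma>0 tendsto_const[of h]], of a] by simp
    have XN: "\<forall>\<^sub>F k in sequentially. ?X k \<in> N"
      using tendstoD[OF Xa a(1)] by eventually_elim (use a(2) in \<open>auto simp: dist_commute\<close>)
    have Xat: "filterlim ?X (at a) sequentially" if "h \<noteq> 0"
      unfolding filterlim_at using Xa that \<sigma> by (auto simp: less_imp_neq[symmetric])
    have Dlim: "D \<longlonglongrightarrow> \<xi> \<bullet> h"
    proof (cases "h = 0")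
      case False
      have "(\<lambda>k. r (?X k) / norm (?X k - a)) \<longlonglongrightarrow> 0"
        by (rule filterlim_compose[OF smalloD_tendsto[OF r] Xat[OF False]])
      then have "(\<lambda>k. \<xi> \<bullet> h + r (?X k) / norm (?X k - a) * norm h) \<longlonglongrightarrow> \<xi> \<bullet> h + 0 * norm h"
        by (intro tendsto_intros)
      moreover have "r (?X k) / norm (?X k - a) * norm h = r (?X k) / \<sigma> k" for k
        using False \<sigma>[of k] by simp
      ultimately have "(\<lambda>k. \<xi> \<bullet> h + r (?X k) / \<sigma> k) \<longlonglongrightarrow> \<xi> \<bullet> h" by (simp only: mult_zero_left add_0_right)
      then show ?thesis using False by (simp add: D_def)
    qed (simp add: D_def)
    have "\<forall>\<^sub>F k in sequentially. \<sigma> k * D k \<le> v (?X k) - v a"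
    proof (cases "h = 0")
      case False
      have "\<forall>\<^sub>F k in sequentially. val_fun f g (?X k) \<ge> val_fun f g a + ereal (\<xi> \<bullet> (?X k - a) + r (?X k))"
        by (rule eventually_compose_filterlim[OF ev Xat[OF False]])
      with XN show ?thesis
      proof eventually_elim
        case (elim k)
        then have "v a + (\<xi> \<bullet> (\<sigma> k *\<^sub>R h) + r (?X k)) \<le> v (?X k)" using val_N aN by simp
        then show ?case using False \<sigma>[of k] by (simp add: D_def distrib_left)
      qed
    qed (simp add: D_def)
    then have "\<forall>\<^sub>F k in sequentially. \<sigma> k * D k \<le> f (?X k, y + \<sigma> k *\<^sub>R w) + C * viol g (?X k, y + \<sigma> k *\<^sub>R w) - f (a, y)"
      using XN eventually_ball[OF \<sigma>0 \<epsilon>, of y w]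
    proof eventually_elim
      case (elim k)
      then show ?case using v_pen[OF aN _ elim(2,3)] y v_sol[OF y(1)] by fastforce
    qed
    moreover have "(\<lambda>k. (?X k - a) /\<^sub>R \<sigma> k) \<longlonglongrightarrow> h"
    proof -
      have "(?X k - a) /\<^sub>R \<sigma> k = h" for k using \<sigma>[of k] by simp
      then show ?thesis by simp
    qed
    ultimately show ?thesis using penalty_quotient[OF sol_mapD(1)[OF y(1)] Xa _ \<sigma> \<sigma>0 Dlim] by blast
  qed
  from kkt_of_full_bound[OF C this] obtain \<mu> where "kkt C (a, y) \<mu>" "Lx (a, y) \<mu> = \<xi>" by blast
  then show "\<xi> \<in> W a" using y by (auto simp: W_def)
qed

end

section \<open>Directional derivative of the value function\<close>

lemma grad_eqI: "(h has_derivative (\<lambda>k. D \<bullet> k)) (at z) \<Longrightarrow> grad h z = D"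
  unfolding grad_def gderiv_def
proof (rule the_equality)
  assume h: "(h has_derivative (\<lambda>k. D \<bullet> k)) (at z)"
  then show "(h has_derivative (\<lambda>k. k \<bullet> D)) (at z)" by (simp add: inner_commute)
  fix E assume "(h has_derivative (\<lambda>k. k \<bullet> E)) (at z)"
  then have "(\<lambda>k. k \<bullet> E) = (\<lambda>k. D \<bullet> k)" using h by (rule has_derivative_unique)
  then have "(E - D) \<bullet> (E - D) = 0" by (metis inner_commute inner_diff_right cancel_comm_monoid_add_class.diff_cancel)
  then show "E = D" by simp
qed

lemma grad_C1: "C1 h dh \<Longrightarrow> grad h z = dh z"
  by (rule grad_eqI[OF C1_has_derivative])

lemma grad_y_C1:
  assumes "C1 h dh" shows "grad_y h x y = snd (dh (x, y))"
  unfolding grad_y_def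
proof (rule grad_eqI)
  have "((\<lambda>y'. (x, y')) has_derivative (\<lambda>k. (0, k))) (at y)"
    by (auto intro!: derivative_eq_intros)
  from has_derivative_compose[OF this C1_has_derivative[OF assms]]
  show "((\<lambda>y'. h (x, y')) has_derivative (\<lambda>k. snd (dh (x, y)) \<bullet> k)) (at y)"
    by (simp add: inner_prod_def)
qed

lemma grad_x_C1:
  assumes "C1 h dh" shows "grad_x h x y = fst (dh (x, y))"
  unfolding grad_x_def
proof (rule grad_eqI)
  have "((\<lambda>x'. (x', y)) has_derivative (\<lambda>k. (k, 0))) (at x)"
    by (auto intro!: derivative_eq_intros)
  from has_derivative_compose[OF this C1_has_derivative[OF assms]]
  show "((\<lambda>x'. h (x', y)) has_derivative (\<lambda>k. fst (dh (x, y)) \<bullet> k)) (at x)"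
    by (simp add: inner_prod_def)
qed

lemma C1_lagrangian:
  assumes "C1 f df" "\<And>i. C1 (\<lambda>z. g z $ i) (dg i)"
  shows "C1 (lagrangian f g \<mu>) (\<lambda>z. df z + (\<Sum>i\<in>UNIV. \<mu> $ i *\<^sub>R dg i z))"
  unfolding C1_def
proof (intro conjI allI)
  fix z
  have "((\<lambda>z. f z + (\<Sum>i\<in>UNIV. \<mu> $ i * g z $ i)) has_derivative (\<lambda>k. df z \<bullet> k + (\<Sum>i\<in>UNIV. \<mu> $ i * (dg i z \<bullet> k)))) (at z)"
    by (intro has_derivative_add has_derivative_sum has_derivative_mult_right C1_has_derivative assms)
  then show "(lagrangian f g \<mu> has_derivative (\<lambda>k. (df z + (\<Sum>i\<in>UNIV. \<mu> $ i *\<^sub>R dg i z)) \<bullet> k)) (at z)"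
    by (simp add: lagrangian_def[abs_def] inner_vec_def inner_add_left inner_sum_left mult.commute)
next
  have "continuous_on UNIV df" "\<And>i. continuous_on UNIV (dg i)" using assms by (auto simp: C1_def)
  then show "continuous_on UNIV (\<lambda>z. df z + (\<Sum>i\<in>UNIV. \<mu> $ i *\<^sub>R dg i z))"
    by (intro continuous_intros)
qed

text \<open>At a feasible point the products of constraint values and multipliers are all
  nonpositive, so their sum vanishes only if each does.\<close>

lemma multipliers_iff:
  assumes "C1 f df" "\<And>i. C1 (\<lambda>z. g z $ i) (dg i)" and feas: "\<And>i. g (x, y) $ i \<le> 0"
  shows "\<mu> \<in> multipliers f g x y \<longleftrightarrow> (\<forall>i. 0 \<le> \<mu> $ i) \<and> (\<forall>i. g (x, y) $ i \<noteq> 0 \<longrightarrow> \<mu> $ i = 0)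
    \<and> snd (df (x, y)) + (\<Sum>i\<in>UNIV. \<mu> $ i *\<^sub>R snd (dg i (x, y))) = 0"
proof -
  have "g (x, y) \<bullet> \<mu> = 0 \<longleftrightarrow> (\<forall>i. g (x, y) $ i \<noteq> 0 \<longrightarrow> \<mu> $ i = 0)" if "\<forall>i. 0 \<le> \<mu> $ i"
  proof -
    have "(\<Sum>i\<in>UNIV. - (g (x, y) $ i * \<mu> $ i)) = 0 \<longleftrightarrow> (\<forall>i\<in>UNIV. - (g (x, y) $ i * \<mu> $ i) = 0)"
      by (rule sum_nonneg_eq_0_iff) (use that feas in \<open>auto simp: mult_le_0_iff\<close>)
    then show ?thesis by (auto simp: inner_vec_def sum_negf)
  qed
  moreover have "0 \<le> \<mu> \<longleftrightarrow> (\<forall>i. 0 \<le> \<mu> $ i)" by (simp add: less_eq_vec_def)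
  ultimately show ?thesis
    by (auto simp: multipliers_def grad_y_C1[OF C1_lagrangian[OF assms(1,2)]] snd_sum)
qed

section \<open>Convergence of the difference quotients of the value function\<close>

context lower_level_penalty
begin

text \<open>Shifting \<open>y k\<close> back by \<open>t k *\<^sub>R w\<close> gives a point that is
  feasible at \<open>xb\<close> up to o(t), so its penalized value bounds \<open>v xb\<close> from
  above and yields the estimate for \<open>df\<close>. The third conclusion serves the orthogonality
  to multipliers: a constraint that is zero along the whole sequence has scaled values 0, which
  forces derivative 0.\<close>

lemma direction_selection:
  assumes y0: "y0 \<in> sol_map f g xb" and t: "\<And>k. t k > 0" "t \<longlonglongrightarrow> 0" and s: "s \<longlonglongrightarrow> u"
    and y: "\<And>k. y k \<in> sol_map f g (xb + t k *\<^sub>R s k)" "y \<longlonglongrightarrow> y0"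
    and D: "(\<lambda>k. (v (xb + t k *\<^sub>R s k) - v xb) / t k) \<longlonglongrightarrow> D"
  obtains w where "\<And>i. g (xb, y0) $ i = 0 \<Longrightarrow> dg i (xb, y0) \<bullet> (u, w) \<le> 0" "df (xb, y0) \<bullet> (u, w) \<le> D"
    "\<And>i. \<forall>k. g (xb + t k *\<^sub>R s k, y k) $ i = 0 \<Longrightarrow> dg i (xb, y0) \<bullet> (u, w) = 0"
proof -
  let ?z0 = "(xb, y0)"
  define z where "z = (\<lambda>k. (xb + t k *\<^sub>R s k, y k))"
  have xlim: "(\<lambda>k. xb + t k *\<^sub>R s k) \<longlonglongrightarrow> xb"
    using tendsto_add[OF tendsto_const tendsto_scaleR[OF t(2) s], of xb] by simp
  have zlim: "z \<longlonglongrightarrow> ?z0" unfolding z_def by (intro tendsto_Pair xlim y(2))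
  obtain \<delta>1 where \<delta>1: "\<delta>1 > 0" "\<And>K. K \<subseteq> active g ?z0 \<Longrightarrow> \<exists>r. \<forall>(a, b)\<in>ball ?z0 \<delta>1. dim ((\<lambda>j. grad_y (\<lambda>z. g z $ j) a b) ` K) = r"
    using rcr[OF y0] unfolding RCR_regular_def by blast
  have rank: "\<exists>q. \<forall>z\<in>ball ?z0 \<delta>1. dim ((\<lambda>i. snd (dg i z)) ` K) = q" if "K \<subseteq> {i. g ?z0 $ i = 0}" for K
    using \<delta>1(2)[of K] that by (simp add: active_def grad_y_C1[OF g] split_beta)
  have ulim: "(\<lambda>k. (fst (z k) - fst ?z0) /\<^sub>R t k) \<longlonglongrightarrow> u"
  proof -
    have "(fst (z k) - fst ?z0) /\<^sub>R t k = s k" for k using t(1)[of k] by (simp add: z_def)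
    then show ?thesis using s by simp
  qed
  have feas: "g (z k) $ i \<le> 0" for i k unfolding z_def by (rule sol_mapD(1)[OF y(1)])
  obtain r w where r: "strict_mono (r :: nat \<Rightarrow> nat)"
    and w: "\<And>i. g ?z0 $ i = 0 \<Longrightarrow> dg i ?z0 \<bullet> (u, w) \<le> 0"
      "\<And>i e. g ?z0 $ i = 0 \<Longrightarrow> e > 0 \<Longrightarrow> \<forall>\<^sub>F k in sequentially. g (z (r k)) $ i \<le> t (r k) * (dg i ?z0 \<bullet> (u, w) + e)"
    by (rule rcr_direction[of "\<lambda>i z. g z $ i" dg, OF g \<delta>1(1)], erule rank, rule zlim, rule t(1), rule ulim, rule feas, rule that)
  \<comment> \<open>Both \<open>z (r k)\<close> and \<open>z' k\<close> tend to the base point, and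
    their difference is exactly \<open>t (r k)\<close> times \<open>(s (r k), w)\<close>, so strict
    derivatives apply even if \<open>y\<close> itself moves fast.\<close>
  define z' where "z' = (\<lambda>k. (xb, y (r k) - t (r k) *\<^sub>R w))"
  have sub: "(\<lambda>k. X (r k)) \<longlonglongrightarrow> l" if "X \<longlonglongrightarrow> l" for X :: "nat \<Rightarrow> 'z::topological_space" and l
    using LIMSEQ_subseq_LIMSEQ[OF that r] by (simp add: o_def)
  have y'lim: "(\<lambda>k. y (r k) - t (r k) *\<^sub>R w) \<longlonglongrightarrow> y0"
    using tendsto_diff[OF sub[OF y(2)] tendsto_scaleR[OF sub[OF t(2)] tendsto_const[of w]]] by simp
  then have z'lim: "z' \<longlonglongrightarrow> ?z0" unfolding z'_def by (intro tendsto_Pair tendsto_const)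
  have quot: "(\<lambda>k. (z (r k) - z' k) /\<^sub>R t (r k)) \<longlonglongrightarrow> (u, w)"
  proof -
    have "(z (r k) - z' k) /\<^sub>R t (r k) = (s (r k), w)" for k using t(1)[of "r k"] by (simp add: z_def z'_def)
    then show ?thesis by (simp add: tendsto_Pair sub[OF s])
  qed
  have fq: "(\<lambda>k. (f (z (r k)) - f (z' k)) / t (r k)) \<longlonglongrightarrow> df ?z0 \<bullet> (u, w)"
    by (rule C1_strict_derivative[OF f z'lim sub[OF zlim] quot])
  have gq: "(\<lambda>k. (g (z (r k)) $ i - g (z' k) $ i) / t (r k)) \<longlonglongrightarrow> dg i ?z0 \<bullet> (u, w)" for i
    by (rule C1_strict_derivative[OF g z'lim sub[OF zlim] quot])
  \<comment> \<open>The upper bound on the constraint at \<open>z (r k)\<close> and the increment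
    between the two points differ only by o(t), which is all that remains as violation at
    \<open>z' k\<close>.\<close>
  have small: "\<forall>\<^sub>F k in sequentially. max 0 (g (z' k) $ i) \<le> t (r k) * e" if e: "e > 0" for i e
  proof (cases "g ?z0 $ i = 0")
    case True
    have "e / 2 > 0" using e by simp
    from w(2)[OF True this] have "\<forall>\<^sub>F k in sequentially. g (z (r k)) $ i \<le> t (r k) * (dg i ?z0 \<bullet> (u, w) + e / 2)" .
    moreover have "\<forall>\<^sub>F k in sequentially. dg i ?z0 \<bullet> (u, w) - e / 2 < (g (z (r k)) $ i - g (z' k) $ i) / t (r k)"
      by (rule order_tendstoD(1)[OF gq]) (use e in simp)
    ultimately show ?thesis
    proof eventually_elim
      case (elim k)
      have "t (r k) * (dg i ?z0 \<bullet> (u, w) - e / 2) < g (z (r k)) $ i - g (z' k) $ i"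
        using elim(2) t(1)[of "r k"] by (simp add: pos_less_divide_eq mult.commute)
      then have "g (z' k) $ i \<le> t (r k) * (dg i ?z0 \<bullet> (u, w) + e / 2) - t (r k) * (dg i ?z0 \<bullet> (u, w) - e / 2)"
        using elim(1) by linarith
      also have "\<dots> = t (r k) * e" by (simp add: algebra_simps)
      finally show ?case using t(1)[of "r k"] e by simp
    qed
  next
    case False
    then have "g ?z0 $ i < 0" using sol_mapD(1)[OF y0, of i] by simp
    from order_tendstoD(2)[OF C1_tendsto[OF g z'lim] this] show ?thesis
      by eventually_elim (use t(1) e in \<open>simp add: less_imp_le\<close>)
  qed
  obtain C' e' d' where C': "C' \<ge> 0" "e' > 0" "d' > 0"
    "\<And>b y'. b \<in> (+) xb ` dir_nhd e' d' u \<Longrightarrow> y' \<in> ball y0 e' \<Longrightarrow> val_fun f g b \<le> ereal (f (b, y') + C' * viol g (b, y'))"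
    using penalty_local[OF y0] by metis
  have ev: "\<forall>\<^sub>F k in sequentially. v xb \<le> f (z' k) + C' * viol g (z' k)"
    using tendstoD[OF y'lim C'(2)]
  proof eventually_elim
    case (elim k)
    have "xb \<in> (+) xb ` dir_nhd e' d' u" using zero_in_dir_nhd[OF C'(2)] by (simp add: mem_translate_iff)
    from C'(4)[OF this, of "y (r k) - t (r k) *\<^sub>R w"] elim show ?case
      by (simp add: z'_def dist_commute val_N[OF xb_N])
  qed
  have "df ?z0 \<bullet> (u, w) \<le> D + e" if "e > 0" for e
  proof -
    \<comment> \<open>The tolerance is divided among the constraints and the penalty weight; adding
      1 keeps the denominator positive.\<close>
    define e1 where "e1 = e / (C' * CARD('p) + 1)"
    have e1: "e1 > 0" "C' * (CARD('p) * e1) \<le> e"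
    proof -
      have p: "C' * CARD('p) + 1 > 0" using C'(1) by (simp add: add_nonneg_pos)
      then show "e1 > 0" using that by (simp add: e1_def)
      have "C' * (CARD('p) * e1) = (C' * CARD('p)) / (C' * CARD('p) + 1) * e" by (simp add: e1_def)
      also have "\<dots> \<le> 1 * e" using p that by (intro mult_right_mono) auto
      finally show "C' * (CARD('p) * e1) \<le> e" by simp
    qed
    have "\<forall>\<^sub>F k in sequentially. \<forall>i\<in>UNIV. max 0 (g (z' k) $ i) \<le> t (r k) * e1"
      by (intro eventually_ball_finite finite ballI small e1)
    with ev have "\<forall>\<^sub>F k in sequentially. (f (z (r k)) - f (z' k)) / t (r k) - e \<le> (v (xb + t (r k) *\<^sub>R s (r k)) - v xb) / t (r k)"
    proof eventually_elim
      case (elim k)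
      have "viol g (z' k) \<le> CARD('p) * (t (r k) * e1)"
        unfolding viol_def using sum_bounded_above[of UNIV "\<lambda>i. max 0 (g (z' k) $ i)" "t (r k) * e1"] elim(2) by simp
      then have "C' * viol g (z' k) \<le> C' * (CARD('p) * (t (r k) * e1))" using C'(1) by (intro mult_left_mono) auto
      also have "\<dots> = t (r k) * (C' * (CARD('p) * e1))" by simp
      also have "\<dots> \<le> t (r k) * e" using e1(2) t(1)[of "r k"] by (intro mult_left_mono) auto
      finally have "f (z (r k)) - f (z' k) - t (r k) * e \<le> f (z (r k)) - v xb" using elim(1) by linarith
      moreover have "f (z (r k)) = v (xb + t (r k) *\<^sub>R s (r k))" using v_sol[OF y(1)] by (simp add: z_def)
      ultimately have "f (z (r k)) - f (z' k) - t (r k) * e \<le> v (xb + t (r k) *\<^sub>R s (r k)) - v xb" by simp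
      then have "(f (z (r k)) - f (z' k) - t (r k) * e) / t (r k) \<le> (v (xb + t (r k) *\<^sub>R s (r k)) - v xb) / t (r k)"
        using t(1)[of "r k"] by (intro divide_right_mono) auto
      then show ?case using t(1)[of "r k"] by (simp add: diff_divide_distrib)
    qed
    then have "df ?z0 \<bullet> (u, w) - e \<le> D"
      by (intro tendsto_le[OF sequentially_bot sub[OF D] tendsto_diff[OF fq tendsto_const]])
    then show ?thesis by simp
  qed
  then have "df ?z0 \<bullet> (u, w) \<le> D" by (rule field_le_epsilon)
  moreover have "dg i ?z0 \<bullet> (u, w) = 0" if zero: "\<forall>k. g (xb + t k *\<^sub>R s k, y k) $ i = 0" for i
  proof (rule antisym)
    have gz: "g (z k) $ i = 0" for k using zero by (simp add: z_def)
    have "(\<lambda>k. g (z k) $ i) \<longlonglongrightarrow> g ?z0 $ i" by (rule C1_tendsto[OF g zlim])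
    then have act: "g ?z0 $ i = 0" by (simp add: gz LIMSEQ_const_iff)
    then show "dg i ?z0 \<bullet> (u, w) \<le> 0" by (rule w)
    \<comment> \<open>With vanishing constraint values the upper estimate from
      \<open>rcr_direction\<close> reads
      \<open>0 \<le> t (r k) * (dg i ?z0 \<bullet> (u, w) + e)\<close>.\<close>
    have "0 \<le> dg i ?z0 \<bullet> (u, w) + e" if "e > 0" for e
    proof -
      have "\<forall>\<^sub>F k in sequentially. 0 \<le> t (r k) * (dg i ?z0 \<bullet> (u, w) + e)"
        using w(2)[OF act that] by (simp add: gz)
      then obtain k where "0 \<le> t (r k) * (dg i ?z0 \<bullet> (u, w) + e)"
        by (auto simp: eventually_sequentially)
      then show ?thesis using t(1)[of "r k"] by (simp add: zero_le_mult_iff)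
    qed
    then show "0 \<le> dg i ?z0 \<bullet> (u, w)" by (rule field_le_epsilon)
  qed
  ultimately show ?thesis using that w(1) by blast
qed

text \<open>The constant comes from the local penalty at \<open>y0\<close> and does not depend on
  the sequence or on \<open>w\<close>; this uniformity permits comparing different sequences at one
  solution.\<close>

lemma quotient_upper_bound:
  assumes y0: "y0 \<in> sol_map f g xb"
  obtains c where "c \<ge> 0" "\<And>t s D w. (\<And>k. t k > 0) \<Longrightarrow> t \<longlonglongrightarrow> 0 \<Longrightarrow> s \<longlonglongrightarrow> u \<Longrightarrow>
    (\<lambda>k. (v (xb + t k *\<^sub>R s k) - v xb) / t k) \<longlonglongrightarrow> D \<Longrightarrow>
    D \<le> df (xb, y0) \<bullet> (u, w) + c * (\<Sum>i\<in>{i. g (xb, y0) $ i = 0}. max 0 (dg i (xb, y0) \<bullet> (u, w)))"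
proof -
  obtain c e d where c: "c \<ge> 0" "e > 0" "d > 0"
    "\<And>b y'. b \<in> (+) xb ` dir_nhd e d u \<Longrightarrow> y' \<in> ball y0 e \<Longrightarrow> val_fun f g b \<le> ereal (f (b, y') + c * viol g (b, y'))"
    using penalty_local[OF y0] by metis
  show ?thesis
  proof (rule that[OF c(1)])
    fix t s D w assume t: "\<And>k. (t k :: real) > 0" "t \<longlonglongrightarrow> 0" and s: "s \<longlonglongrightarrow> u"
      and D: "(\<lambda>k. (v (xb + t k *\<^sub>R s k) - v xb) / t k) \<longlonglongrightarrow> D"
    let ?X = "\<lambda>k. xb + t k *\<^sub>R s k"
    have ap: "approaches ?X xb u" using t s by (intro approaches_sector) (auto intro: less_imp_le)
    show "D \<le> df (xb, y0) \<bullet> (u, w) + c * (\<Sum>i\<in>{i. g (xb, y0) $ i = 0}. max 0 (dg i (xb, y0) \<bullet> (u, w)))"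
    proof (rule penalty_quotient[OF sol_mapD(1)[OF y0] approaches_tendsto[OF ap] _ t D])
      have "(?X k - xb) /\<^sub>R t k = s k" for k using t(1)[of k] by simp
      then show "(\<lambda>k. (?X k - xb) /\<^sub>R t k) \<longlonglongrightarrow> u" using s by simp
      show "\<forall>\<^sub>F k in sequentially. t k * ((v (?X k) - v xb) / t k)
          \<le> f (?X k, y0 + t k *\<^sub>R w) + c * viol g (?X k, y0 + t k *\<^sub>R w) - f (xb, y0)"
        using approachesD[OF ap c(2,3)] approaches_N[OF ap] eventually_ball[OF t(2) c(2), of y0 w]
      proof eventually_elim
        case (elim k)
        have "t k * ((v (?X k) - v xb) / t k) = v (?X k) - f (xb, y0)"
          using t(1)[of k] v_sol[OF y0] by simp
        then show ?case using c(4)[OF elim(1,3)] val_N[OF elim(2)] by simp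
      qed
    qed
  qed
qed

text \<open>The Lipschitz bound keeps the quotients in a compact interval and
  \<open>\<Omega>\<close> keeps suitable solutions in a compact set, so both converge along a common
  subsequence.\<close>

lemma subsequence_quotient:
  assumes t: "\<And>k. t k > 0" "t \<longlonglongrightarrow> 0" and s: "s \<longlonglongrightarrow> u"
  obtains r D y y0 where "strict_mono (r :: nat \<Rightarrow> nat)"
    "(\<lambda>k. (v (xb + t (r k) *\<^sub>R s (r k)) - v xb) / t (r k)) \<longlonglongrightarrow> D"
    "\<And>k. y k \<in> sol_map f g (xb + t (r k) *\<^sub>R s (r k))" "y \<longlonglongrightarrow> y0" "y0 \<in> \<Omega>" "y0 \<in> sol_map f g xb"
proof -
  let ?X = "\<lambda>k. xb + t k *\<^sub>R s k"
  have ap: "approaches ?X xb u" using t s by (intro approaches_sector) (auto intro: less_imp_le)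
  obtain k0 where k0: "\<And>k. k \<ge> k0 \<Longrightarrow> ?X k \<in> N" using approaches_N[OF ap] unfolding eventually_sequentially by blast
  define r0 where "r0 = (\<lambda>k. k + k0)"
  have r0: "strict_mono r0" by (simp add: r0_def strict_mono_def)
  have XN: "?X (r0 k) \<in> N" for k using k0 by (simp add: r0_def)
  have "\<forall>k. \<exists>y. y \<in> sol_map f g (?X (r0 k)) \<and> y \<in> \<Omega>" using sol\<Omega>[OF XN] by blast
  then obtain y where y: "\<And>k. y k \<in> sol_map f g (?X (r0 k))" "\<And>k. y k \<in> \<Omega>" by metis
  obtain y0 r1 where y0: "y0 \<in> \<Omega>" and r1: "strict_mono (r1 :: nat \<Rightarrow> nat)" and "(y \<circ> r1) \<longlonglongrightarrow> y0"
    using seq_compactE[OF compact_imp_seq_compact[OF compact_\<Omega>], of y] y(2) by metis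
  then have ylim: "(\<lambda>k. y (r1 k)) \<longlonglongrightarrow> y0" by (simp add: o_def)
  obtain L where L: "L > 0" "\<And>a b. a \<in> N \<Longrightarrow> b \<in> N \<Longrightarrow> \<bar>v a - v b\<bar> \<le> L * norm (a - b)"
    using v_lipschitz by metis
  obtain B where B: "\<And>k. norm (s k) \<le> B" using convergent_imp_Bseq[OF convergentI[OF s]] by (auto simp: Bseq_def)
  define q where "q = (\<lambda>k. (v (?X (r0 (r1 k))) - v xb) / t (r0 (r1 k)))"
  have "q k \<in> cball 0 (L * B)" for k
  proof -
    let ?t = "t (r0 (r1 k))"
    have "\<bar>v (?X (r0 (r1 k))) - v xb\<bar> \<le> L * norm (?X (r0 (r1 k)) - xb)" by (rule L(2)[OF XN xb_N])
    also have "\<dots> = L * norm (s (r0 (r1 k))) * ?t" using t(1)[of "r0 (r1 k)"] by simp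
    also have "\<dots> \<le> L * B * ?t" using B L(1) t(1)[of "r0 (r1 k)"] by (intro mult_right_mono mult_left_mono) auto
    finally show ?thesis using t(1)[of "r0 (r1 k)"] by (simp add: q_def abs_divide pos_divide_le_eq)
  qed
  then obtain D r2 where r2: "strict_mono (r2 :: nat \<Rightarrow> nat)" and D: "(q \<circ> r2) \<longlonglongrightarrow> D"
    using seq_compactE[OF compact_imp_seq_compact[OF compact_cball[of 0 "L * B"]], of q] by metis
  define r where "r = (\<lambda>k. r0 (r1 (r2 k)))"
  have r: "strict_mono r" using r0 r1 r2 by (simp add: r_def strict_mono_def)
  have r12: "strict_mono (\<lambda>k. r0 (r1 k))" using r0 r1 by (simp add: strict_mono_def)
  have "y0 \<in> sol_map f g xb"
    by (rule sol_limit[OF approaches_subseq[OF ap r12] _ ylim]) (rule y(1))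
  then show ?thesis
  proof (intro that[OF r, of D "\<lambda>k. y (r1 (r2 k))" y0] y0)
    show "(\<lambda>k. (v (xb + t (r k) *\<^sub>R s (r k)) - v xb) / t (r k)) \<longlonglongrightarrow> D"
      using D by (simp add: q_def r_def o_def)
    show "(\<lambda>k. y (r1 (r2 k))) \<longlonglongrightarrow> y0" using LIMSEQ_subseq_LIMSEQ[OF ylim r2] by (simp add: o_def)
  qed (use y(1) in \<open>auto simp: r_def\<close>)
qed

text \<open>The direction \<open>w\<close> selected along the primed-free sequence satisfies all
  linearized active constraints, so the penalty term in the upper bound for the other sequence
  vanishes: \<open>D' \<le> df (xb, y0) \<bullet> (u, w) \<le> D\<close>.\<close>

lemma quotient_limit_unique:
  assumes "\<And>k. t k > 0" "t \<longlonglongrightarrow> 0" "s \<longlonglongrightarrow> u"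
    "\<And>k. y k \<in> sol_map f g (xb + t k *\<^sub>R s k)" "y \<longlonglongrightarrow> y0" "y0 \<in> sol_map f g xb"
    "(\<lambda>k. (v (xb + t k *\<^sub>R s k) - v xb) / t k) \<longlonglongrightarrow> D"
    and "\<And>k. t' k > 0" "t' \<longlonglongrightarrow> 0" "s' \<longlonglongrightarrow> u" "(\<lambda>k. (v (xb + t' k *\<^sub>R s' k) - v xb) / t' k) \<longlonglongrightarrow> D'"
  shows "D' \<le> D"
proof -
  obtain w where w: "\<And>i. g (xb, y0) $ i = 0 \<Longrightarrow> dg i (xb, y0) \<bullet> (u, w) \<le> 0" "df (xb, y0) \<bullet> (u, w) \<le> D"
    by (rule direction_selection[OF assms(6,1,2,3,4,5,7)], rule that)
  obtain c where "D' \<le> df (xb, y0) \<bullet> (u, w) + c * (\<Sum>i\<in>{i. g (xb, y0) $ i = 0}. max 0 (dg i (xb, y0) \<bullet> (u, w)))"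
  proof (rule quotient_upper_bound[OF assms(6)])
    fix c assume "\<And>t s D w. (\<And>k. t k > 0) \<Longrightarrow> t \<longlonglongrightarrow> 0 \<Longrightarrow> s \<longlonglongrightarrow> u \<Longrightarrow>
      (\<lambda>k. (v (xb + t k *\<^sub>R s k) - v xb) / t k) \<longlonglongrightarrow> D \<Longrightarrow>
      D \<le> df (xb, y0) \<bullet> (u, w) + c * (\<Sum>i\<in>{i. g (xb, y0) $ i = 0}. max 0 (dg i (xb, y0) \<bullet> (u, w)))"
    from this[OF assms(8-11)] show ?thesis by (rule that)
  qed
  moreover have "(\<Sum>i\<in>{i. g (xb, y0) $ i = 0}. max 0 (dg i (xb, y0) \<bullet> (u, w))) = 0"
    by (rule sum.neutral) (use w(1) in \<open>auto simp: max_def intro: antisym\<close>)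
  ultimately show ?thesis using w(2) by simp
qed

text \<open>Any two subsequential limits bound each other, so the limit \<open>d\<close> of one
  reference subsequence is the limit for all step sizes and all converging directions.\<close>

lemma quotient_limit:
  obtains d where "\<And>t s. (\<And>k. t k > 0) \<Longrightarrow> t \<longlonglongrightarrow> 0 \<Longrightarrow> s \<longlonglongrightarrow> u \<Longrightarrow>
    (\<lambda>k. (v (xb + t k *\<^sub>R s k) - v xb) / t k) \<longlonglongrightarrow> d"
proof -
  define t0 where "t0 = (\<lambda>k. inverse (real (Suc k)))"
  define s0 where "s0 = (\<lambda>_::nat. u)"
  have inv: "\<And>k. t0 k > 0" "t0 \<longlonglongrightarrow> 0" "s0 \<longlonglongrightarrow> u"
    using LIMSEQ_inverse_real_of_nat by (auto simp: t0_def s0_def)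
  obtain r d y y0 where rd: "strict_mono (r :: nat \<Rightarrow> nat)"
    "(\<lambda>k. (v (xb + t0 (r k) *\<^sub>R s0 (r k)) - v xb) / t0 (r k)) \<longlonglongrightarrow> d"
    "\<And>k. y k \<in> sol_map f g (xb + t0 (r k) *\<^sub>R s0 (r k))" "y \<longlonglongrightarrow> y0" "y0 \<in> \<Omega>" "y0 \<in> sol_map f g xb"
    by (rule subsequence_quotient[OF inv], rule that)
  have rl: "\<And>k. t0 (r k) > 0" "(\<lambda>k. t0 (r k)) \<longlonglongrightarrow> 0" "(\<lambda>k. s0 (r k)) \<longlonglongrightarrow> u"
    using inv(1) LIMSEQ_subseq_LIMSEQ[OF inv(2) rd(1)] LIMSEQ_subseq_LIMSEQ[OF inv(3) rd(1)] by (auto simp: o_def)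
  show ?thesis
  proof (rule that, rule ccontr)
    fix t s assume t: "\<And>k. (t k :: real) > 0" "t \<longlonglongrightarrow> 0" and s: "s \<longlonglongrightarrow> u"
      and not: "\<not> (\<lambda>k. (v (xb + t k *\<^sub>R s k) - v xb) / t k) \<longlonglongrightarrow> d"
    define q where "q = (\<lambda>k. (v (xb + t k *\<^sub>R s k) - v xb) / t k)"
    obtain e where e: "e > 0" "\<And>k0. \<exists>k\<ge>k0. \<not> dist (q k) d < e"
      using not unfolding q_def[symmetric] LIMSEQ_def by blast
    obtain \<rho> where \<rho>: "strict_mono (\<rho> :: nat \<Rightarrow> nat)" "\<And>k. \<not> dist (q (\<rho> k)) d < e"
      using infinite_enumerate[of "{k. \<not> dist (q k) d < e}"] e(2)
      unfolding infinite_nat_iff_unbounded_le by auto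
    have t\<rho>: "\<And>k. t (\<rho> k) > 0" "(\<lambda>k. t (\<rho> k)) \<longlonglongrightarrow> 0" "(\<lambda>k. s (\<rho> k)) \<longlonglongrightarrow> u"
      using t s LIMSEQ_subseq_LIMSEQ[OF t(2) \<rho>(1)] LIMSEQ_subseq_LIMSEQ[OF s \<rho>(1)] by (auto simp: o_def)
    obtain r' D y' y0' where r': "strict_mono (r' :: nat \<Rightarrow> nat)"
      "(\<lambda>k. (v (xb + t (\<rho> (r' k)) *\<^sub>R s (\<rho> (r' k))) - v xb) / t (\<rho> (r' k))) \<longlonglongrightarrow> D"
      "\<And>k. y' k \<in> sol_map f g (xb + t (\<rho> (r' k)) *\<^sub>R s (\<rho> (r' k)))" "y' \<longlonglongrightarrow> y0'" "y0' \<in> \<Omega>" "y0' \<in> sol_map f g xb"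
      by (rule subsequence_quotient[OF t\<rho>], rule that)
    have tr: "\<And>k. t (\<rho> (r' k)) > 0" "(\<lambda>k. t (\<rho> (r' k))) \<longlonglongrightarrow> 0" "(\<lambda>k. s (\<rho> (r' k))) \<longlonglongrightarrow> u"
      using t LIMSEQ_subseq_LIMSEQ[OF t\<rho>(2) r'(1)] LIMSEQ_subseq_LIMSEQ[OF t\<rho>(3) r'(1)] by (auto simp: o_def)
    have "D \<le> d"
      by (rule quotient_limit_unique[OF rl rd(3,4,6,2) tr r'(2)])
    moreover have "d \<le> D"
      by (rule quotient_limit_unique[OF tr r'(3,4,6,2) rl rd(2)])
    ultimately have "(\<lambda>k. q (\<rho> (r' k))) \<longlonglongrightarrow> d" using r'(2) by (simp add: q_def)
    then have "\<forall>\<^sub>F k in sequentially. dist (q (\<rho> (r' k))) d < e" using e(1) by (rule tendstoD)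
    then show False using \<rho>(2) by simp
  qed
qed

end

section \<open>Frechet derivatives and adjoints in terms of component gradients\<close>

lemma C1_vec_has_derivative:
  fixes g :: "'z::euclidean_space \<Rightarrow> real^'p"
  assumes "\<And>i. C1 (\<lambda>z. g z $ i) (dg i)"
  shows "(g has_derivative (\<lambda>k. \<chi> i. dg i z \<bullet> k)) (at z)"
proof (subst has_derivative_componentwise_within, intro ballI)
  fix b :: "real^'p" assume "b \<in> Basis"
  then obtain i where "b = axis i 1" by (auto simp: Basis_vec_def)
  then show "((\<lambda>z. g z \<bullet> b) has_derivative (\<lambda>k. (\<chi> i. dg i z \<bullet> k) \<bullet> b)) (at z)"
    using C1_has_derivative[OF assms, of i z UNIV] by (simp add: inner_axis)
qed

lemma frechet_derivative_C1_vec: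
  fixes g :: "'z::euclidean_space \<Rightarrow> real^'p"
  assumes "\<And>i. C1 (\<lambda>z. g z $ i) (dg i)"
  shows "frechet_derivative g (at z) = (\<lambda>k. \<chi> i. dg i z \<bullet> k)"
  using frechet_derivative_at[OF C1_vec_has_derivative[where g = g and dg = dg and z = z]] assms by simp

lemma frechet_derivative_C1:
  assumes "C1 f df"
  shows "frechet_derivative f (at z) = (\<lambda>k. df z \<bullet> k)"
  using frechet_derivative_at[OF C1_has_derivative[OF assms, of z UNIV]] by simp

lemma adjoint_vec:
  fixes a :: "'p::finite \<Rightarrow> 'z::euclidean_space"
  shows "adjoint (\<lambda>k. \<chi> i. a i \<bullet> k) \<mu> = (\<Sum>i\<in>UNIV. \<mu> $ i *\<^sub>R a i)"
proof -
  have "adjoint (\<lambda>k. \<chi> i. a i \<bullet> k) = (\<lambda>\<mu>. \<Sum>i\<in>UNIV. \<mu> $ i *\<^sub>R a i)"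
    by (rule adjoint_unique) (simp add: inner_vec_def inner_sum_right inner_commute mult.commute)
  then show ?thesis by simp
qed

lemma C1_section:
  fixes h :: "'a::euclidean_space \<times> 'b::euclidean_space \<Rightarrow> real"
  assumes "C1 h dh" shows "C1 (\<lambda>x'. h (x', y)) (\<lambda>x'. fst (dh (x', y)))"
  unfolding C1_def
proof (intro conjI allI)
  fix x :: 'a
  have "((\<lambda>x'. (x', y)) has_derivative (\<lambda>k. (k, 0))) (at x)"
    by (auto intro!: derivative_eq_intros)
  from has_derivative_compose[OF this C1_has_derivative[OF assms]]
  show "((\<lambda>x'. h (x', y)) has_derivative (\<lambda>k. fst (dh (x, y)) \<bullet> k)) (at x)"
    by (simp add: inner_prod_def)
  have "continuous_on UNIV dh" using assms by (simp add: C1_def)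
  then have "continuous_on UNIV (\<lambda>x'. dh (x', y))"
    by (rule continuous_on_compose2[where f = "\<lambda>x'. (x', y)"]) (simp_all add: continuous_on_Pair)
  then show "continuous_on UNIV (\<lambda>x'. fst (dh (x', y)))" by (rule continuous_on_fst)
qed

section \<open>Dual formula for the directional derivative, and limits of Lagrangian
  gradients\<close>

context lower_level_penalty
begin

text \<open>A derivative in the sense of Hadamard: the directions \<open>s\<close> vary too, as they
  do for directional solutions and limiting subgradients.\<close>

definition d :: real where
  "d = (SOME d. \<forall>t s. (\<forall>k. t k > 0) \<longrightarrow> t \<longlonglongrightarrow> 0 \<longrightarrow> s \<longlonglongrightarrow> u \<longrightarrow>
     (\<lambda>k. (v (xb + t k *\<^sub>R s k) - v xb) / t k) \<longlonglongrightarrow> d)"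

lemma d_lim:
  assumes "\<And>k. t k > 0" "t \<longlonglongrightarrow> 0" "s \<longlonglongrightarrow> u"
  shows "(\<lambda>k. (v (xb + t k *\<^sub>R s k) - v xb) / t k) \<longlonglongrightarrow> d"
proof -
  have "\<exists>d. \<forall>t s. (\<forall>k. t k > 0) \<longrightarrow> t \<longlonglongrightarrow> 0 \<longrightarrow> s \<longlonglongrightarrow> u \<longrightarrow>
     (\<lambda>k. (v (xb + t k *\<^sub>R s k) - v xb) / t k) \<longlonglongrightarrow> d"
  proof (rule quotient_limit)
    fix d assume d: "\<And>t s. (\<And>k. t k > 0) \<Longrightarrow> t \<longlonglongrightarrow> 0 \<Longrightarrow> s \<longlonglongrightarrow> u \<Longrightarrow>
      (\<lambda>k. (v (xb + t k *\<^sub>R s k) - v xb) / t k) \<longlonglongrightarrow> d"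
    show ?thesis by (intro exI[of _ d] allI impI, rule d) auto
  qed
  from someI_ex[OF this] have "\<forall>t s. (\<forall>k. t k > 0) \<longrightarrow> t \<longlonglongrightarrow> 0 \<longrightarrow> s \<longlonglongrightarrow> u \<longrightarrow>
     (\<lambda>k. (v (xb + t k *\<^sub>R s k) - v xb) / t k) \<longlonglongrightarrow> d" unfolding d_def .
  with assms show ?thesis by simp
qed

lemma sector_N:
  obtains \<eta> where "\<eta> > 0" "\<And>t w. 0 \<le> t \<Longrightarrow> t < \<eta> \<Longrightarrow> norm (w - u) < \<eta> \<Longrightarrow> xb + t *\<^sub>R w \<in> N"
proof (rule dir_nhd_sector[OF \<epsilon> \<delta>, of u])
  fix \<eta> assume "\<eta> > 0" "\<And>t w. 0 \<le> t \<Longrightarrow> t < \<eta> \<Longrightarrow> norm (w - u) < \<eta> \<Longrightarrow> t *\<^sub>R w \<in> dir_nhd \<epsilon> \<delta> u"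
  then show ?thesis by (intro that[of \<eta>]) (auto simp: N_def)
qed

lemma has_dir_deriv_d: "has_dir_deriv (val_fun f g) (ereal d) xb u"
proof -
  obtain \<eta> where \<eta>: "\<eta> > 0" "\<And>t w. 0 \<le> t \<Longrightarrow> t < \<eta> \<Longrightarrow> norm (w - u) < \<eta> \<Longrightarrow> xb + t *\<^sub>R w \<in> N"
    using sector_N by blast
  have "((\<lambda>t. (v (xb + t *\<^sub>R u) - v xb) / t) \<longlongrightarrow> d) (at_right 0)"
    unfolding tendsto_at_iff_sequentially
  proof (intro allI impI)
    fix X :: "nat \<Rightarrow> real" assume "\<forall>i. X i \<in> {0<..} - {0}" "X \<longlonglongrightarrow> 0"
    then have "(\<lambda>k. (v (xb + X k *\<^sub>R u) - v xb) / X k) \<longlonglongrightarrow> d"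
      using d_lim[of X "\<lambda>_. u"] by auto
    then show "((\<lambda>t. (v (xb + t *\<^sub>R u) - v xb) / t) \<circ> X) \<longlonglongrightarrow> d" by (simp add: o_def)
  qed
  then have lim: "((\<lambda>t. ereal ((v (xb + t *\<^sub>R u) - v xb) / t)) \<longlongrightarrow> ereal d) (at_right 0)" by simp
  have "\<forall>\<^sub>F t in at_right 0. t \<in> {0<..<\<eta>}" using \<eta>(1) by (rule eventually_at_right_real)
  then have "\<forall>\<^sub>F t in at_right 0. ereal ((v (xb + t *\<^sub>R u) - v xb) / t)
      = (val_fun f g (xb + t *\<^sub>R u) - val_fun f g xb) / ereal t"
  proof eventually_elim
    case (elim t)
    then have "xb + t *\<^sub>R u \<in> N" using \<eta> by simp
    then show ?case using elim by (simp add: val_N xb_N)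
  qed
  from tendsto_cong[OF this] lim show ?thesis by (simp add: has_dir_deriv_def)
qed

lemma dir_deriv_d: "dir_deriv (val_fun f g) xb u = ereal d"
  unfolding dir_deriv_def
proof (rule the_equality, rule has_dir_deriv_d)
  fix D assume "has_dir_deriv (val_fun f g) D xb u"
  then show "D = ereal d" using has_dir_deriv_d unfolding has_dir_deriv_def
    by (intro tendsto_unique[OF trivial_limit_at_right_real])
qed

lemma dir_lipschitz_val: "dir_lipschitz (val_fun f g) xb u"
proof -
  obtain L where L: "L > 0" "\<And>a b. a \<in> N \<Longrightarrow> b \<in> N \<Longrightarrow> \<bar>v a - v b\<bar> \<le> L * norm (a - b)"
    using v_lipschitz by metis
  have "\<forall>a\<in>N. \<bar>val_fun f g a\<bar> \<noteq> \<infinity> \<and> (\<forall>b\<in>N. \<bar>val_fun f g a - val_fun f g b\<bar> \<le> ereal (L * norm (a - b)))"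
    using L(2) by (simp add: val_N)
  then show ?thesis unfolding dir_lipschitz_def N_def using L(1) \<epsilon> \<delta> by blast
qed

lemma d_upper:
  assumes y0: "y0 \<in> sol_map f g xb"
  obtains c where "c \<ge> 0"
    "\<And>w. d \<le> df (xb, y0) \<bullet> (u, w) + c * (\<Sum>i\<in>{i. g (xb, y0) $ i = 0}. max 0 (dg i (xb, y0) \<bullet> (u, w)))"
proof (rule quotient_upper_bound[OF y0])
  fix c assume c: "c \<ge> 0" and *: "\<And>t s D w. (\<And>k. t k > 0) \<Longrightarrow> t \<longlonglongrightarrow> 0 \<Longrightarrow> s \<longlonglongrightarrow> u \<Longrightarrow>
    (\<lambda>k. (v (xb + t k *\<^sub>R s k) - v xb) / t k) \<longlonglongrightarrow> D \<Longrightarrow>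
    D \<le> df (xb, y0) \<bullet> (u, w) + c * (\<Sum>i\<in>{i. g (xb, y0) $ i = 0}. max 0 (dg i (xb, y0) \<bullet> (u, w)))"
  have inv: "\<And>k. inverse (real (Suc k)) > 0" "(\<lambda>k. inverse (real (Suc k))) \<longlonglongrightarrow> 0" "(\<lambda>_::nat. u) \<longlonglongrightarrow> u"
    using LIMSEQ_inverse_real_of_nat by auto
  show thesis by (rule that[OF c *[OF inv d_lim[OF inv]]])
qed

text \<open>Stationarity in the second variable makes the terms in \<open>w\<close> cancel, so any
  \<open>w\<close> may be inserted.\<close>

lemma multiplier_linearization:
  assumes "snd (df z) + (\<Sum>i\<in>UNIV. \<mu> $ i *\<^sub>R snd (dg i z)) = 0"
  shows "Lx z \<mu> \<bullet> h = df z \<bullet> (h, w) + (\<Sum>i\<in>UNIV. \<mu> $ i * (dg i z \<bullet> (h, w)))"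
proof -
  have "0 = (snd (df z) + (\<Sum>i\<in>UNIV. \<mu> $ i *\<^sub>R snd (dg i z))) \<bullet> w" using assms by simp
  then show ?thesis
    by (simp add: Lx_def inner_prod_def inner_add_left inner_sum_left distrib_left sum.distrib)
qed

lemma grad_x_lagrangian: "grad_x (lagrangian f g \<mu>) x y = Lx (x, y) \<mu>"
  by (simp add: grad_x_C1[OF C1_lagrangian[OF f g]] Lx_def fst_sum)

text \<open>This is linear programming duality at one solution. The selected direction
  \<open>w\<close> has primal value at most \<open>d\<close> and thus bounds all multipliers by weak
  duality, while the upper estimate provides a multiplier whose value is at least
  \<open>d\<close>.\<close>

lemma dir_sol_maximum:
  assumes "y0 \<in> dir_sol f g xb u"
  shows "is_maximum ((\<lambda>l. grad_x (lagrangian f g l) xb y0 \<bullet> u) ` multipliers f g xb y0) d"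
proof -
  obtain t s y where y0: "y0 \<in> sol_map f g xb" and t: "\<And>k. t k > 0" "t \<longlonglongrightarrow> 0" and s: "s \<longlonglongrightarrow> u"
    and y: "\<And>k. y k \<in> sol_map f g (xb + t k *\<^sub>R s k)" "y \<longlonglongrightarrow> y0"
    using assms unfolding dir_sol_def by blast
  note iff = multipliers_iff[OF f g sol_mapD(1)[OF y0]]
  obtain w where w: "\<And>i. g (xb, y0) $ i = 0 \<Longrightarrow> dg i (xb, y0) \<bullet> (u, w) \<le> 0" "df (xb, y0) \<bullet> (u, w) \<le> d"
    by (rule direction_selection[OF y0 t s y d_lim[OF t s]], rule that)
  have le: "Lx (xb, y0) \<mu> \<bullet> u \<le> d" if "\<mu> \<in> multipliers f g xb y0" for \<mu>
  proof -
    have \<mu>: "\<And>i. 0 \<le> \<mu> $ i" "\<And>i. g (xb, y0) $ i \<noteq> 0 \<Longrightarrow> \<mu> $ i = 0"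
      "snd (df (xb, y0)) + (\<Sum>i\<in>UNIV. \<mu> $ i *\<^sub>R snd (dg i (xb, y0))) = 0"
      using that unfolding iff by auto
    have "\<mu> $ i * (dg i (xb, y0) \<bullet> (u, w)) \<le> 0" for i
      using \<mu>(1,2)[of i] w(1)[of i] by (cases "g (xb, y0) $ i = 0") (auto simp: mult_nonneg_nonpos)
    then have "(\<Sum>i\<in>UNIV. \<mu> $ i * (dg i (xb, y0) \<bullet> (u, w))) \<le> 0" by (intro sum_nonpos) auto
    then show ?thesis using multiplier_linearization[OF \<mu>(3), of u w] w(2) by linarith
  qed
  obtain c where c: "c \<ge> 0"
    "\<And>w. d \<le> df (xb, y0) \<bullet> (u, w) + c * (\<Sum>i\<in>{i. g (xb, y0) $ i = 0}. max 0 (dg i (xb, y0) \<bullet> (u, w)))"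
    by (rule d_upper[OF y0], rule that)
  obtain \<mu> where \<mu>: "kkt c (xb, y0) \<mu>" "d \<le> Lx (xb, y0) \<mu> \<bullet> u"
    using kkt_of_bound[OF c] by blast
  then have "\<mu> \<in> multipliers f g xb y0" unfolding iff kkt_def by blast
  moreover from le[OF this] have "Lx (xb, y0) \<mu> \<bullet> u = d" using \<mu>(2) by simp
  ultimately show ?thesis unfolding is_maximum_def grad_x_lagrangian using le by force
qed

lemma dir_sol_nonempty: "dir_sol f g xb u \<noteq> {}"
proof -
  define t0 where "t0 = (\<lambda>k. inverse (real (Suc k)))"
  define s0 where "s0 = (\<lambda>_::nat. u)"
  have inv: "\<And>k. t0 k > 0" "t0 \<longlonglongrightarrow> 0" "s0 \<longlonglongrightarrow> u"
    using LIMSEQ_inverse_real_of_nat by (auto simp: t0_def s0_def)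
  obtain r D y y0 where rd: "strict_mono (r :: nat \<Rightarrow> nat)"
    "(\<lambda>k. (v (xb + t0 (r k) *\<^sub>R s0 (r k)) - v xb) / t0 (r k)) \<longlonglongrightarrow> D"
    "\<And>k. y k \<in> sol_map f g (xb + t0 (r k) *\<^sub>R s0 (r k))" "y \<longlonglongrightarrow> y0" "y0 \<in> \<Omega>" "y0 \<in> sol_map f g xb"
    by (rule subsequence_quotient[OF inv], rule that)
  have "\<forall>k. t0 (r k) > 0" "(\<lambda>k. t0 (r k)) \<longlonglongrightarrow> 0" "(\<lambda>k. s0 (r k)) \<longlonglongrightarrow> u"
    using inv(1) LIMSEQ_subseq_LIMSEQ[OF inv(2) rd(1)] LIMSEQ_subseq_LIMSEQ[OF inv(3) rd(1)] by (auto simp: o_def)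
  then have "y0 \<in> dir_sol f g xb u" unfolding dir_sol_def
    using rd(3,4,6) by (intro CollectI conjI exI[of _ "\<lambda>k. t0 (r k)"] exI[of _ "\<lambda>k. s0 (r k)"] exI[of _ y]) auto
  then show ?thesis by blast
qed

text \<open>Bounded multipliers and compactness of \<open>\<Omega>\<close> give a convergent
  subsequence. A multiplier positive in the limit is positive along a tail, so its constraint is
  active there and the selected \<open>w\<close> is tangent to it; this is the orthogonality that
  \<open>Theta\<close> requires.\<close>

lemma W_limit:
  assumes t: "\<And>k. t k > 0" "t \<longlonglongrightarrow> 0" and s: "s \<longlonglongrightarrow> u" and \<xi>: "\<And>k. \<xi> k \<in> W (xb + t k *\<^sub>R s k)"
  obtains r \<xi>0 where "strict_mono (r :: nat \<Rightarrow> nat)" "(\<lambda>k. \<xi> (r k)) \<longlonglongrightarrow> \<xi>0" "\<xi>0 \<in> Theta f g \<Omega> xb u"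
proof -
  let ?X = "\<lambda>k. xb + t k *\<^sub>R s k"
  have "\<forall>k. \<exists>y \<mu>. y \<in> sol_map f g (?X k) \<and> y \<in> \<Omega> \<and> kkt C (?X k, y) \<mu> \<and> \<xi> k = Lx (?X k, y) \<mu>"
    using \<xi> unfolding W_def by blast
  then obtain y \<mu> where y: "\<And>k. y k \<in> sol_map f g (?X k)" "\<And>k. y k \<in> \<Omega>"
    and \<mu>: "\<And>k. kkt C (?X k, y k) (\<mu> k)" and \<xi>eq: "\<And>k. \<xi> k = Lx (?X k, y k) (\<mu> k)" by metis
  have inK: "(y k, \<mu> k) \<in> \<Omega> \<times> cbox ((\<chi> i. 0)::real^'p) (\<chi> i. C)" for k
    using y(2)[of k] \<mu>[of k] by (auto simp: kkt_def mem_box_cart)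
  have cK: "compact (\<Omega> \<times> cbox ((\<chi> i. 0)::real^'p) (\<chi> i. C))"
    by (intro compact_Times compact_\<Omega> compact_cbox)
  obtain l r1 where l: "l \<in> \<Omega> \<times> cbox ((\<chi> i. 0)::real^'p) (\<chi> i. C)" and r1: "strict_mono (r1 :: nat \<Rightarrow> nat)"
    and "((\<lambda>k. (y k, \<mu> k)) \<circ> r1) \<longlonglongrightarrow> l"
    by (rule seq_compactE[OF compact_imp_seq_compact[OF cK], of "\<lambda>k. (y k, \<mu> k)"], use inK in blast, rule that)
  then have lim0: "(\<lambda>k. (y (r1 k), \<mu> (r1 k))) \<longlonglongrightarrow> l" by (simp add: o_def)
  define y0 where "y0 = fst l"
  define \<mu>0 where "\<mu>0 = snd l"
  have y0: "y0 \<in> \<Omega>" and \<mu>0: "\<And>i. 0 \<le> \<mu>0 $ i \<and> \<mu>0 $ i \<le> C"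
    using l by (auto simp: y0_def \<mu>0_def mem_box_cart)
  have ylim: "(\<lambda>k. y (r1 k)) \<longlonglongrightarrow> y0" and \<mu>lim: "(\<lambda>k. \<mu> (r1 k)) \<longlonglongrightarrow> \<mu>0"
    using tendsto_fst[OF lim0] tendsto_snd[OF lim0] by (simp_all add: y0_def \<mu>0_def)
  \<comment> \<open>Positivity is arranged for every index after a shift, because
    \<open>direction_selection\<close> needs activity along the entire sequence.\<close>
  have "\<forall>\<^sub>F k in sequentially. \<forall>i\<in>{i. \<mu>0 $ i > 0}. \<mu> (r1 k) $ i > 0"
    by (intro eventually_ball_finite finite ballI order_tendstoD(1)[OF tendsto_vec_nth[OF \<mu>lim]]) auto
  then obtain k0 where k0: "\<And>k i. k \<ge> k0 \<Longrightarrow> \<mu>0 $ i > 0 \<Longrightarrow> \<mu> (r1 k) $ i > 0"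
    unfolding eventually_sequentially by blast
  define r where "r = (\<lambda>k. r1 (k + k0))"
  have r: "strict_mono r" using r1 by (simp add: r_def strict_mono_def)
  have sub1: "(\<lambda>k. Y (r k)) \<longlonglongrightarrow> a" if "(\<lambda>k. Y (r1 k)) \<longlonglongrightarrow> a" for Y :: "nat \<Rightarrow> 'z::topological_space" and a
    using LIMSEQ_ignore_initial_segment[OF that, of k0] by (simp add: r_def)
  have sub: "(\<lambda>k. Y (r k)) \<longlonglongrightarrow> a" if "Y \<longlonglongrightarrow> a" for Y :: "nat \<Rightarrow> 'z::topological_space" and a
    using LIMSEQ_subseq_LIMSEQ[OF that r] by (simp add: o_def)
  have tr: "\<And>k. t (r k) > 0" "(\<lambda>k. t (r k)) \<longlonglongrightarrow> 0" "(\<lambda>k. s (r k)) \<longlonglongrightarrow> u" using t sub[OF t(2)] sub[OF s] by auto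
  have ap: "approaches (\<lambda>k. ?X (r k)) xb u" using tr by (intro approaches_sector) (auto intro: less_imp_le)
  have yr: "(\<lambda>k. y (r k)) \<longlonglongrightarrow> y0" by (rule sub1[OF ylim])
  have S0: "y0 \<in> sol_map f g xb" by (rule sol_limit[OF ap _ yr]) (rule y(1))
  have dir: "y0 \<in> dir_sol f g xb u" unfolding dir_sol_def
    using S0 tr yr y(1) by (intro CollectI conjI exI[of _ "\<lambda>k. t (r k)"] exI[of _ "\<lambda>k. s (r k)"] exI[of _ "\<lambda>k. y (r k)"]) auto
  have zlim: "(\<lambda>k. (?X (r k), y (r k))) \<longlonglongrightarrow> (xb, y0)"
    by (intro tendsto_Pair approaches_tendsto[OF ap] yr)
  have \<mu>r: "(\<lambda>k. \<mu> (r k) $ i) \<longlonglongrightarrow> \<mu>0 $ i" for i by (rule tendsto_vec_nth[OF sub1[OF \<mu>lim]])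
  have gzero: "g (?X (r k), y (r k)) $ i = 0" if "\<mu>0 $ i > 0" for i k
    using k0[of "k + k0" i] that \<mu>[of "r k"] by (auto simp: kkt_def r_def)
  obtain w where w: "\<And>i. g (xb, y0) $ i = 0 \<Longrightarrow> dg i (xb, y0) \<bullet> (u, w) \<le> 0" "df (xb, y0) \<bullet> (u, w) \<le> d"
    "\<And>i. \<forall>k. g (?X (r k), y (r k)) $ i = 0 \<Longrightarrow> dg i (xb, y0) \<bullet> (u, w) = 0"
    by (rule direction_selection[OF S0 tr y(1) yr d_lim[OF tr]], rule that)
  have orth: "\<mu>0 $ i * (dg i (xb, y0) \<bullet> (u, w)) = 0" for i
    using w(3)[of i] gzero[of i] \<mu>0[of i] by (cases "\<mu>0 $ i = 0") auto
  have comp: "\<mu>0 $ i = 0" if "g (xb, y0) $ i \<noteq> 0" for i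
  proof (rule ccontr)
    assume "\<mu>0 $ i \<noteq> 0"
    then have "\<mu>0 $ i > 0" using \<mu>0[of i] by simp
    from gzero[OF this] have "(\<lambda>k. 0) \<longlonglongrightarrow> g (xb, y0) $ i" using C1_tendsto[OF g zlim, of i] by simp
    then show False using that by (simp add: LIMSEQ_const_iff)
  qed
  have "(\<lambda>k. snd (df (?X (r k), y (r k))) + (\<Sum>i\<in>UNIV. \<mu> (r k) $ i *\<^sub>R snd (dg i (?X (r k), y (r k)))))
      \<longlonglongrightarrow> snd (df (xb, y0)) + (\<Sum>i\<in>UNIV. \<mu>0 $ i *\<^sub>R snd (dg i (xb, y0)))"
    by (intro tendsto_add tendsto_sum tendsto_scaleR tendsto_snd C1_grad_tendsto[OF f zlim] C1_grad_tendsto[OF g zlim] \<mu>r)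
  then have stat: "snd (df (xb, y0)) + (\<Sum>i\<in>UNIV. \<mu>0 $ i *\<^sub>R snd (dg i (xb, y0))) = 0"
    using \<mu> by (simp add: kkt_def LIMSEQ_const_iff)
  have lim: "(\<lambda>k. \<xi> (r k)) \<longlonglongrightarrow> Lx (xb, y0) \<mu>0" unfolding \<xi>eq Lx_def
    by (intro tendsto_add tendsto_sum tendsto_scaleR tendsto_fst C1_grad_tendsto[OF f zlim] C1_grad_tendsto[OF g zlim] \<mu>r)
  \<comment> \<open>For this \<open>w\<close> the penalty term of the upper estimate is zero, so
    \<open>w\<close> attains the derivative and belongs to \<open>Sigma_dir\<close>.\<close>
  have "d \<le> df (xb, y0) \<bullet> (u, w)"
  proof (rule d_upper[OF S0])
    fix c assume "\<And>w. d \<le> df (xb, y0) \<bullet> (u, w) + c * (\<Sum>i\<in>{i. g (xb, y0) $ i = 0}. max 0 (dg i (xb, y0) \<bullet> (u, w)))"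
    moreover have "(\<Sum>i\<in>{i. g (xb, y0) $ i = 0}. max 0 (dg i (xb, y0) \<bullet> (u, w))) = 0"
      by (rule sum.neutral) (use w(1) in \<open>auto simp: max_def intro: antisym\<close>)
    ultimately show ?thesis by (metis add.right_neutral mult_zero_right)
  qed
  then have deq: "d = df (xb, y0) \<bullet> (u, w)" using w(2) by simp
  have "w \<in> Sigma_dir f g xb y0 u"
    unfolding Sigma_dir_def lin_cone_def dir_deriv_d frechet_derivative_C1[OF f] frechet_derivative_C1_vec[OF g]
    using w(1) deq by (simp add: active_def)
  moreover have "\<mu>0 \<in> multipliers f g xb y0 \<inter> {frechet_derivative g (at (xb, y0)) (u, w)}\<^sup>\<bottom>"
    unfolding multipliers_iff[OF f g sol_mapD(1)[OF S0]] Int_iff frechet_derivative_C1_vec[OF g] orthogonal_comp_def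
    using \<mu>0 comp stat by (simp add: orthogonal_def inner_vec_def mult.commute sum.neutral orth del: mult_eq_0_iff)
  moreover have "Lx (xb, y0) \<mu>0 = grad_x f xb y0 + adjoint (frechet_derivative (\<lambda>x'. g (x', y0)) (at xb)) \<mu>0"
    by (simp add: frechet_derivative_C1_vec[OF C1_section[OF g]] adjoint_vec Lx_def grad_x_C1[OF f])
  ultimately have "Lx (xb, y0) \<mu>0 \<in> Theta f g \<Omega> xb u"
    unfolding Theta_def using dir y0 by blast
  then show ?thesis by (rule that[OF r lim])
qed

lemma limiting_subdiff_subset: "dir_limiting_subdiff (val_fun f g) xb u \<subseteq> Theta f g \<Omega> xb u"
proof
  fix \<xi> assume "\<xi> \<in> dir_limiting_subdiff (val_fun f g) xb u"
  then obtain t s \<xi>s where t: "\<And>k. t k > 0" "t \<longlonglongrightarrow> 0" and s: "s \<longlonglongrightarrow> u" and \<xi>s: "\<xi>s \<longlonglongrightarrow> \<xi>"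
    "\<And>k. \<xi>s k \<in> regular_subdiff (val_fun f g) (xb + t k *\<^sub>R s k)"
    unfolding dir_limiting_subdiff_def by blast
  obtain \<eta> where \<eta>: "\<eta> > 0" "\<And>t w. 0 \<le> t \<Longrightarrow> t < \<eta> \<Longrightarrow> norm (w - u) < \<eta> \<Longrightarrow> xb + t *\<^sub>R w \<in> N"
    using sector_N by blast
  have "\<forall>\<^sub>F k in sequentially. \<xi>s k \<in> W (xb + t k *\<^sub>R s k)"
    using order_tendstoD(2)[OF t(2) \<eta>(1)] tendstoD[OF s \<eta>(1)]
  proof eventually_elim
    case (elim k)
    \<comment> \<open>The slack left in the sector, scaled back by \<open>t k\<close>: within this
      radius the direction still differs from \<open>u\<close> by less than
      \<open>\<eta>\<close>.\<close>
    define e where "e = t k * (\<eta> - norm (s k - u))"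
    have e: "e > 0" using elim t(1)[of k] by (simp add: e_def dist_norm)
    have "ball (xb + t k *\<^sub>R s k) e \<subseteq> N"
    proof
      fix x assume "x \<in> ball (xb + t k *\<^sub>R s k) e"
      then have x: "norm (x - (xb + t k *\<^sub>R s k)) < e" by (simp add: dist_norm norm_minus_commute)
      let ?w = "(x - xb) /\<^sub>R t k"
      have E: "?w - u = (x - (xb + t k *\<^sub>R s k)) /\<^sub>R t k + (s k - u)"
        using t(1)[of k] by (simp add: algebra_simps)
      have "norm (?w - u) \<le> norm (x - (xb + t k *\<^sub>R s k)) / t k + norm (s k - u)"
        unfolding E by (rule order_trans[OF norm_triangle_ineq]) (use t(1)[of k] in \<open>simp add: divide_inverse mult.commute\<close>)
      also have "\<dots> < e / t k + norm (s k - u)" using x t(1)[of k] by (simp add: divide_strict_right_mono)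
      also have "\<dots> = \<eta>" using t(1)[of k] by (simp add: e_def)
      finally have "xb + t k *\<^sub>R ?w \<in> N" by (intro \<eta>(2)) (use t(1)[of k] elim(1) in auto)
      then show "x \<in> N" using t(1)[of k] by simp
    qed
    from regular_subdiff_subset_W[OF e this] show ?case using \<xi>s(2) by blast
  qed
  then obtain k0 where k0: "\<And>k. k \<ge> k0 \<Longrightarrow> \<xi>s k \<in> W (xb + t k *\<^sub>R s k)"
    unfolding eventually_sequentially by blast
  have sh: "\<And>k. t (k + k0) > 0" "(\<lambda>k. t (k + k0)) \<longlonglongrightarrow> 0" "(\<lambda>k. s (k + k0)) \<longlonglongrightarrow> u" "(\<lambda>k. \<xi>s (k + k0)) \<longlonglongrightarrow> \<xi>"
    using t s \<xi>s(1) by (auto intro: LIMSEQ_ignore_initial_segment)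
  have W: "\<And>k. \<xi>s (k + k0) \<in> W (xb + t (k + k0) *\<^sub>R s (k + k0))" using k0 by simp
  obtain r \<xi>0 where r: "strict_mono (r :: nat \<Rightarrow> nat)" "(\<lambda>k. \<xi>s (r k + k0)) \<longlonglongrightarrow> \<xi>0" "\<xi>0 \<in> Theta f g \<Omega> xb u"
    by (rule W_limit[where t = "\<lambda>k. t (k + k0)" and s = "\<lambda>k. s (k + k0)" and \<xi> = "\<lambda>k. \<xi>s (k + k0)", OF sh(1-3) W], rule that)
  have "(\<lambda>k. \<xi>s (r k + k0)) \<longlonglongrightarrow> \<xi>"
    using LIMSEQ_subseq_LIMSEQ[OF sh(4) r(1)] by (simp add: o_def)
  then have "\<xi> = \<xi>0" using r(2) LIMSEQ_unique by blast
  then show "\<xi> \<in> Theta f g \<Omega> xb u" using r(3) by simp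
qed

end

section \<open>Multipliers for the bilevel program\<close>

text \<open>The squared positive part is differentiable with derivative \<open>2 * max 0 a\<close>,
  and its first order error is at most the squared increment.\<close>

lemma max0_square_diff:
  fixes a b :: real
  shows "(max 0 b)\<^sup>2 - (max 0 a)\<^sup>2 \<le> 2 * max 0 a * (b - a) + (b - a)\<^sup>2"
proof (cases "a \<le> 0")
  case True
  then have "(max 0 b)\<^sup>2 \<le> (b - a)\<^sup>2"
    by (cases "b \<le> 0") (auto intro!: power_mono)
  then show ?thesis using True by simp
next
  case False
  then show ?thesis by (cases "b \<le> 0") (auto simp: power2_eq_square algebra_simps)
qed

section \<open>Compactness of the limiting gradients, and separation\<close>

context lower_level_penalty
begin

text \<open>Multipliers in \<open>Theta\<close> may be unbounded, whereas these limits come from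
  multipliers bounded by \<open>C\<close>; the set is therefore a compact part of
  \<open>Theta\<close> to which separation applies.\<close>

definition W_limits :: "'a set" where
  "W_limits = {\<xi>. \<exists>t s \<xi>s. (\<forall>k. t k > 0) \<and> t \<longlonglongrightarrow> 0 \<and> s \<longlonglongrightarrow> u \<and> (\<forall>k. \<xi>s k \<in> W (xb + t k *\<^sub>R s k)) \<and> \<xi>s \<longlonglongrightarrow> \<xi>}"

lemma W_limits_subsequence:
  assumes t: "\<And>k. t k > 0" "t \<longlonglongrightarrow> 0" and s: "s \<longlonglongrightarrow> u" and \<xi>: "\<And>k. \<xi> k \<in> W (xb + t k *\<^sub>R s k)"
  obtains r \<xi>0 where "strict_mono (r :: nat \<Rightarrow> nat)" "(\<lambda>k. \<xi> (r k)) \<longlonglongrightarrow> \<xi>0" "\<xi>0 \<in> W_limits"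
proof (rule W_limit[OF t s \<xi>])
  fix r :: "nat \<Rightarrow> nat" and \<xi>0 assume r: "strict_mono r" and lim: "(\<lambda>k. \<xi> (r k)) \<longlonglongrightarrow> \<xi>0"
  have "\<forall>k. t (r k) > 0" "(\<lambda>k. t (r k)) \<longlonglongrightarrow> 0" "(\<lambda>k. s (r k)) \<longlonglongrightarrow> u" "\<forall>k. \<xi> (r k) \<in> W (xb + t (r k) *\<^sub>R s (r k))"
    using t(1) \<xi> LIMSEQ_subseq_LIMSEQ[OF t(2) r] LIMSEQ_subseq_LIMSEQ[OF s r] by (auto simp: o_def)
  then have "\<xi>0 \<in> W_limits" unfolding W_limits_def using lim
    by (intro CollectI exI[of _ "\<lambda>k. t (r k)"] exI[of _ "\<lambda>k. s (r k)"] exI[of _ "\<lambda>k. \<xi> (r k)"] conjI)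
  then show thesis by (rule that[OF r lim])
qed

lemma W_limits_subset: "W_limits \<subseteq> Theta f g \<Omega> xb u"
proof
  fix \<xi> assume "\<xi> \<in> W_limits"
  then obtain t s \<xi>s where t: "\<And>k. t k > 0" "t \<longlonglongrightarrow> 0" and s: "s \<longlonglongrightarrow> u"
    and \<xi>s: "\<And>k. \<xi>s k \<in> W (xb + t k *\<^sub>R s k)" and lim: "\<xi>s \<longlonglongrightarrow> \<xi>"
    unfolding W_limits_def by blast
  obtain r \<xi>0 where r: "strict_mono (r :: nat \<Rightarrow> nat)" "(\<lambda>k. \<xi>s (r k)) \<longlonglongrightarrow> \<xi>0" "\<xi>0 \<in> Theta f g \<Omega> xb u"
    by (rule W_limit[OF t s \<xi>s], rule that)
  have "(\<lambda>k. \<xi>s (r k)) \<longlonglongrightarrow> \<xi>" using LIMSEQ_subseq_LIMSEQ[OF lim r(1)] by (simp add: o_def)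
  then have "\<xi> = \<xi>0" using r(2) LIMSEQ_unique by blast
  then show "\<xi> \<in> Theta f g \<Omega> xb u" using r(3) by simp
qed

lemma null_bound:
  fixes X :: "nat \<Rightarrow> 'z::real_normed_vector"
  assumes "\<And>n. norm (X n - Y n) \<le> 1 / real (Suc n)" "Y \<longlonglongrightarrow> l"
  shows "X \<longlonglongrightarrow> l"
proof -
  have "(\<lambda>n. X n - Y n) \<longlonglongrightarrow> 0"
  proof (rule Lim_null_comparison)
    show "\<forall>\<^sub>F n in sequentially. norm (X n - Y n) \<le> 1 / real (Suc n)" using assms(1) by simp
    show "(\<lambda>n. 1 / real (Suc n)) \<longlonglongrightarrow> 0" using LIMSEQ_inverse_real_of_nat by (simp add: divide_inverse)
  qed
  from tendsto_add[OF this assms(2)] show ?thesis by simp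
qed

text \<open>Each limit is replaced by an approximating element of \<open>W\<close> at distance, step
  size and angular error at most \<open>1 / Suc n\<close>; the diagonal sequence thus obtained again
  approaches in direction \<open>u\<close>.\<close>

lemma compact_W_limits: "compact W_limits"
  unfolding compact_def
proof (intro allI impI)
  fix \<xi> :: "nat \<Rightarrow> 'a" assume \<xi>: "\<forall>n. \<xi> n \<in> W_limits"
  have "\<exists>t s \<xi>'. 0 < t \<and> t \<le> 1 / real (Suc n) \<and> norm (s - u) \<le> 1 / real (Suc n) \<and> norm (\<xi> n - \<xi>') \<le> 1 / real (Suc n)
      \<and> \<xi>' \<in> W (xb + t *\<^sub>R s)" for n
  proof -
    obtain t s \<xi>s where t: "\<And>k. t k > 0" "t \<longlonglongrightarrow> 0" and s: "s \<longlonglongrightarrow> u"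
      and \<xi>s: "\<And>k. \<xi>s k \<in> W (xb + t k *\<^sub>R s k)" and lim: "\<xi>s \<longlonglongrightarrow> \<xi> n"
      using \<xi>[THEN spec, of n] unfolding W_limits_def by blast
    have e: "1 / real (Suc n) > 0" by simp
    have "\<forall>\<^sub>F k in sequentially. t k < 1 / real (Suc n) \<and> dist (s k) u < 1 / real (Suc n) \<and> dist (\<xi>s k) (\<xi> n) < 1 / real (Suc n)"
      by (intro eventually_conj order_tendstoD(2)[OF t(2) e] tendstoD[OF s e] tendstoD[OF lim e])
    then obtain k where "t k < 1 / real (Suc n) \<and> dist (s k) u < 1 / real (Suc n) \<and> dist (\<xi>s k) (\<xi> n) < 1 / real (Suc n)"
      unfolding eventually_sequentially by blast
    then show ?thesis using t(1)[of k] \<xi>s[of k]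
      by (intro exI[of _ "t k"] exI[of _ "s k"] exI[of _ "\<xi>s k"]) (auto simp: dist_norm norm_minus_commute intro: less_imp_le)
  qed
  then obtain t s \<xi>' where t: "\<And>n. 0 < t n" "\<And>n. t n \<le> 1 / real (Suc n)" and s: "\<And>n. norm (s n - u) \<le> 1 / real (Suc n)"
    and \<xi>': "\<And>n. norm (\<xi> n - \<xi>' n) \<le> 1 / real (Suc n)" "\<And>n. \<xi>' n \<in> W (xb + t n *\<^sub>R s n)" by metis
  have tl: "t \<longlonglongrightarrow> 0" by (rule null_bound[where Y = "\<lambda>_. 0"]) (use t in \<open>auto simp: less_imp_le\<close>)
  have sl: "s \<longlonglongrightarrow> u" by (rule null_bound[where Y = "\<lambda>_. u"]) (use s in auto)
  obtain r \<xi>0 where r: "strict_mono (r :: nat \<Rightarrow> nat)" "(\<lambda>k. \<xi>' (r k)) \<longlonglongrightarrow> \<xi>0" "\<xi>0 \<in> W_limits"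
    by (rule W_limits_subsequence[OF t(1) tl sl \<xi>'(2)], rule that)
  have "(\<lambda>k. \<xi> (r k)) \<longlonglongrightarrow> \<xi>0"
  proof (rule null_bound[OF _ r(2)])
    fix n
    have "norm (\<xi> (r n) - \<xi>' (r n)) \<le> 1 / real (Suc (r n))" by (rule \<xi>')
    also have "\<dots> \<le> 1 / real (Suc n)" using seq_suble[OF r(1), of n] by (intro frac_le) auto
    finally show "norm (\<xi> (r n) - \<xi>' (r n)) \<le> 1 / real (Suc n)" .
  qed
  then show "\<exists>l\<in>W_limits. \<exists>r. strict_mono r \<and> (\<xi> \<circ> r) \<longlonglongrightarrow> l" using r by (auto simp: o_def)
qed

text \<open>The limiting inequality offers a different gradient for each direction \<open>k\<close>.
  Separating 0 from a compact convex image exchanges the quantifiers, at the price of passing to the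
  convex hull.\<close>

lemma W_limits_multiplier:
  assumes "\<And>k. \<exists>\<xi>\<in>W_limits. 0 \<le> a \<bullet> k - \<nu> * (\<xi> \<bullet> fst k)"
  obtains \<xi> where "\<xi> \<in> convex hull W_limits" "a - \<nu> *\<^sub>R (\<xi>, 0) = (0 :: 'a \<times> 'b)"
proof -
  let ?m = "\<lambda>\<xi>::'a. a - \<nu> *\<^sub>R (\<xi>, 0 :: 'b)"
  let ?Z = "?m ` (convex hull W_limits)"
  have "compact ?Z"
    by (intro compact_continuous_image compact_convex_hull compact_W_limits continuous_intros)
  moreover have "convex ?Z"
  proof -
    have "linear (\<lambda>\<xi>::'a. - (\<nu> *\<^sub>R (\<xi>, 0 :: 'b)))" by (simp add: linear_iff algebra_simps)
    from convex_translation[OF convex_linear_image[OF this convex_convex_hull], of a W_limits]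
    show ?thesis by (simp only: image_image add_uminus_conv_diff)
  qed
  moreover have "0 \<in> ?Z"
  proof (rule ccontr)
    assume "0 \<notin> ?Z"
    then obtain k b where k: "0 < b" "\<And>z. z \<in> ?Z \<Longrightarrow> k \<bullet> z > b"
      using separating_hyperplane_closed_0[OF \<open>convex ?Z\<close> compact_imp_closed[OF \<open>compact ?Z\<close>]] by metis
    obtain \<xi> where \<xi>: "\<xi> \<in> W_limits" "0 \<le> a \<bullet> (- k) - \<nu> * (\<xi> \<bullet> fst (- k))" using assms[of "- k"] by blast
    have "?m \<xi> \<in> ?Z" using \<xi>(1) by (intro imageI hull_inc)
    from k(2)[OF this] have "k \<bullet> a - \<nu> * (fst k \<bullet> \<xi>) > b" by (simp add: inner_diff_right inner_prod_def)
    then show False using \<xi>(2) k(1) by (simp add: inner_commute)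
  qed
  ultimately show ?thesis using that by (metis (no_types, lifting) imageE)
qed

end

text \<open>The constraints of both levels are merged into one family \<open>h\<close>, since they
  receive the same treatment; only the value function constraint \<open>f z \<le> v (fst z)\<close>
  is separate, being nonsmooth.\<close>

locale bilevel = lower_level_penalty f df g dg xb u yb \<Omega> C \<epsilon> N \<delta>
  for f :: "'a::euclidean_space \<times> 'b::euclidean_space \<Rightarrow> real" and df
    and g :: "'a \<times> 'b \<Rightarrow> real^'p" and dg xb u yb \<Omega> C \<epsilon> N \<delta> +
  fixes F :: "'a \<times> 'b \<Rightarrow> real" and dF
    and h :: "'c::finite \<Rightarrow> 'a \<times> 'b \<Rightarrow> real" and dh and vd :: 'b and e0 :: real
  assumes F: "C1 F dF" and h: "\<And>c. C1 (h c) (dh c)" and h0: "\<And>c. h c (xb, yb) \<le> 0" and e0: "e0 > 0"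
    and min: "\<And>z. fst z \<in> N \<Longrightarrow> dist z (xb, yb) < e0 \<Longrightarrow> f z \<le> v (fst z) \<Longrightarrow> (\<And>c. h c z \<le> 0) \<Longrightarrow> F (xb, yb) \<le> F z"
    and crit: "dF (xb, yb) \<bullet> (u, vd) \<le> 0" "df (xb, yb) \<bullet> (u, vd) \<le> d"
      "\<And>c. h c (xb, yb) = 0 \<Longrightarrow> dh c (xb, yb) \<bullet> (u, vd) \<le> 0"
begin

definition \<phi> :: "'a \<times> 'b \<Rightarrow> real" where
  "\<phi> z = f z - v (fst z)"

definition Q :: "'a \<times> 'b \<Rightarrow> real" where
  "Q z = (max 0 (\<phi> z))\<^sup>2 + (\<Sum>c\<in>UNIV. (max 0 (h c z))\<^sup>2)"

text \<open>
  The squared residual is differentiable up to the value function, whose increments along \<open>k\<close> are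
  controlled by \<open>W\<close> through the mean value theorem.
\<close>

lemma stationarity_step:
  assumes int: "r > 0" "ball (fst z') r \<subseteq> N" and \<kappa>: "\<kappa> \<ge> 0" and \<rho>: "\<rho> \<ge> 0" and e: "e \<ge> 0"
    and loc: "\<forall>\<^sub>F z in nhds z'. 0 \<le> \<rho> * (F z - F z') + \<kappa> / 2 * (Q z - Q z') + e * norm (z - z')"
    and \<tau>: "\<tau> > 0"
  obtains x \<xi> where "norm (x - fst z') < \<tau>" "\<xi> \<in> W x"
    "0 \<le> \<rho> * (dF z' \<bullet> k) + \<kappa> * max 0 (\<phi> z') * (df z' \<bullet> k - \<xi> \<bullet> fst k)
      + (\<Sum>c\<in>UNIV. \<kappa> * max 0 (h c z') * (dh c z' \<bullet> k)) + e * norm k + \<tau>"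
proof -
  define \<sigma> where "\<sigma> = (\<lambda>n. inverse (real (Suc n)))"
  have \<sigma>: "\<sigma> n > 0" for n by (simp add: \<sigma>_def)
  have \<sigma>0: "\<sigma> \<longlonglongrightarrow> 0" unfolding \<sigma>_def by (rule LIMSEQ_inverse_real_of_nat)
  define Z where "Z = (\<lambda>n. z' + \<sigma> n *\<^sub>R k)"
  have Zlim: "Z \<longlonglongrightarrow> z'"
    unfolding Z_def using tendsto_add[OF tendsto_const tendsto_scaleR[OF \<sigma>0 tendsto_const[of k]], of z'] by simp
  have quot: "(\<lambda>n. (Z n - z') /\<^sub>R \<sigma> n) \<longlonglongrightarrow> k"
  proof -
    have "(Z n - z') /\<^sub>R \<sigma> n = k" for n using \<sigma>[of n] by (simp add: Z_def)
    then show ?thesis by simp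
  qed
  define q where "q = (\<lambda>H n. (H (Z n) - H z') / \<sigma> n :: real)"
  have ql: "q H \<longlonglongrightarrow> dH z' \<bullet> k" if "C1 H dH" for H dH
    unfolding q_def by (rule C1_strict_derivative[OF that tendsto_const Zlim quot])
  have q: "H (Z n) - H z' = \<sigma> n * q H n" for H n using \<sigma>[of n] by (simp add: q_def)
  obtain L where L: "L > 0" "\<And>a b. a \<in> N \<Longrightarrow> b \<in> N \<Longrightarrow> \<bar>v a - v b\<bar> \<le> L * norm (a - b)"
    using v_lipschitz by metis
  \<comment> \<open>\<open>M\<close> bounds the increment of \<open>\<phi>\<close> per unit step, so
    the squared increment is of second order in the step size.\<close>
  define M where "M = \<bar>df z' \<bullet> k\<bar> + 1 + L * norm (fst k)"
  define P where "P = max 0 (\<phi> z')"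
  \<comment> \<open>All errors of the first order expansion are collected in \<open>E\<close>, which
    tends to 0 and is absorbed by \<open>\<tau>\<close>.\<close>
  define E where "E = (\<lambda>n. \<rho> * (q F n - dF z' \<bullet> k) + \<kappa> * P * (q f n - df z' \<bullet> k) + \<kappa> / 2 * (\<sigma> n * M\<^sup>2)
      + (\<Sum>c\<in>UNIV. \<kappa> * max 0 (h c z') * (q (h c) n - dh c z' \<bullet> k) + \<kappa> / 2 * (\<sigma> n * (q (h c) n)\<^sup>2)))"
  have "E \<longlonglongrightarrow> \<rho> * (dF z' \<bullet> k - dF z' \<bullet> k) + \<kappa> * P * (df z' \<bullet> k - df z' \<bullet> k) + \<kappa> / 2 * (0 * M\<^sup>2)
      + (\<Sum>c\<in>UNIV. \<kappa> * max 0 (h c z') * (dh c z' \<bullet> k - dh c z' \<bullet> k) + \<kappa> / 2 * (0 * (dh c z' \<bullet> k)\<^sup>2))"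
    unfolding E_def
    by (intro tendsto_add tendsto_sum tendsto_mult tendsto_diff tendsto_power tendsto_const ql F f h \<sigma>0)
  then have "E \<longlonglongrightarrow> 0" by simp
  then have E\<tau>: "\<forall>\<^sub>F n in sequentially. E n < \<tau>" using \<tau> by (rule order_tendstoD(2))
  have "(\<lambda>n. \<bar>q f n\<bar>) \<longlonglongrightarrow> \<bar>df z' \<bullet> k\<bar>" by (intro tendsto_rabs ql f)
  then have qf: "\<forall>\<^sub>F n in sequentially. \<bar>q f n\<bar> < \<bar>df z' \<bullet> k\<bar> + 1" by (rule order_tendstoD(2)) simp
  have near: "\<forall>\<^sub>F n in sequentially. dist (Z n) z' < min r \<tau>" using tendstoD[OF Zlim, of "min r \<tau>"] int(1) \<tau> by simp
  have locn: "\<forall>\<^sub>F n in sequentially. 0 \<le> \<rho> * (F (Z n) - F z') + \<kappa> / 2 * (Q (Z n) - Q z') + e * norm (Z n - z')"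
    by (rule eventually_compose_filterlim[OF loc Zlim])
  have "\<forall>\<^sub>F n in sequentially. E n < \<tau> \<and> \<bar>q f n\<bar> < \<bar>df z' \<bullet> k\<bar> + 1 \<and> dist (Z n) z' < min r \<tau>
      \<and> 0 \<le> \<rho> * (F (Z n) - F z') + \<kappa> / 2 * (Q (Z n) - Q z') + e * norm (Z n - z')"
    using E\<tau> qf near locn by eventually_elim simp
  then obtain n where n: "E n < \<tau>" "\<bar>q f n\<bar> < \<bar>df z' \<bullet> k\<bar> + 1" "dist (Z n) z' < min r \<tau>"
      "0 \<le> \<rho> * (F (Z n) - F z') + \<kappa> / 2 * (Q (Z n) - Q z') + e * norm (Z n - z')"
    unfolding eventually_sequentially by blast
  let ?x = "fst z'" and ?y = "fst (Z n)" and ?s = "\<sigma> n"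
  have s: "?s > 0" by (rule \<sigma>)
  have yx: "?y - ?x = ?s *\<^sub>R fst k" by (simp add: Z_def)
  have dyx: "dist ?y ?x < min r \<tau>" using n(3) dist_fst_le[of "Z n" z'] by linarith
  have inb: "?x \<in> ball ?x r" "?y \<in> ball ?x r" using dyx int(1) by (auto simp: dist_commute)
  then have "closed_segment ?y ?x \<subseteq> ball ?x r" by (simp add: closed_segment_subset)
  then have seg: "closed_segment ?y ?x \<subseteq> N" using int(2) by blast
  \<comment> \<open>The segment runs from the new point back to \<open>fst z'\<close>: the mean
    value theorem bounds an increment of \<open>v\<close> from above, and \<open>v\<close> enters
    \<open>\<phi>\<close> with a minus sign.\<close>
  obtain x \<xi> where x: "x \<in> closed_segment ?y ?x" "\<xi> \<in> W x" "v ?x - v ?y \<le> \<xi> \<bullet> (?x - ?y)"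
    by (rule value_mean_value[OF seg], rule that)
  have "norm (x - ?x) < \<tau>"
    using segment_bound(2)[OF x(1)] dyx by (simp add: dist_norm norm_minus_commute)
  moreover have "0 \<le> \<rho> * (dF z' \<bullet> k) + \<kappa> * max 0 (\<phi> z') * (df z' \<bullet> k - \<xi> \<bullet> fst k)
      + (\<Sum>c\<in>UNIV. \<kappa> * max 0 (h c z') * (dh c z' \<bullet> k)) + e * norm k + \<tau>"
  proof -
    have \<xi>le: "v ?x - v ?y \<le> - (?s * (\<xi> \<bullet> fst k))"
    proof -
      have "?x - ?y = - (?s *\<^sub>R fst k)" using yx by (simp add: algebra_simps)
      then show ?thesis using x(3) by simp
    qed
    have \<phi>d: "\<phi> (Z n) - \<phi> z' \<le> ?s * (q f n - \<xi> \<bullet> fst k)"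
      using q[of f n] \<xi>le by (simp add: \<phi>_def algebra_simps)
    have "\<bar>\<phi> (Z n) - \<phi> z'\<bar> \<le> ?s * M"
    proof -
      have "\<bar>v ?y - v ?x\<bar> \<le> L * norm (?y - ?x)" using L(2) int(2) inb by blast
      also have "\<dots> = ?s * (L * norm (fst k))" using s by (simp add: yx)
      finally have "\<bar>v ?y - v ?x\<bar> \<le> ?s * (L * norm (fst k))" .
      moreover have "\<phi> (Z n) - \<phi> z' = ?s * q f n - (v ?y - v ?x)" using q[of f n] by (simp add: \<phi>_def)
      ultimately have "\<bar>\<phi> (Z n) - \<phi> z'\<bar> \<le> \<bar>?s * q f n\<bar> + ?s * (L * norm (fst k))"
        using abs_triangle_ineq4[of "?s * q f n" "v ?y - v ?x"] by simp
      also have "\<bar>?s * q f n\<bar> \<le> ?s * (\<bar>df z' \<bullet> k\<bar> + 1)" using n(2) s by (simp add: abs_mult)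
      finally show ?thesis by (simp add: M_def algebra_simps)
    qed
    then have \<phi>2: "(\<phi> (Z n) - \<phi> z')\<^sup>2 \<le> ?s * (?s * M\<^sup>2)"
      using power_mono[of "\<bar>\<phi> (Z n) - \<phi> z'\<bar>" "?s * M" 2] by (simp add: power2_eq_square algebra_simps)
    have "P * (\<phi> (Z n) - \<phi> z') \<le> P * (?s * (q f n - \<xi> \<bullet> fst k))"
      by (rule mult_left_mono[OF \<phi>d]) (simp add: P_def)
    then have Q1: "(max 0 (\<phi> (Z n)))\<^sup>2 - (max 0 (\<phi> z'))\<^sup>2 \<le> ?s * (2 * P * (q f n - \<xi> \<bullet> fst k) + ?s * M\<^sup>2)"
      using max0_square_diff[of "\<phi> (Z n)" "\<phi> z'"] \<phi>2 by (simp add: P_def algebra_simps)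
    have Q2: "(max 0 (h c (Z n)))\<^sup>2 - (max 0 (h c z'))\<^sup>2 \<le> ?s * (2 * max 0 (h c z') * q (h c) n + ?s * (q (h c) n)\<^sup>2)" for c
      using max0_square_diff[of "h c (Z n)" "h c z'"] unfolding q[of "h c" n]
      by (simp add: power2_eq_square algebra_simps)
    define A where "A = 2 * P * (q f n - \<xi> \<bullet> fst k) + ?s * M\<^sup>2"
    define B where "B = (\<lambda>c. 2 * max 0 (h c z') * q (h c) n + ?s * (q (h c) n)\<^sup>2)"
    have "Q (Z n) - Q z' = ((max 0 (\<phi> (Z n)))\<^sup>2 - (max 0 (\<phi> z'))\<^sup>2)
        + (\<Sum>c\<in>UNIV. (max 0 (h c (Z n)))\<^sup>2 - (max 0 (h c z'))\<^sup>2)"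
      by (simp add: Q_def sum_subtractf)
    also have "\<dots> \<le> ?s * A + (\<Sum>c\<in>UNIV. ?s * B c)"
      unfolding A_def B_def by (intro add_mono sum_mono Q1 Q2)
    also have "\<dots> = ?s * (A + (\<Sum>c\<in>UNIV. B c))" by (simp add: distrib_left sum_distrib_left)
    finally have "\<kappa> / 2 * (Q (Z n) - Q z') \<le> \<kappa> / 2 * (?s * (A + (\<Sum>c\<in>UNIV. B c)))"
      using \<kappa> by (intro mult_left_mono) auto
    moreover have "norm (Z n - z') = ?s * norm k" using s by (simp add: Z_def)
    ultimately have "0 \<le> \<rho> * (?s * q F n) + \<kappa> / 2 * (?s * (A + (\<Sum>c\<in>UNIV. B c))) + e * (?s * norm k)"
      using n(4) q[of F n] by simp
    also have "\<dots> = ?s * (\<rho> * q F n + \<kappa> / 2 * (A + (\<Sum>c\<in>UNIV. B c)) + e * norm k)"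
      by (simp add: algebra_simps)
    finally have "0 \<le> \<rho> * q F n + \<kappa> / 2 * (A + (\<Sum>c\<in>UNIV. B c)) + e * norm k"
      using s by (simp add: zero_le_mult_iff)
    also have "\<dots> = \<rho> * (dF z' \<bullet> k) + \<kappa> * P * (df z' \<bullet> k - \<xi> \<bullet> fst k)
      + (\<Sum>c\<in>UNIV. \<kappa> * max 0 (h c z') * (dh c z' \<bullet> k)) + e * norm k + E n"
    proof -
      have "(\<Sum>c\<in>UNIV. \<kappa> * max 0 (h c z') * (q (h c) n - dh c z' \<bullet> k) + \<kappa> / 2 * (\<sigma> n * (q (h c) n)\<^sup>2))
          = \<kappa> / 2 * (\<Sum>c\<in>UNIV. B c) - (\<Sum>c\<in>UNIV. \<kappa> * max 0 (h c z') * (dh c z' \<bullet> k))"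
        unfolding sum_distrib_left sum_subtractf[symmetric]
        by (rule sum.cong) (auto simp: B_def algebra_simps)
      then show ?thesis unfolding E_def A_def by (simp add: algebra_simps)
    qed
    finally show ?thesis using n(1) by (simp add: P_def)
  qed
  ultimately show ?thesis using that x(2) by blast
qed

end

lemma norm_fst_le_norm: "norm (fst p) \<le> norm p"
  by (metis norm_fst_le prod.collapse)

section \<open>Normal and abnormal multipliers through penalization along the critical
  direction\<close>

context bilevel
begin

abbreviation zb :: "'a \<times> 'b" where "zb \<equiv> (xb, yb)"
abbreviation dir :: "'a \<times> 'b" where "dir \<equiv> (u, vd)"

text \<open>The Euclidean norm of the residual, suited to exact penalties; stationarity is always
  expressed through its square \<open>Q\<close>.\<close>

definition P :: "'a \<times> 'b \<Rightarrow> real" where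
  "P z = sqrt (Q z)"

lemma Q_nonneg: "Q z \<ge> 0"
  unfolding Q_def by (intro add_nonneg_nonneg sum_nonneg) auto

lemma P_nonneg: "P z \<ge> 0"
  by (simp add: P_def Q_nonneg)

lemma P_square: "(P z)\<^sup>2 = Q z"
  by (simp add: P_def Q_nonneg)

lemma residual_le_P: "max 0 (\<phi> z) \<le> P z" "max 0 (h c z) \<le> P z"
proof -
  have "(max 0 (h c z))\<^sup>2 \<le> (\<Sum>c\<in>UNIV. (max 0 (h c z))\<^sup>2)" by (rule member_le_sum) auto
  then have "(max 0 (h c z))\<^sup>2 \<le> Q z" by (simp add: Q_def add_increasing)
  moreover have "(max 0 (\<phi> z))\<^sup>2 \<le> Q z" by (simp add: Q_def sum_nonneg)
  ultimately show "max 0 (\<phi> z) \<le> P z" "max 0 (h c z) \<le> P z"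
    unfolding P_def by (simp_all only: real_le_rsqrt)
qed

text \<open>By concavity of the square root, an increment of \<open>P\<close> at an infeasible point
  is at most its linearization in \<open>Q\<close>, so almost minimality for \<open>P\<close> passes
  to \<open>Q\<close>.\<close>

lemma P_diff_le: "P z' > 0 \<Longrightarrow> P z - P z' \<le> (Q z - Q z') / (2 * P z')"
proof -
  assume p: "P z' > 0"
  have "0 \<le> (P z - P z')\<^sup>2" by simp
  then have "(P z - P z') * (2 * P z') \<le> (P z)\<^sup>2 - (P z')\<^sup>2" by (simp add: power2_eq_square algebra_simps)
  then show ?thesis using p by (simp add: P_square pos_le_divide_eq)
qed

lemma P_continuous: "continuous_on {z. fst z \<in> N} P"
proof -
  have "continuous_on {z. fst z \<in> N} (\<lambda>z. v (fst z))"
    by (rule continuous_on_compose2[OF v_continuous]) (auto intro: continuous_intros)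
  then have "continuous_on {z. fst z \<in> N} \<phi>"
    unfolding \<phi>_def by (intro continuous_on_diff C1_continuous[OF f])
  then show ?thesis unfolding P_def Q_def
    by (intro continuous_on_real_sqrt continuous_on_add continuous_on_sum continuous_on_power continuous_on_max
        continuous_on_const C1_continuous[OF h])
qed

text \<open>The weight \<rho> covers both cases: 0 for abnormal and 1 for normal multipliers. The
  products of \<open>\<kappa> k\<close> with the residuals are the approximate multipliers, kept
  bounded by \<open>bd\<close>; their limits and the compact set \<open>W_limits\<close> turn
  approximate stationarity into a multiplier rule.\<close>

lemma fritz_john:
  assumes t: "\<And>k. t k > 0" "t \<longlonglongrightarrow> 0" and D: "D \<longlonglongrightarrow> dir" and z: "\<And>k. z k = zb + t k *\<^sub>R D k"
    and e: "\<And>k. e k \<ge> 0" "e \<longlonglongrightarrow> 0" and \<kappa>: "\<And>k. \<kappa> k \<ge> 0" and \<rho>: "\<rho> \<ge> 0"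
    and int: "\<forall>\<^sub>F k in sequentially. \<exists>r>0. ball (fst (z k)) r \<subseteq> N"
    and loc: "\<forall>\<^sub>F k in sequentially. \<forall>\<^sub>F w in nhds (z k).
      0 \<le> \<rho> * (F w - F (z k)) + \<kappa> k / 2 * (Q w - Q (z k)) + e k * norm (w - z k)"
    and bd: "\<forall>\<^sub>F k in sequentially. \<kappa> k * P (z k) \<le> B"
  obtains r \<nu>0 \<nu> \<xi> where "strict_mono (r :: nat \<Rightarrow> nat)" "(\<lambda>k. \<kappa> (r k) * max 0 (\<phi> (z (r k)))) \<longlonglongrightarrow> \<nu>0"
    "\<And>c. (\<lambda>k. \<kappa> (r k) * max 0 (h c (z (r k)))) \<longlonglongrightarrow> \<nu> c" "\<nu>0 \<ge> 0" "\<And>c. \<nu> c \<ge> 0"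
    "\<xi> \<in> convex hull W_limits" "\<rho> *\<^sub>R dF zb + \<nu>0 *\<^sub>R (df zb - (\<xi>, 0)) + (\<Sum>c\<in>UNIV. \<nu> c *\<^sub>R dh c zb) = 0"
    "\<And>c. \<nu> c > 0 \<Longrightarrow> h c zb = 0 \<and> dh c zb \<bullet> dir = 0"
proof -
  obtain k0 where k0: "\<And>k. k \<ge> k0 \<Longrightarrow> (\<exists>r>0. ball (fst (z k)) r \<subseteq> N)
      \<and> (\<forall>\<^sub>F w in nhds (z k). 0 \<le> \<rho> * (F w - F (z k)) + \<kappa> k / 2 * (Q w - Q (z k)) + e k * norm (w - z k))
      \<and> \<kappa> k * P (z k) \<le> B"
    using eventually_conj[OF int eventually_conj[OF loc bd]] unfolding eventually_sequentially by blast
  define p :: "nat \<Rightarrow> real \<times> (real^'c)" where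
    "p = (\<lambda>k. (\<kappa> (k + k0) * max 0 (\<phi> (z (k + k0))), \<chi> c. \<kappa> (k + k0) * max 0 (h c (z (k + k0)))))"
  have le: "0 \<le> \<kappa> (k + k0) * max 0 (\<phi> (z (k + k0))) \<and> \<kappa> (k + k0) * max 0 (\<phi> (z (k + k0))) \<le> B"
      "0 \<le> \<kappa> (k + k0) * max 0 (h c (z (k + k0))) \<and> \<kappa> (k + k0) * max 0 (h c (z (k + k0))) \<le> B" for k c
  proof -
    let ?k = "k + k0"
    have "\<kappa> ?k * max 0 (\<phi> (z ?k)) \<le> \<kappa> ?k * P (z ?k)" "\<kappa> ?k * max 0 (h c (z ?k)) \<le> \<kappa> ?k * P (z ?k)"
      by (intro mult_left_mono residual_le_P \<kappa>)+
    moreover have "\<kappa> ?k * P (z ?k) \<le> B" using k0[of ?k] by simp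
    moreover have "0 \<le> \<kappa> ?k * max 0 (\<phi> (z ?k))" "0 \<le> \<kappa> ?k * max 0 (h c (z ?k))"
      by (intro mult_nonneg_nonneg \<kappa>; simp)+
    ultimately show "0 \<le> \<kappa> ?k * max 0 (\<phi> (z ?k)) \<and> \<kappa> ?k * max 0 (\<phi> (z ?k)) \<le> B"
      "0 \<le> \<kappa> ?k * max 0 (h c (z ?k)) \<and> \<kappa> ?k * max 0 (h c (z ?k)) \<le> B" by linarith+
  qed
  have inK: "p k \<in> {0..B} \<times> cbox (\<chi> c. 0) (\<chi> c. B)" for k
    using le by (auto simp: p_def mem_box_cart)
  have cK: "compact ({0..B} \<times> cbox ((\<chi> c. 0)::real^'c) (\<chi> c. B))"
    by (intro compact_Times compact_Icc compact_cbox)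
  obtain l r1 where r1: "strict_mono (r1 :: nat \<Rightarrow> nat)" and l: "l \<in> {0..B} \<times> cbox ((\<chi> c. 0)::real^'c) (\<chi> c. B)" "(p \<circ> r1) \<longlonglongrightarrow> l"
    by (rule seq_compactE[OF compact_imp_seq_compact[OF cK], of p], use inK in blast, rule that)
  define r where "r = (\<lambda>k. r1 k + k0)"
  have r: "strict_mono r" using r1 by (simp add: r_def strict_mono_def)
  define \<nu>0 where "\<nu>0 = fst l"
  define \<nu> where "\<nu> = (\<lambda>c. snd l $ c)"
  have pl: "(\<lambda>k. p (r1 k)) \<longlonglongrightarrow> l" using l(2) by (simp add: o_def)
  have lim0: "(\<lambda>k. \<kappa> (r k) * max 0 (\<phi> (z (r k)))) \<longlonglongrightarrow> \<nu>0"
    using tendsto_fst[OF pl] by (simp add: p_def r_def \<nu>0_def)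
  have limc: "(\<lambda>k. \<kappa> (r k) * max 0 (h c (z (r k)))) \<longlonglongrightarrow> \<nu> c" for c
    using tendsto_vec_nth[OF tendsto_snd[OF pl], of c] by (simp add: p_def r_def \<nu>_def)
  have nn: "\<nu>0 \<ge> 0" "\<nu> c \<ge> 0" for c using l(1) by (auto simp: \<nu>0_def \<nu>_def mem_box_cart)
  have sub: "(\<lambda>k. Y (r k)) \<longlonglongrightarrow> a" if "Y \<longlonglongrightarrow> a" for Y :: "nat \<Rightarrow> 'z::topological_space" and a
    using LIMSEQ_subseq_LIMSEQ[OF that r] by (simp add: o_def)
  have zlim: "(\<lambda>k. z (r k)) \<longlonglongrightarrow> zb"
  proof -
    have "z \<longlonglongrightarrow> zb + 0 *\<^sub>R dir" unfolding z by (intro tendsto_add tendsto_const tendsto_scaleR t D)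
    then show ?thesis by (intro sub) simp
  qed
  define a where "a = \<rho> *\<^sub>R dF zb + \<nu>0 *\<^sub>R df zb + (\<Sum>c\<in>UNIV. \<nu> c *\<^sub>R dh c zb)"
  have ineq_limit: "\<exists>\<xi>\<in>W_limits. 0 \<le> a \<bullet> k - \<nu>0 * (\<xi> \<bullet> fst k)" for k
  proof -
    \<comment> \<open>Accuracy o(t) keeps the points \<open>x n\<close>, where the gradients are
      taken, asymptotically in direction \<open>u\<close>.\<close>
    define \<tau> where "\<tau> = (\<lambda>n. t (r n) / real (Suc n))"
    define I where "I = (\<lambda>n \<xi>. \<rho> * (dF (z (r n)) \<bullet> k) + \<kappa> (r n) * max 0 (\<phi> (z (r n))) * (df (z (r n)) \<bullet> k - \<xi> \<bullet> fst k)
        + (\<Sum>c\<in>UNIV. \<kappa> (r n) * max 0 (h c (z (r n))) * (dh c (z (r n)) \<bullet> k)) + e (r n) * norm k + \<tau> n)"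
    have "\<exists>x \<xi>. norm (x - fst (z (r n))) < \<tau> n \<and> \<xi> \<in> W x \<and> 0 \<le> I n \<xi>" for n
    proof -
      have "r n \<ge> k0" by (simp add: r_def)
      note k0n = k0[OF this]
      obtain \<delta>' where \<delta>': "\<delta>' > 0" "ball (fst (z (r n))) \<delta>' \<subseteq> N" using k0n by blast
      have \<tau>n: "\<tau> n > 0" using t(1) by (simp add: \<tau>_def)
      show ?thesis
        by (rule stationarity_step[where k = k, OF \<delta>' \<kappa> \<rho> e(1) conjunct1[OF conjunct2[OF k0n]] \<tau>n])
          (intro exI conjI, assumption+, simp only: I_def)
    qed
    then obtain x \<xi> where x: "\<And>n. norm (x n - fst (z (r n))) < \<tau> n" and \<xi>: "\<And>n. \<xi> n \<in> W (x n)"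
      and ineq: "\<And>n. 0 \<le> I n (\<xi> n)"
      by metis
    define s where "s = (\<lambda>n. (x n - xb) /\<^sub>R t (r n))"
    have xs: "xb + t (r n) *\<^sub>R s n = x n" for n using t(1)[of "r n"] by (simp add: s_def)
    have sl: "s \<longlonglongrightarrow> u"
    proof (rule null_bound)
      show "(\<lambda>n. fst (D (r n))) \<longlonglongrightarrow> u" using tendsto_fst[OF sub[OF D]] by simp
      fix n
      have "s n - fst (D (r n)) = (x n - fst (z (r n))) /\<^sub>R t (r n)"
        using t(1)[of "r n"] by (simp add: s_def z scaleR_right_diff_distrib scaleR_right_distrib)
      then have "norm (s n - fst (D (r n))) = norm (x n - fst (z (r n))) / t (r n)"
        using t(1)[of "r n"] by (simp add: divide_inverse mult.commute)
      also have "\<dots> \<le> \<tau> n / t (r n)" using x[of n] t(1)[of "r n"] by (intro divide_right_mono) auto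
      also have "\<dots> = 1 / real (Suc n)" using t(1)[of "r n"] by (simp add: \<tau>_def)
      finally show "norm (s n - fst (D (r n))) \<le> 1 / real (Suc n)" .
    qed
    have \<xi>W: "\<xi> n \<in> W (xb + t (r n) *\<^sub>R s n)" for n unfolding xs by (rule \<xi>)
    obtain r2 \<xi>0 where r2: "strict_mono (r2 :: nat \<Rightarrow> nat)" "(\<lambda>n. \<xi> (r2 n)) \<longlonglongrightarrow> \<xi>0" "\<xi>0 \<in> W_limits"
      by (rule W_limits_subsequence[where t = "\<lambda>n. t (r n)", OF t(1) sub[OF t(2)] sl \<xi>W], rule that)
    have sub2: "(\<lambda>k. Y (r2 k)) \<longlonglongrightarrow> a" if "Y \<longlonglongrightarrow> a" for Y :: "nat \<Rightarrow> 'z::topological_space" and a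
      using LIMSEQ_subseq_LIMSEQ[OF that r2(1)] by (simp add: o_def)
    have \<tau>l: "\<tau> \<longlonglongrightarrow> 0"
    proof -
      have "(\<lambda>n. t (r n) * inverse (real (Suc n))) \<longlonglongrightarrow> 0 * 0"
        by (intro tendsto_mult sub[OF t(2)] LIMSEQ_inverse_real_of_nat)
      then show ?thesis by (simp add: \<tau>_def divide_inverse)
    qed
    note gl = C1_grad_tendsto[OF _ sub2[OF zlim]]
    have "(\<lambda>n. \<rho> * (dF (z (r (r2 n))) \<bullet> k) + \<kappa> (r (r2 n)) * max 0 (\<phi> (z (r (r2 n)))) * (df (z (r (r2 n))) \<bullet> k - \<xi> (r2 n) \<bullet> fst k)
        + (\<Sum>c\<in>UNIV. \<kappa> (r (r2 n)) * max 0 (h c (z (r (r2 n)))) * (dh c (z (r (r2 n))) \<bullet> k)) + e (r (r2 n)) * norm k + \<tau> (r2 n))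
      \<longlonglongrightarrow> \<rho> * (dF zb \<bullet> k) + \<nu>0 * (df zb \<bullet> k - \<xi>0 \<bullet> fst k) + (\<Sum>c\<in>UNIV. \<nu> c * (dh c zb \<bullet> k)) + 0 * norm k + 0"
      by (intro tendsto_add tendsto_diff tendsto_sum tendsto_mult[OF tendsto_const] tendsto_mult[OF sub2[OF lim0]]
          tendsto_mult[OF sub2[OF limc]] tendsto_mult[OF sub2[OF sub[OF e(2)]]] tendsto_inner tendsto_const
          gl[OF F] gl[OF f] gl[OF h] r2(2) sub2[OF \<tau>l])
    then have "0 \<le> \<rho> * (dF zb \<bullet> k) + \<nu>0 * (df zb \<bullet> k - \<xi>0 \<bullet> fst k) + (\<Sum>c\<in>UNIV. \<nu> c * (dh c zb \<bullet> k)) + 0 * norm k + 0"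
      by (rule LIMSEQ_le_const) (use ineq[unfolded I_def] in blast)
    also have "\<dots> = a \<bullet> k - \<nu>0 * (\<xi>0 \<bullet> fst k)"
      by (simp add: a_def inner_add_left inner_sum_left algebra_simps)
    finally show ?thesis using r2(3) by blast
  qed
  obtain \<xi> where \<xi>: "\<xi> \<in> convex hull W_limits" "a - \<nu>0 *\<^sub>R (\<xi>, 0) = 0"
    by (rule W_limits_multiplier[OF ineq_limit], rule that)
  have orth: "h c zb = 0 \<and> dh c zb \<bullet> dir = 0" if c: "\<nu> c > 0" for c
  proof -
    \<comment> \<open>A positive limit multiplier requires a violated constraint along the tail. As
      \<open>zb\<close> is feasible, the constraint is active there with nonnegative derivative
      along \<open>dir\<close>, and criticality gives the opposite sign.\<close>
    have pos: "\<forall>\<^sub>F k in sequentially. h c (z (r k)) > 0"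
      using order_tendstoD(1)[OF limc c]
    proof eventually_elim
      case (elim k)
      then show ?case using \<kappa>[of "r k"] by (auto simp: zero_less_mult_iff max_def split: if_splits)
    qed
    have "0 \<le> h c zb"
      by (rule tendsto_lowerbound[OF C1_tendsto[OF h zlim]]) (use pos in \<open>auto elim: eventually_mono\<close>)
    then have act: "h c zb = 0" using h0[of c] by simp
    have quot: "(\<lambda>k. (z (r k) - zb) /\<^sub>R t (r k)) \<longlonglongrightarrow> dir"
    proof -
      have "(z (r k) - zb) /\<^sub>R t (r k) = D (r k)" for k using t(1)[of "r k"] by (simp add: z)
      then show ?thesis using sub[OF D] by simp
    qed
    have "(\<lambda>k. (h c (z (r k)) - h c zb) / t (r k)) \<longlonglongrightarrow> dh c zb \<bullet> dir"
      by (rule C1_strict_derivative[OF h tendsto_const zlim quot])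
    then have "0 \<le> dh c zb \<bullet> dir"
    proof (rule tendsto_lowerbound)
      show "\<forall>\<^sub>F k in sequentially. 0 \<le> (h c (z (r k)) - h c zb) / t (r k)"
        using pos by eventually_elim (use t(1) act in \<open>simp add: less_imp_le\<close>)
    qed simp
    then show ?thesis using act crit(3)[OF act] by simp
  qed
  show ?thesis
  proof (rule that[OF r lim0 limc nn \<xi>(1) _ orth])
    show "\<rho> *\<^sub>R dF zb + \<nu>0 *\<^sub>R (df zb - (\<xi>, 0)) + (\<Sum>c\<in>UNIV. \<nu> c *\<^sub>R dh c zb) = 0"
      using \<xi>(2) by (simp add: a_def scaleR_right_diff_distrib algebra_simps del: scaleR_Pair)
  qed
qed

text \<open>The radius is proportional to \<open>t\<close>, so whole neighbourhoods of the auxiliary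
  minimizers project into \<open>N\<close>. The sector of size \<open>\<eta>1\<close> is spent as
  two quarters for the distances and one half for the angle.\<close>

lemma sector_N_ball:
  obtains \<eta> where "\<eta> > 0" "\<And>t D' z. 0 < t \<Longrightarrow> t < \<eta> \<Longrightarrow> norm (D' - dir) < 2 * \<eta> \<Longrightarrow> norm (z - (zb + t *\<^sub>R D')) \<le> t * \<eta> \<Longrightarrow>
    ball (fst z) (t * \<eta>) \<subseteq> N"
proof (rule sector_N)
  fix \<eta>1 assume \<eta>1: "\<eta>1 > 0" "\<And>t w. 0 \<le> t \<Longrightarrow> t < \<eta>1 \<Longrightarrow> norm (w - u) < \<eta>1 \<Longrightarrow> xb + t *\<^sub>R w \<in> N"
  show ?thesis
  proof (rule that[of "\<eta>1 / 4"])
    fix t D' z assume t: "0 < t" "t < \<eta>1 / 4" and D': "norm (D' - dir) < 2 * (\<eta>1 / 4)"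
      and z: "norm (z - (zb + t *\<^sub>R D')) \<le> t * (\<eta>1 / 4)"
    show "ball (fst z) (t * (\<eta>1 / 4)) \<subseteq> N"
    proof
      fix x assume "x \<in> ball (fst z) (t * (\<eta>1 / 4))"
      then have x: "norm (x - fst z) < t * (\<eta>1 / 4)" by (simp add: dist_norm norm_minus_commute)
      let ?w = "(x - xb) /\<^sub>R t"
      have f1: "norm (fst z - (xb + t *\<^sub>R fst D')) \<le> t * (\<eta>1 / 4)"
        using norm_fst_le_norm[of "z - (zb + t *\<^sub>R D')"] z by simp
      have f2: "norm (fst D' - u) < \<eta>1 / 2" using norm_fst_le_norm[of "D' - dir"] D' by simp
      have E: "t *\<^sub>R (?w - u) = (x - fst z) + (fst z - (xb + t *\<^sub>R fst D')) + t *\<^sub>R (fst D' - u)"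
        using t by (simp add: algebra_simps)
      have "t * norm (?w - u) = norm (t *\<^sub>R (?w - u))" using t by simp
      also have "\<dots> \<le> norm (x - fst z) + norm (fst z - (xb + t *\<^sub>R fst D')) + norm (t *\<^sub>R (fst D' - u))"
        unfolding E by (intro norm_triangle_le add_right_mono norm_triangle_ineq)
      also have "\<dots> < t * (\<eta>1 / 4) + t * (\<eta>1 / 4) + t * (\<eta>1 / 2)"
      proof -
        have "norm (t *\<^sub>R (fst D' - u)) < t * (\<eta>1 / 2)" using mult_strict_left_mono[OF f2 t(1)] t by simp
        then show ?thesis using x f1 by linarith
      qed
      finally have "t * norm (?w - u) < t * \<eta>1" by (simp add: algebra_simps)
      then have "norm (?w - u) < \<eta>1" using t by simp
      then have "xb + t *\<^sub>R ?w \<in> N" by (intro \<eta>1(2)) (use t in auto)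
      then show "x \<in> N" using t by simp
    qed
  qed (use \<eta>1 in auto)
qed

lemma residual_zero_feasible: "P z = 0 \<Longrightarrow> fst z \<in> N \<Longrightarrow> dist z zb < e0 \<Longrightarrow> F zb \<le> F z"
  using residual_le_P(1)[of z] residual_le_P(2)[where z = z] by (intro min) (simp_all add: \<phi>_def)

text \<open>
  Minimizing \<open>P\<close> plus a small multiple of the distance near points that violate every exact
  penalty bound yields infeasible, almost stationary points of \<open>P\<close> in the direction \<open>(u, vd)\<close>.
\<close>

lemma abnormal_multiplier:
  assumes not: "\<And>c1 \<eta>. c1 > 0 \<Longrightarrow> \<eta> > 0 \<Longrightarrow> \<exists>t D'. 0 < t \<and> t < \<eta> \<and> norm (D' - dir) < \<eta>
      \<and> F (zb + t *\<^sub>R D') + c1 * P (zb + t *\<^sub>R D') < F zb"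
  obtains \<nu>0 \<nu> \<xi> t D where "\<nu>0 \<ge> 0" "\<And>c. \<nu> c \<ge> 0" "\<nu>0 \<noteq> 0 \<or> (\<exists>c. \<nu> c \<noteq> 0)" "\<xi> \<in> convex hull W_limits"
    "\<nu>0 *\<^sub>R (df zb - (\<xi>, 0)) + (\<Sum>c\<in>UNIV. \<nu> c *\<^sub>R dh c zb) = 0"
    "\<And>c. \<nu> c > 0 \<Longrightarrow> h c zb = 0 \<and> dh c zb \<bullet> dir = 0"
    "\<And>k. t k > 0" "t \<longlonglongrightarrow> 0" "D \<longlonglongrightarrow> dir" "\<And>k. fst (zb + t k *\<^sub>R D k) \<in> N"
    "\<And>k. \<nu>0 > 0 \<Longrightarrow> \<phi> (zb + t k *\<^sub>R D k) > 0" "\<And>k c. \<nu> c > 0 \<Longrightarrow> h c (zb + t k *\<^sub>R D k) > 0"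
proof -
  obtain \<eta> where \<eta>: "\<eta> > 0" and sect: "\<And>t D' z. 0 < t \<Longrightarrow> t < \<eta> \<Longrightarrow> norm (D' - dir) < 2 * \<eta> \<Longrightarrow>
      norm (z - (zb + t *\<^sub>R D')) \<le> t * \<eta> \<Longrightarrow> ball (fst z) (t * \<eta>) \<subseteq> N"
    by (rule sector_N_ball, rule that)
  \<comment> \<open>The penalty constant grows to infinity while the sector shrinks; the cap
    \<open>\<eta>\<close> keeps all points where \<open>N\<close> is available.\<close>
  have "\<exists>t D'. 0 < t \<and> t < min (1 / real (Suc n)) \<eta> \<and> norm (D' - dir) < min (1 / real (Suc n)) \<eta>
      \<and> F (zb + t *\<^sub>R D') + real (Suc n) * P (zb + t *\<^sub>R D') < F zb" for n
    by (rule not) (use \<eta> in auto)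
  then obtain t D where t: "\<And>n. 0 < t n" "\<And>n. t n < min (1 / real (Suc n)) \<eta>"
    and D: "\<And>n. norm (D n - dir) < min (1 / real (Suc n)) \<eta>"
    and bad: "\<And>n. F (zb + t n *\<^sub>R D n) + real (Suc n) * P (zb + t n *\<^sub>R D n) < F zb" by metis
  have t0: "t \<longlonglongrightarrow> 0"
    by (rule null_bound[where Y = "\<lambda>_. 0"]) (use t in \<open>auto simp: less_imp_le\<close>)
  have Dl: "D \<longlonglongrightarrow> dir"
    by (rule null_bound[where Y = "\<lambda>_. dir"]) (use D in \<open>auto simp: less_imp_le\<close>)
  define z where "z = (\<lambda>n. zb + t n *\<^sub>R D n)"
  \<comment> \<open>The constant \<open>Suc n\<close> is split as \<open>m n * m n\<close>: one
    factor makes the weight \<open>1 / m n\<close> of the distance vanish, the other keeps the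
    displacement of order \<open>t n / m n\<close>.\<close>
  define m where "m = (\<lambda>n. sqrt (real (Suc n)))"
  have m: "m n > 0" "m n * m n = real (Suc n)" for n by (simp_all add: m_def)
  define K where "K = (\<lambda>n. cball (z n) (t n * \<eta>))"
  have KN: "ball (fst w) (t n * \<eta>) \<subseteq> N" if "w \<in> K n" for w n
  proof (rule sect)
    show "norm (D n - dir) < 2 * \<eta>" using D[of n] \<eta> by simp
    show "norm (w - (zb + t n *\<^sub>R D n)) \<le> t n * \<eta>" using that by (simp add: K_def z_def dist_norm norm_minus_commute)
  qed (use t in auto)
  have r\<eta>: "t n * \<eta> > 0" for n using t(1)[of n] \<eta> by simp
  then have KN': "fst w \<in> N" if "w \<in> K n" for w n using KN[OF that] by (meson centre_in_ball subsetD)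
  have zK: "z n \<in> K n" for n using r\<eta>[of n] by (simp add: K_def)
  \<comment> \<open>A perturbation in the manner of Ekeland: the minimizer is at most
    \<open>m n * P (z n)\<close> away from \<open>z n\<close> and almost stationary for
    \<open>P\<close> with error \<open>1 / m n\<close>.\<close>
  have "\<exists>z'\<in>K n. \<forall>w\<in>K n. P z' + norm (z' - z n) / m n \<le> P w + norm (w - z n) / m n" for n
  proof (rule continuous_attains_inf)
    show "continuous_on (K n) (\<lambda>w. P w + norm (w - z n) / m n)"
      using m(1)[of n] KN' by (intro continuous_intros continuous_on_subset[OF P_continuous]; (blast | force))
  qed (use r\<eta>[of n] in \<open>auto simp: K_def\<close>)
  then obtain z' where z'K: "\<And>n. z' n \<in> K n"
    and z'min: "\<And>n w. w \<in> K n \<Longrightarrow> P (z' n) + norm (z' n - z n) / m n \<le> P w + norm (w - z n) / m n" by metis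
  obtain L where L: "L > 0" "\<And>a b. a \<in> cball zb 1 \<Longrightarrow> b \<in> cball zb 1 \<Longrightarrow> \<bar>F a - F b\<bar> \<le> L * norm (a - b)"
    using C1_lipschitz_on_compact[OF F compact_cball[of zb 1] convex_cball] by metis
  define BD where "BD = norm dir + 1"
  have BD: "norm (D n) \<le> BD" for n
  proof -
    have "1 / real (Suc n) \<le> 1" by simp
    then show ?thesis using D[of n] norm_triangle_sub[of "D n" dir] unfolding BD_def by linarith
  qed
  have zzb: "norm (z n - zb) \<le> t n * BD" for n
    using BD[of n] t(1)[of n] by (simp add: z_def)
  have z'zb: "norm (z' n - zb) \<le> t n * (BD + \<eta>)" for n
  proof -
    have "norm (z' n - zb) \<le> norm (z' n - z n) + norm (z n - zb)"
      using dist_triangle[of "z' n" zb "z n"] by (simp add: dist_norm)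
    moreover have "norm (z' n - z n) \<le> t n * \<eta>" using z'K[of n] by (simp add: K_def dist_norm norm_minus_commute)
    ultimately show ?thesis using zzb[of n] by (simp add: distrib_left)
  qed
  have minv: "(\<lambda>n. 1 / m n) \<longlonglongrightarrow> 0"
  proof -
    have "(\<lambda>n. sqrt (inverse (real (Suc n)))) \<longlonglongrightarrow> sqrt 0" by (intro tendsto_real_sqrt LIMSEQ_inverse_real_of_nat)
    then show ?thesis by (simp add: m_def real_sqrt_inverse divide_inverse)
  qed
  have step: "(\<lambda>n. L * BD * (1 / m n)) \<longlonglongrightarrow> 0"
    using tendsto_mult[OF tendsto_const[of "L * BD"] minv] by simp
  have "(\<lambda>n. t n * (BD + \<eta>)) \<longlonglongrightarrow> 0" using tendsto_mult[OF t0 tendsto_const[of "BD + \<eta>"]] by simp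
  then have ev1: "\<forall>\<^sub>F n in sequentially. t n * (BD + \<eta>) < min 1 e0" using e0 by (intro order_tendstoD(2)) auto
  have ev2: "\<forall>\<^sub>F n in sequentially. 1 / m n < 1 / L" using L(1) by (intro order_tendstoD(2)[OF minv]) auto
  have ev3: "\<forall>\<^sub>F n in sequentially. L * BD * (1 / m n) < \<eta>" using \<eta> by (intro order_tendstoD(2)[OF step]) auto
  define good where "good = (\<lambda>n. norm (z' n - z n) \<le> t n * (L * BD * (1 / m n)) \<and> norm (z' n - z n) < t n * \<eta> \<and> P (z' n) > 0)"
  have good: "\<forall>\<^sub>F n in sequentially. good n"
    using ev1 ev2 ev3
  proof eventually_elim
    case (elim n)
    have BD0: "BD > 0" by (simp add: BD_def add_nonneg_pos)
    have "t n * BD \<le> t n * (BD + \<eta>)" using t(1)[of n] \<eta> by simp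
    then have in1: "z n \<in> cball zb 1" "z' n \<in> cball zb 1" "zb \<in> cball zb 1" "dist (z' n) zb < e0"
      using zzb[of n] z'zb[of n] elim(1) by (auto simp: dist_norm norm_minus_commute)
    have A1: "norm (z' n - z n) \<le> m n * P (z n) - m n * P (z' n)"
      using z'min[OF zK[of n]] m(1)[of n] by (simp add: field_simps)
    then have A1': "norm (z' n - z n) \<le> m n * P (z n)"
      using mult_nonneg_nonneg[OF less_imp_le[OF m(1)] P_nonneg, of n "z' n"] by linarith
    have A2: "m n * (m n * P (z n)) < F zb - F (z n)"
      using bad[of n] m(2)[of n] by (simp add: z_def mult.assoc[symmetric])
    have A3: "F zb - F (z n) \<le> L * (t n * BD)"
    proof -
      have "\<bar>F zb - F (z n)\<bar> \<le> L * norm (zb - z n)" using L(2)[OF in1(3,1)] .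
      also have "\<dots> \<le> L * (t n * BD)" using zzb[of n] L(1) by (intro mult_left_mono) (auto simp: norm_minus_commute)
      finally show ?thesis by simp
    qed
    have "m n * norm (z' n - z n) \<le> m n * (m n * P (z n))" using A1' m(1)[of n] by (intro mult_left_mono) auto
    then have "m n * norm (z' n - z n) \<le> L * (t n * BD)" using A2 A3 by linarith
    then have c1: "norm (z' n - z n) \<le> t n * (L * BD * (1 / m n))" using m(1)[of n] by (simp add: field_simps)
    also have "\<dots> < t n * \<eta>" using elim(3) t(1)[of n] by (intro mult_strict_left_mono)
    finally have c2: "norm (z' n - z n) < t n * \<eta>" .
    \<comment> \<open>A feasible \<open>z' n\<close> would satisfy
      \<open>F zb \<le> F (z' n)\<close>, and the violated penalty bound together with the Lipschitz
      constant of \<open>F\<close> would give \<open>m n < L\<close>.\<close>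
    have "P (z' n) \<noteq> 0"
    proof
      assume "P (z' n) = 0"
      from residual_zero_feasible[OF this KN'[OF z'K] in1(4)] have "F zb \<le> F (z' n)" .
      then have "m n * (m n * P (z n)) < F (z' n) - F (z n)" using A2 by linarith
      also have "\<dots> \<le> L * norm (z' n - z n)" using L(2)[OF in1(2,1)] by simp
      also have "\<dots> \<le> L * (m n * P (z n))" using A1' L(1) by (intro mult_left_mono) auto
      finally have "(m n - L) * (m n * P (z n)) < 0" by (simp add: algebra_simps)
      moreover have "L < m n" using elim(2) L(1) m(1)[of n] by (simp add: field_simps)
      then have "(m n - L) * (m n * P (z n)) \<ge> 0"
        using m(1)[of n] P_nonneg[of "z n"] by (intro mult_nonneg_nonneg) auto
      ultimately show False by simp
    qed
    then have "P (z' n) > 0" using P_nonneg[of "z' n"] by simp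
    then show "good n" using c1 c2 by (simp add: good_def)
  qed
  define D' where "D' = (\<lambda>n. (z' n - zb) /\<^sub>R t n)"
  have z'D: "z' n = zb + t n *\<^sub>R D' n" for n using t(1)[of n] by (simp add: D'_def)
  have D'l: "D' \<longlonglongrightarrow> dir"
  proof -
    have "(\<lambda>n. D' n - D n) \<longlonglongrightarrow> 0"
    proof (rule Lim_null_comparison[OF _ step])
      show "\<forall>\<^sub>F n in sequentially. norm (D' n - D n) \<le> L * BD * (1 / m n)"
        using good
      proof eventually_elim
        case (elim n)
        have "D' n - D n = (z' n - z n) /\<^sub>R t n"
          using t(1)[of n] by (simp add: D'_def z_def scaleR_right_diff_distrib scaleR_right_distrib)
        then have "t n * norm (D' n - D n) = norm (z' n - z n)" using t(1)[of n] by simp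
        then have "t n * norm (D' n - D n) \<le> t n * (L * BD * (1 / m n))" using elim by (simp only: good_def)
        then show ?case using t(1)[of n] by (metis mult_le_cancel_left_pos)
      qed
    qed
    from tendsto_add[OF this Dl] show ?thesis by simp
  qed
  \<comment> \<open>Dividing by \<open>P (z' n)\<close> gives the approximate multipliers Euclidean
    norm 1, so their limit cannot vanish.\<close>
  define \<kappa> where "\<kappa> = (\<lambda>n. 1 / P (z' n))"
  have \<kappa>: "\<kappa> n \<ge> 0" for n by (simp add: \<kappa>_def P_nonneg)
  have loc: "\<forall>\<^sub>F n in sequentially. \<forall>\<^sub>F w in nhds (z' n).
      0 \<le> 0 * (F w - F (z' n)) + \<kappa> n / 2 * (Q w - Q (z' n)) + 1 / m n * norm (w - z' n)"
    using good
  proof eventually_elim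
    case (elim n)
    have "z' n \<in> ball (z n) (t n * \<eta>)" using elim by (simp add: good_def dist_norm norm_minus_commute)
    then have "\<forall>\<^sub>F w in nhds (z' n). w \<in> ball (z n) (t n * \<eta>)" by (rule eventually_nhds_in_open[OF open_ball])
    then show ?case
    proof eventually_elim
      case (elim w)
      then have "w \<in> K n" by (simp add: K_def)
      from z'min[OF this] have "P (z' n) - P w \<le> (norm (w - z n) - norm (z' n - z n)) / m n"
        by (simp add: diff_divide_distrib)
      also have "\<dots> \<le> norm (w - z' n) / m n"
        using norm_triangle_ineq2[of "w - z n" "z' n - z n"] m(1)[of n] by (intro divide_right_mono) auto
      finally have "P (z' n) - P w \<le> norm (w - z' n) / m n" .
      moreover have "P w - P (z' n) \<le> \<kappa> n / 2 * (Q w - Q (z' n))"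
        using P_diff_le[of "z' n" w] \<open>good n\<close> by (simp add: good_def \<kappa>_def)
      ultimately show ?case by simp
    qed
  qed
  have int: "\<forall>\<^sub>F n in sequentially. \<exists>r>0. ball (fst (z' n)) r \<subseteq> N"
    using KN[OF z'K] r\<eta> by (intro always_eventually) blast
  have bd: "\<forall>\<^sub>F n in sequentially. \<kappa> n * P (z' n) \<le> 1"
    by (intro always_eventually) (simp add: \<kappa>_def)
  have e: "1 / m n \<ge> 0" for n using m(1)[of n] by simp
  obtain r \<nu>0 \<nu> \<xi> where r: "strict_mono (r :: nat \<Rightarrow> nat)" and lim0: "(\<lambda>k. \<kappa> (r k) * max 0 (\<phi> (z' (r k)))) \<longlonglongrightarrow> \<nu>0"
    and limc: "\<And>c. (\<lambda>k. \<kappa> (r k) * max 0 (h c (z' (r k)))) \<longlonglongrightarrow> \<nu> c" and nn: "\<nu>0 \<ge> 0" "\<And>c. \<nu> c \<ge> 0"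
    and \<xi>: "\<xi> \<in> convex hull W_limits" "0 *\<^sub>R dF zb + \<nu>0 *\<^sub>R (df zb - (\<xi>, 0)) + (\<Sum>c\<in>UNIV. \<nu> c *\<^sub>R dh c zb) = 0"
    and orth: "\<And>c. \<nu> c > 0 \<Longrightarrow> h c zb = 0 \<and> dh c zb \<bullet> dir = 0"
    by (rule fritz_john[OF t(1) t0 D'l z'D e minv \<kappa> order_refl int loc bd], rule that)
  have sub: "\<forall>\<^sub>F k in sequentially. good (r k)" using good r by (rule eventually_subseq[rotated])
  have "(\<lambda>k. (\<kappa> (r k) * max 0 (\<phi> (z' (r k))))\<^sup>2 + (\<Sum>c\<in>UNIV. (\<kappa> (r k) * max 0 (h c (z' (r k))))\<^sup>2)) \<longlonglongrightarrow> \<nu>0\<^sup>2 + (\<Sum>c\<in>UNIV. (\<nu> c)\<^sup>2)"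
    by (intro tendsto_add tendsto_sum tendsto_power lim0 limc)
  moreover have "\<forall>\<^sub>F k in sequentially. (\<kappa> (r k) * max 0 (\<phi> (z' (r k))))\<^sup>2 + (\<Sum>c\<in>UNIV. (\<kappa> (r k) * max 0 (h c (z' (r k))))\<^sup>2) = 1"
    using sub
  proof eventually_elim
    case (elim k)
    have "(\<kappa> (r k) * max 0 (\<phi> (z' (r k))))\<^sup>2 + (\<Sum>c\<in>UNIV. (\<kappa> (r k) * max 0 (h c (z' (r k))))\<^sup>2) = (\<kappa> (r k))\<^sup>2 * Q (z' (r k))"
      by (simp add: Q_def power_mult_distrib distrib_left sum_distrib_left)
    also have "\<dots> = 1" using elim by (simp add: good_def \<kappa>_def power_divide P_square[symmetric])
    finally show ?case .
  qed
  ultimately have "(\<lambda>k::nat. 1) \<longlonglongrightarrow> \<nu>0\<^sup>2 + (\<Sum>c\<in>UNIV. (\<nu> c)\<^sup>2)" using tendsto_cong by force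
  then have "\<nu>0\<^sup>2 + (\<Sum>c\<in>UNIV. (\<nu> c)\<^sup>2) = 1" by (simp add: LIMSEQ_const_iff)
  then have nz: "\<nu>0 \<noteq> 0 \<or> (\<exists>c. \<nu> c \<noteq> 0)" by (cases "\<forall>c. \<nu> c = 0") auto
  have pos_of: "a > 0" if "\<kappa> (r k) * max 0 a > 0" for a k
    using that \<kappa>[of "r k"] by (auto simp: zero_less_mult_iff max_def split: if_splits)
  have ev0: "\<forall>\<^sub>F k in sequentially. \<nu>0 > 0 \<longrightarrow> \<phi> (z' (r k)) > 0"
  proof (cases "\<nu>0 > 0")
    case True
    from order_tendstoD(1)[OF lim0 True] show ?thesis by eventually_elim (use pos_of in blast)
  qed simp
  have evc: "\<forall>\<^sub>F k in sequentially. \<nu> c > 0 \<longrightarrow> h c (z' (r k)) > 0" for c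
  proof (cases "\<nu> c > 0")
    case True
    from order_tendstoD(1)[OF limc True] show ?thesis by eventually_elim (use pos_of in blast)
  qed simp
  have ev: "\<forall>\<^sub>F k in sequentially. \<forall>c\<in>UNIV. \<nu> c > 0 \<longrightarrow> h c (z' (r k)) > 0"
    by (intro eventually_ball_finite finite ballI evc)
  obtain k0 where k0: "\<And>k. k \<ge> k0 \<Longrightarrow> (\<nu>0 > 0 \<longrightarrow> \<phi> (z' (r k)) > 0) \<and> (\<forall>c\<in>UNIV. \<nu> c > 0 \<longrightarrow> h c (z' (r k)) > 0)"
    using eventually_conj[OF ev0 ev] unfolding eventually_sequentially by blast
  show ?thesis
  proof (rule that[of \<nu>0 \<nu> \<xi> "\<lambda>k. t (r (k + k0))" "\<lambda>k. D' (r (k + k0))", folded z'D])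
    show "\<nu>0 *\<^sub>R (df zb - (\<xi>, 0)) + (\<Sum>c\<in>UNIV. \<nu> c *\<^sub>R dh c zb) = 0" using \<xi>(2) by simp
    show "(\<lambda>k. t (r (k + k0))) \<longlonglongrightarrow> 0" "(\<lambda>k. D' (r (k + k0))) \<longlonglongrightarrow> dir"
      using LIMSEQ_ignore_initial_segment[OF LIMSEQ_subseq_LIMSEQ[OF t0 r], of k0]
        LIMSEQ_ignore_initial_segment[OF LIMSEQ_subseq_LIMSEQ[OF D'l r], of k0] by (simp_all add: o_def)
    show "fst (z' (r (k + k0))) \<in> N" for k by (rule KN'[OF z'K])
    show "\<phi> (z' (r (k + k0))) > 0" if "\<nu>0 > 0" for k using k0[of "k + k0"] that by simp
    show "h c (z' (r (k + k0))) > 0" if "\<nu> c > 0" for k c using k0[of "k + k0"] that by simp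
  qed (use nn nz \<xi>(1) orth t(1) in auto)
qed

text \<open>
  The exact penalty \<open>c\<^sub>1 P\<close> is replaced by the smooth penalty \<open>P\<^sup>2 / (2 \<theta> t)\<close>, which is larger up to
  \<open>c\<^sub>1\<^sup>2 \<theta> t / 2 = o(t)\<close>.
\<close>

lemma normal_multiplier:
  assumes c1: "c1 > 0" and \<eta>1: "\<eta>1 > 0" and exact: "\<And>t D'. 0 < t \<Longrightarrow> t < \<eta>1 \<Longrightarrow> norm (D' - dir) < \<eta>1 \<Longrightarrow>
      F zb \<le> F (zb + t *\<^sub>R D') + c1 * P (zb + t *\<^sub>R D')"
  obtains \<nu>0 \<nu> \<xi> where "\<nu>0 \<ge> 0" "\<And>c. \<nu> c \<ge> 0" "\<xi> \<in> convex hull W_limits"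
    "dF zb + \<nu>0 *\<^sub>R (df zb - (\<xi>, 0)) + (\<Sum>c\<in>UNIV. \<nu> c *\<^sub>R dh c zb) = 0"
    "\<And>c. \<nu> c > 0 \<Longrightarrow> h c zb = 0 \<and> dh c zb \<bullet> dir = 0"
proof -
  obtain \<eta>2 where \<eta>2: "\<eta>2 > 0" and sect: "\<And>t D' z. 0 < t \<Longrightarrow> t < \<eta>2 \<Longrightarrow> norm (D' - dir) < 2 * \<eta>2 \<Longrightarrow>
      norm (z - (zb + t *\<^sub>R D')) \<le> t * \<eta>2 \<Longrightarrow> ball (fst z) (t * \<eta>2) \<subseteq> N"
    by (rule sector_N_ball, rule that)
  \<comment> \<open>Half the minimum makes both inequalities strict, so that the closed balls
    \<open>K n\<close> stay inside the sectors.\<close>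
  define \<eta> where "\<eta> = min \<eta>1 \<eta>2 / 2"
  have \<eta>: "\<eta> > 0" "\<eta> < \<eta>1" "\<eta> < \<eta>2" using \<eta>1 \<eta>2 by (auto simp: \<eta>_def)
  define t where "t = (\<lambda>n. \<eta> * inverse (real (Suc n)))"
  have t: "t n > 0" for n using \<eta>(1) by (simp add: t_def)
  have t\<eta>: "t n \<le> \<eta>" for n
    using mult_left_mono[of "inverse (real (Suc n))" 1 \<eta>] \<eta>(1) by (simp add: t_def inverse_eq_divide)
  have t0: "t \<longlonglongrightarrow> 0" unfolding t_def using tendsto_mult[OF tendsto_const[of \<eta>] LIMSEQ_inverse_real_of_nat] by simp
  define z where "z = (\<lambda>n. zb + t n *\<^sub>R dir)"
  define K where "K = (\<lambda>n. cball (z n) (t n * \<eta>))"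
  have KN: "ball (fst w) (t n * \<eta>2) \<subseteq> N" if "w \<in> K n" for w n
  proof (rule sect)
    have "norm (w - (zb + t n *\<^sub>R dir)) \<le> t n * \<eta>" using that by (simp add: K_def z_def dist_norm norm_minus_commute)
    also have "\<dots> \<le> t n * \<eta>2" using \<eta> t[of n] by (intro mult_left_mono) auto
    finally show "norm (w - (zb + t n *\<^sub>R dir)) \<le> t n * \<eta>2" .
  qed (use t t\<eta>[of n] \<eta> \<eta>2 in auto)
  have r\<eta>: "t n * \<eta> > 0" "t n * \<eta>2 > 0" for n using t[of n] \<eta> \<eta>2 by simp_all
  then have KN': "fst w \<in> N" if "w \<in> K n" for w n using KN[OF that] by (meson centre_in_ball subsetD)
  have zK: "z n \<in> K n" for n using r\<eta>[of n] by (simp add: K_def)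
  have zlim: "z \<longlonglongrightarrow> zb"
    unfolding z_def using tendsto_add[OF tendsto_const tendsto_scaleR[OF t0 tendsto_const[of dir]], of zb] by simp
  have quot: "(\<lambda>n. (z n - zb) /\<^sub>R t n) \<longlonglongrightarrow> dir"
  proof -
    have "(z n - zb) /\<^sub>R t n = dir" for n using t[of n] by (simp add: z_def)
    then show ?thesis by simp
  qed
  note quotient = C1_strict_derivative[OF _ tendsto_const zlim quot]
  \<comment> \<open>Along the ray itself every residual is o(t): the derivative of the active
    constraints is nonpositive there, and for \<phi> the Hadamard derivative \<open>d\<close>
    supplies the missing quotient.\<close>
  have p\<phi>: "(\<lambda>n. max 0 (\<phi> (z n)) / t n) \<longlonglongrightarrow> 0"
  proof -
    have "(\<lambda>n. (f (z n) - f zb) / t n - (v (xb + t n *\<^sub>R u) - v xb) / t n) \<longlonglongrightarrow> df zb \<bullet> dir - d"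
      by (intro tendsto_diff quotient f d_lim[OF t t0 tendsto_const])
    then have "(\<lambda>n. max 0 ((f (z n) - f zb) / t n - (v (xb + t n *\<^sub>R u) - v xb) / t n)) \<longlonglongrightarrow> max 0 (df zb \<bullet> dir - d)"
      by (intro tendsto_max tendsto_const)
    moreover have "max 0 ((f (z n) - f zb) / t n - (v (xb + t n *\<^sub>R u) - v xb) / t n) = max 0 (\<phi> (z n)) / t n" for n
    proof -
      have "(f (z n) - f zb) / t n - (v (xb + t n *\<^sub>R u) - v xb) / t n = \<phi> (z n) / t n"
        using v_sol[OF yb] by (simp add: \<phi>_def z_def diff_divide_distrib)
      then show ?thesis using t[of n] by (auto simp: max_def zero_le_divide_iff)
    qed
    ultimately show ?thesis using crit(2) by simp
  qed
  have ph: "(\<lambda>n. max 0 (h c (z n)) / t n) \<longlonglongrightarrow> 0" for c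
  proof (cases "h c zb = 0")
    case True
    have "(\<lambda>n. max 0 ((h c (z n) - h c zb) / t n)) \<longlonglongrightarrow> max 0 (dh c zb \<bullet> dir)"
      by (intro tendsto_max tendsto_const quotient h)
    moreover have "max 0 ((h c (z n) - h c zb) / t n) = max 0 (h c (z n)) / t n" for n
      using True t[of n] by (auto simp: max_def zero_le_divide_iff)
    ultimately show ?thesis using crit(3)[OF True] by simp
  next
    case False
    then have "h c zb < 0" using h0[of c] by simp
    from order_tendstoD(2)[OF C1_tendsto[OF h zlim] this]
    have "\<forall>\<^sub>F n in sequentially. max 0 (h c (z n)) / t n = 0" by eventually_elim simp
    then show ?thesis by (rule tendsto_eventually)
  qed
  have pP: "(\<lambda>n. P (z n) / t n) \<longlonglongrightarrow> 0"
  proof -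
    have "(\<lambda>n. sqrt ((max 0 (\<phi> (z n)) / t n)\<^sup>2 + (\<Sum>c\<in>UNIV. (max 0 (h c (z n)) / t n)\<^sup>2))) \<longlonglongrightarrow> sqrt (0\<^sup>2 + (\<Sum>c\<in>(UNIV::'c set). 0\<^sup>2))"
      by (intro tendsto_real_sqrt tendsto_add tendsto_sum tendsto_power p\<phi> ph)
    moreover have "sqrt ((max 0 (\<phi> (z n)) / t n)\<^sup>2 + (\<Sum>c\<in>UNIV. (max 0 (h c (z n)) / t n)\<^sup>2)) = P (z n) / t n" for n
    proof -
      have "(max 0 (\<phi> (z n)) / t n)\<^sup>2 + (\<Sum>c\<in>UNIV. (max 0 (h c (z n)) / t n)\<^sup>2) = Q (z n) / (t n)\<^sup>2"
        by (simp add: Q_def power_divide add_divide_distrib sum_divide_distrib)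
      then show ?thesis using t[of n] by (simp add: P_def real_sqrt_divide)
    qed
    ultimately show ?thesis by simp
  qed
  have pF: "(\<lambda>n. max 0 ((F (z n) - F zb) / t n)) \<longlonglongrightarrow> 0"
  proof -
    have "(\<lambda>n. max 0 ((F (z n) - F zb) / t n)) \<longlonglongrightarrow> max 0 (dF zb \<bullet> dir)"
      by (intro tendsto_max tendsto_const quotient F)
    then show ?thesis using crit(1) by simp
  qed
  \<comment> \<open>\<open>\<theta> n\<close> dominates the scaled residual and the scaled increase
    of \<open>F\<close> along the ray and still tends to 0; the last summand keeps it
    positive.\<close>
  define \<theta> where "\<theta> = (\<lambda>n. P (z n) / t n + max 0 ((F (z n) - F zb) / t n) + inverse (real (Suc n)))"
  have \<theta>0: "\<theta> \<longlonglongrightarrow> 0"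
    unfolding \<theta>_def using tendsto_add[OF tendsto_add[OF pP pF] LIMSEQ_inverse_real_of_nat] by simp
  have Pt: "P (z n) / t n \<ge> 0" for n using P_nonneg t[of n] by simp
  have \<theta>: "\<theta> n > 0" for n unfolding \<theta>_def using Pt[of n] by (intro add_nonneg_pos add_nonneg_nonneg) auto
  have inv0: "inverse (real (Suc n)) \<ge> 0" for n by simp
  have \<theta>P: "P (z n) \<le> \<theta> n * t n" for n
  proof -
    have "P (z n) / t n \<le> \<theta> n" unfolding \<theta>_def using inv0[of n] by (simp add: add_increasing2 add_nonneg_nonneg)
    then show ?thesis using t[of n] by (simp add: pos_divide_le_eq)
  qed
  have \<theta>F: "F (z n) - F zb \<le> \<theta> n * t n" for n
  proof -
    have "(F (z n) - F zb) / t n \<le> max 0 ((F (z n) - F zb) / t n)" by simp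
    then have "(F (z n) - F zb) / t n \<le> \<theta> n" unfolding \<theta>_def using Pt[of n] inv0[of n] by linarith
    then show ?thesis using t[of n] by (simp add: pos_divide_le_eq)
  qed
  define \<kappa> where "\<kappa> = (\<lambda>n. 1 / (\<theta> n * t n))"
  have \<theta>t: "\<theta> n * t n > 0" for n using \<theta>[of n] t[of n] by simp
  have \<kappa>: "\<kappa> n \<ge> 0" for n using \<theta>t[of n] by (simp add: \<kappa>_def)
  \<comment> \<open>The weight \<open>sqrt (\<theta> n)\<close> vanishes in the limit, as
    stationarity requires, yet is large compared with \<open>\<theta> n\<close>, so that the
    minimizer is pulled to within o(t) of the ray.\<close>
  define \<Phi> where "\<Phi> = (\<lambda>n w. F w + \<kappa> n / 2 * (P w)\<^sup>2 + sqrt (\<theta> n) * norm (w - z n))"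
  have "\<exists>z'\<in>K n. \<forall>w\<in>K n. \<Phi> n z' \<le> \<Phi> n w" for n
  proof (rule continuous_attains_inf)
    show "continuous_on (K n) (\<Phi> n)" unfolding \<Phi>_def
      using KN' by (intro continuous_intros continuous_on_subset[OF P_continuous] C1_continuous[OF F]) blast
  qed (use r\<eta>[of n] in \<open>auto simp: K_def\<close>)
  then obtain z' where z'K: "\<And>n. z' n \<in> K n" and z'min: "\<And>n w. w \<in> K n \<Longrightarrow> \<Phi> n (z' n) \<le> \<Phi> n w" by metis
  define D' where "D' = (\<lambda>n. (z' n - zb) /\<^sub>R t n)"
  have z'D: "z' n = zb + t n *\<^sub>R D' n" for n using t[of n] by (simp add: D'_def)
  have D'z: "t n * norm (D' n - dir) = norm (z' n - z n)" for n
  proof -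
    have "z' n - z n = t n *\<^sub>R (D' n - dir)" by (simp add: z'D z_def scaleR_right_diff_distrib)
    then show ?thesis using t[of n] by simp
  qed
  \<comment> \<open>The minimizer stays in the sector of the exact penalty, so \<open>F\<close> can
    drop below \<open>F zb\<close> by at most \<open>c1 * P (z' n)\<close>.\<close>
  have low: "F zb \<le> F (z' n) + c1 * P (z' n)" for n
  proof -
    have "t n * norm (D' n - dir) \<le> t n * \<eta>" unfolding D'z using z'K[of n] by (simp add: K_def dist_norm norm_minus_commute)
    then have "norm (D' n - dir) \<le> \<eta>" using t[of n] by simp
    then show ?thesis unfolding z'D using t[of n] t\<eta>[of n] \<eta> by (intro exact) auto
  qed
  define X where "X = (\<lambda>n. \<kappa> n * P (z' n))"
  have X: "P (z' n) = \<theta> n * t n * X n" for n using \<theta>[of n] t[of n] by (simp add: X_def \<kappa>_def)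
  have X0: "X n \<ge> 0" for n unfolding X_def by (intro mult_nonneg_nonneg \<kappa> P_nonneg)
  \<comment> \<open>Comparison of \<open>z' n\<close> with the ray point \<open>z n\<close>: the
    constant 3/2 is 1 from the increase of \<open>F\<close> plus 1/2 from the quadratic penalty at
    \<open>z n\<close>.\<close>
  have main: "\<theta> n * t n * (X n)\<^sup>2 / 2 + sqrt (\<theta> n) * norm (z' n - z n) \<le> \<theta> n * t n * (c1 * X n + 3 / 2)" for n
  proof -
    have "\<kappa> n / 2 * (P (z n))\<^sup>2 \<le> \<kappa> n / 2 * (\<theta> n * t n)\<^sup>2"
      using \<kappa>[of n] \<theta>P[of n] P_nonneg[of "z n"] by (intro mult_left_mono power_mono) auto
    also have "\<dots> = \<theta> n * t n / 2" using \<theta>t[of n] by (simp add: \<kappa>_def power2_eq_square)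
    finally have "\<Phi> n (z n) \<le> F zb + \<theta> n * t n * (3 / 2)" using \<theta>F[of n] by (simp add: \<Phi>_def)
    then have "\<Phi> n (z' n) \<le> F zb + \<theta> n * t n * (3 / 2)" using z'min[OF zK[of n]] by linarith
    moreover have "\<kappa> n / 2 * (P (z' n))\<^sup>2 = \<theta> n * t n * (X n)\<^sup>2 / 2"
      unfolding X \<kappa>_def using \<theta>t[of n] by (simp add: power2_eq_square)
    ultimately have "\<theta> n * t n * (X n)\<^sup>2 / 2 + sqrt (\<theta> n) * norm (z' n - z n) \<le> F zb - F (z' n) + \<theta> n * t n * (3 / 2)"
      by (simp add: \<Phi>_def)
    moreover have "F zb - F (z' n) \<le> c1 * (\<theta> n * t n * X n)" using low[of n] unfolding X[symmetric] by simp
    ultimately show ?thesis by (simp add: algebra_simps)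
  qed
  have Xbd: "X n \<le> 2 * c1 + 3" for n
  proof (rule ccontr)
    assume "\<not> ?thesis"
    then have big: "X n > 2 * c1 + 3" by simp
    have "\<theta> n * t n * (X n)\<^sup>2 / 2 \<le> \<theta> n * t n * (c1 * X n + 3 / 2)"
    proof -
      have "0 \<le> sqrt (\<theta> n) * norm (z' n - z n)" using \<theta>[of n] by simp
      then show ?thesis using main[of n] by linarith
    qed
    then have "\<theta> n * t n * ((X n)\<^sup>2 / 2) \<le> \<theta> n * t n * (c1 * X n + 3 / 2)" by simp
    then have "(X n)\<^sup>2 / 2 \<le> c1 * X n + 3 / 2" using \<theta>t[of n] mult_le_cancel_left_pos by blast
    \<comment> \<open>The quadratic term in \<open>X n\<close> beats the linear one, which bounds
      the approximate multipliers independently of \<open>n\<close>.\<close>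
    then have "X n * (X n - 2 * c1) \<le> 3" by (simp add: power2_eq_square algebra_simps)
    moreover have "3 * 3 \<le> X n * (X n - 2 * c1)" using big c1 by (intro mult_mono) auto
    ultimately show False by simp
  qed
  \<comment> \<open>\<open>B\<close> is the right-hand factor of \<open>main\<close> at the largest
    admissible \<open>X n\<close>; cancelling \<open>sqrt (\<theta> n) * t n\<close> leaves a
    displacement of order \<open>sqrt (\<theta> n)\<close> per unit of \<open>t n\<close>.\<close>
  define B where "B = c1 * (2 * c1 + 3) + 3 / 2"
  have dist_bd: "norm (D' n - dir) \<le> B * sqrt (\<theta> n)" for n
  proof -
    have "sqrt (\<theta> n) * norm (z' n - z n) \<le> \<theta> n * t n * (c1 * X n + 3 / 2)"
      using main[of n] \<theta>t[of n] by (smt (verit) zero_le_power2 mult_nonneg_nonneg divide_nonneg_pos)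
    also have "\<dots> \<le> \<theta> n * t n * B"
      using \<theta>t[of n] Xbd[of n] c1 by (intro mult_left_mono) (auto simp: B_def)
    finally have "sqrt (\<theta> n) * (t n * norm (D' n - dir)) \<le> \<theta> n * t n * B" by (simp only: D'z)
    also have "\<dots> = sqrt (\<theta> n) * (t n * (B * sqrt (\<theta> n)))"
    proof -
      have "sqrt (\<theta> n) * (t n * (B * sqrt (\<theta> n))) = (sqrt (\<theta> n) * sqrt (\<theta> n)) * t n * B" by (simp only: mult_ac)
      then show ?thesis using \<theta>[of n] by simp
    qed
    finally show ?thesis using \<theta>[of n] t[of n] by simp
  qed
  have sq0: "(\<lambda>n. sqrt (\<theta> n)) \<longlonglongrightarrow> 0" using tendsto_real_sqrt[OF \<theta>0] by simp
  have Bsq: "(\<lambda>n. B * sqrt (\<theta> n)) \<longlonglongrightarrow> 0" using tendsto_mult[OF tendsto_const[of B] sq0] by simp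
  have D'l: "D' \<longlonglongrightarrow> dir"
  proof (rule LIM_zero_cancel, rule Lim_null_comparison[OF _ Bsq])
    show "\<forall>\<^sub>F n in sequentially. norm (D' n - dir) \<le> B * sqrt (\<theta> n)" using dist_bd by simp
  qed
  have loc: "\<forall>\<^sub>F n in sequentially. \<forall>\<^sub>F w in nhds (z' n).
      0 \<le> 1 * (F w - F (z' n)) + \<kappa> n / 2 * (Q w - Q (z' n)) + sqrt (\<theta> n) * norm (w - z' n)"
    using order_tendstoD(2)[OF Bsq \<eta>(1)]
  proof eventually_elim
    case (elim n)
    have "norm (D' n - dir) < \<eta>" using dist_bd[of n] elim by simp
    then have "norm (z' n - z n) < t n * \<eta>" unfolding D'z[symmetric] using t[of n] by simp
    then have "z' n \<in> ball (z n) (t n * \<eta>)" by (simp add: dist_norm norm_minus_commute)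
    then have "\<forall>\<^sub>F w in nhds (z' n). w \<in> ball (z n) (t n * \<eta>)" by (rule eventually_nhds_in_open[OF open_ball])
    then show ?case
    proof eventually_elim
      case (elim w)
      then have "w \<in> K n" by (simp add: K_def)
      from z'min[OF this]
      have "0 \<le> F w - F (z' n) + \<kappa> n / 2 * (Q w - Q (z' n)) + sqrt (\<theta> n) * (norm (w - z n) - norm (z' n - z n))"
        by (simp add: \<Phi>_def P_square algebra_simps)
      also have "sqrt (\<theta> n) * (norm (w - z n) - norm (z' n - z n)) \<le> sqrt (\<theta> n) * norm (w - z' n)"
        using norm_triangle_ineq2[of "w - z n" "z' n - z n"] \<theta>[of n] by (intro mult_left_mono) auto
      finally show ?case by simp
    qed
  qed
  have int: "\<forall>\<^sub>F n in sequentially. \<exists>r>0. ball (fst (z' n)) r \<subseteq> N"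
    using KN[OF z'K] r\<eta>(2) by (intro always_eventually) blast
  have bd: "\<forall>\<^sub>F n in sequentially. \<kappa> n * P (z' n) \<le> 2 * c1 + 3"
    using Xbd by (simp add: X_def)
  have e: "sqrt (\<theta> n) \<ge> 0" for n using \<theta>[of n] by simp
  obtain r \<nu>0 \<nu> \<xi> where "strict_mono (r :: nat \<Rightarrow> nat)" "(\<lambda>k. \<kappa> (r k) * max 0 (\<phi> (z' (r k)))) \<longlonglongrightarrow> \<nu>0"
    "\<And>c. (\<lambda>k. \<kappa> (r k) * max 0 (h c (z' (r k)))) \<longlonglongrightarrow> \<nu> c" and nn: "\<nu>0 \<ge> 0" "\<And>c. \<nu> c \<ge> 0"
    and \<xi>: "\<xi> \<in> convex hull W_limits" "1 *\<^sub>R dF zb + \<nu>0 *\<^sub>R (df zb - (\<xi>, 0)) + (\<Sum>c\<in>UNIV. \<nu> c *\<^sub>R dh c zb) = 0"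
    and orth: "\<And>c. \<nu> c > 0 \<Longrightarrow> h c zb = 0 \<and> dh c zb \<bullet> dir = 0"
    by (rule fritz_john[OF t t0 D'l z'D e sq0 \<kappa> zero_le_one int loc bd], rule that)
  show ?thesis
    by (rule that[OF nn \<xi>(1) _ orth]) (use \<xi>(2) in simp)
qed

end

section \<open>Passage from continuous differentiability to gradients, and assembly of the
  statements\<close>

lemma C1I:
  fixes h :: "'z::euclidean_space \<Rightarrow> real"
  assumes der: "\<And>z. (h has_derivative L z) (at z)" and cont: "\<And>b. continuous_on UNIV (\<lambda>z. L z b)"
  shows "C1 h (\<lambda>z. \<Sum>b\<in>Basis. L z b *\<^sub>R b)"
  unfolding C1_def
proof (intro conjI allI)
  fix z
  have lin: "linear (L z)" using der has_derivative_linear by blast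
  have "(\<Sum>b\<in>Basis. L z b *\<^sub>R b) \<bullet> k = L z k" for k
  proof -
    have "L z k = L z (\<Sum>b\<in>Basis. (k \<bullet> b) *\<^sub>R b)" by (simp add: euclidean_representation)
    also have "\<dots> = (\<Sum>b\<in>Basis. (k \<bullet> b) * L z b)" by (simp add: linear_sum[OF lin] linear_cmul[OF lin])
    finally show ?thesis by (simp add: inner_sum_left inner_commute[of k] mult.commute)
  qed
  then show "(h has_derivative (\<lambda>k. (\<Sum>b\<in>Basis. L z b *\<^sub>R b) \<bullet> k)) (at z)" using der by simp
  show "continuous_on UNIV (\<lambda>z. \<Sum>b\<in>Basis. L z b *\<^sub>R b)" by (intro continuous_intros cont)
qed

lemma cont_diff_C1:
  fixes h :: "'z::euclidean_space \<Rightarrow> real"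
  assumes "cont_diff h"
  obtains dh where "C1 h dh"
proof -
  obtain h' :: "'z \<Rightarrow> 'z \<Rightarrow>\<^sub>L real" where "\<And>z. (h has_derivative blinfun_apply (h' z)) (at z)" "continuous_on UNIV h'"
    using assms unfolding cont_diff_def by blast
  then have "C1 h (\<lambda>z. \<Sum>b\<in>Basis. h' z b *\<^sub>R b)" by (intro C1I continuous_intros)
  then show ?thesis by (rule that)
qed

lemma cont_diff_vec_C1:
  fixes h :: "'z::euclidean_space \<Rightarrow> real^'p"
  assumes "cont_diff h"
  obtains dh where "\<And>i. C1 (\<lambda>z. h z $ i) (dh i)"
proof -
  obtain h' :: "'z \<Rightarrow> 'z \<Rightarrow>\<^sub>L (real^'p)" where h': "\<And>z. (h has_derivative blinfun_apply (h' z)) (at z)" "continuous_on UNIV h'"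
    using assms unfolding cont_diff_def by blast
  have "C1 (\<lambda>z. h z $ i) (\<lambda>z. \<Sum>b\<in>Basis. (h' z b $ i) *\<^sub>R b)" for i
  proof (rule C1I)
    show "((\<lambda>z. h z $ i) has_derivative (\<lambda>b. h' z b $ i)) (at z)" for z
      by (rule bounded_linear.has_derivative[OF bounded_linear_vec_nth h'(1)])
    show "continuous_on UNIV (\<lambda>z. h' z b $ i)" for b by (intro continuous_intros h'(2))
  qed
  then show ?thesis by (rule that)
qed

lemma sum_Inl_Inr: "(\<Sum>c\<in>(UNIV :: ('p::finite + 'q::finite) set). X c) = (\<Sum>i\<in>UNIV. X (Inl i)) + (\<Sum>j\<in>UNIV. X (Inr j))"
  using sum.Plus[of UNIV UNIV X] by (simp add: o_def)

theorem theorem5p3: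
  fixes F f :: "(real^'n) \<times> (real^'m) \<Rightarrow> real"
    and G :: "(real^'n) \<times> (real^'m) \<Rightarrow> real^'q"
    and g :: "(real^'n) \<times> (real^'m) \<Rightarrow> real^'p"
    and xb u :: "real^'n" and yb :: "real^'m" and \<Omega> :: "(real^'m) set"
  assumes "cont_diff F" and "cont_diff f" and "cont_diff G" and "cont_diff g"
    and "bilevel_local_min F f g G xb yb"
    and "\<And>y. (xb, y) \<in> gph (sol_map f g) \<Longrightarrow> RCR_regular g xb y"
    and "\<And>y. (xb, y) \<in> gph (sol_map f g) \<Longrightarrow> Robinson_stable g xb y u"
    and "restricted_inf_compact f g \<Omega> xb u"
  shows "dir_lipschitz (val_fun f g) xb u
    \<and> dir_differentiable (val_fun f g) xb u
    \<and> (\<exists>(M :: real^'m \<Rightarrow> real) d.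
         (\<forall>y \<in> dir_sol f g xb u.
            is_maximum ((\<lambda>l. grad_x (lagrangian f g l) xb y \<bullet> u) ` multipliers f g xb y) (M y))
         \<and> is_minimum (M ` dir_sol f g xb u) d
         \<and> dir_deriv (val_fun f g) xb u = ereal d)
    \<and> dir_limiting_subdiff (val_fun f g) xb u \<subseteq> Theta f g \<Omega> xb u
    \<and> (\<forall>v.
         (u, v) \<in> critical_cone F f g G xb yb
         \<and> \<not> (\<exists>(\<alpha> :: real) (\<nu>g :: real^'p) (\<nu>G :: real^'q).
               (\<alpha>, \<nu>g, \<nu>G) \<noteq> 0 \<and> \<alpha> \<ge> 0 \<and> \<nu>g \<ge> 0 \<and> \<nu>G \<ge> 0
               \<and> 0 \<in> {\<alpha> *\<^sub>R grad f (xb, yb) - \<alpha> *\<^sub>R (\<xi>, 0)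
                      + adjoint (frechet_derivative g (at (xb, yb))) \<nu>g
                      + adjoint (frechet_derivative G (at (xb, yb))) \<nu>G
                      | \<xi>. \<xi> \<in> convex hull Theta f g \<Omega> xb u}
               \<and> orthogonal \<nu>g (g (xb, yb))
               \<and> orthogonal \<nu>g (frechet_derivative g (at (xb, yb)) (u, v))
               \<and> orthogonal \<nu>G (G (xb, yb))
               \<and> orthogonal \<nu>G (frechet_derivative G (at (xb, yb)) (u, v))
               \<and> (\<exists>(t :: nat \<Rightarrow> real) us vs.
                    (\<forall>k. t k > 0) \<and> t \<longlonglongrightarrow> 0 \<and> (\<lambda>k. (us k, vs k)) \<longlonglongrightarrow> (u, v)
                    \<and> (\<forall>k.
                         (\<alpha> > 0 \<longrightarrow>
                            ereal \<alpha> * (ereal (f (xb + t k *\<^sub>R us k, yb + t k *\<^sub>R vs k))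
                                       - val_fun f g (xb + t k *\<^sub>R us k)) > 0)
                         \<and> (\<forall>i \<in> active g (xb, yb). \<nu>g $ i > 0 \<longrightarrow>
                              g (xb + t k *\<^sub>R us k, yb + t k *\<^sub>R vs k) $ i > 0)
                         \<and> (\<forall>i \<in> active G (xb, yb). \<nu>G $ i > 0 \<longrightarrow>
                              G (xb + t k *\<^sub>R us k, yb + t k *\<^sub>R vs k) $ i > 0))))
         \<longrightarrow>
         (\<exists>(lV :: real) (lg :: real^'p) (lG :: real^'q).
            0 \<in> {grad F (xb, yb) + lV *\<^sub>R grad f (xb, yb) - lV *\<^sub>R (\<xi>, 0)
                   + adjoint (frechet_derivative g (at (xb, yb))) lg
                   + adjoint (frechet_derivative G (at (xb, yb))) lG
                   | \<xi>. \<xi> \<in> convex hull Theta f g \<Omega> xb u}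
            \<and> lV \<ge> 0
            \<and> lg \<ge> 0 \<and> orthogonal lg (g (xb, yb))
            \<and> orthogonal lg (frechet_derivative g (at (xb, yb)) (u, v))
            \<and> lG \<ge> 0 \<and> orthogonal lG (G (xb, yb))
            \<and> orthogonal lG (frechet_derivative G (at (xb, yb)) (u, v))))"
proof -
  obtain dF where dF: "C1 F dF" using cont_diff_C1[OF assms(1)] by blast
  obtain df where df: "C1 f df" using cont_diff_C1[OF assms(2)] by blast
  obtain dG where dG: "\<And>j. C1 (\<lambda>z. G z $ j) (dG j)" using cont_diff_vec_C1[OF assms(3)] by blast
  obtain dg where dg: "\<And>i. C1 (\<lambda>z. g z $ i) (dg i)" using cont_diff_vec_C1[OF assms(4)] by blast
  have ybS: "yb \<in> sol_map f g xb" and GS: "G (xb, yb) \<le> 0"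
    using assms(5) by (auto simp: bilevel_local_min_def bilevel_feasible_def)
  interpret lower_level f df g dg xb u yb \<Omega>
    using df dg ybS assms(6,7,8) by unfold_locales (auto simp: gph_def)
  obtain C \<epsilon> \<delta> where C: "C \<ge> 0" "\<epsilon> > 0" "\<delta> > 0"
    "\<And>a. a \<in> (+) xb ` dir_nhd \<epsilon> \<delta> u \<Longrightarrow> sol_map f g a \<inter> \<Omega> \<noteq> {}"
    "\<And>a y b y'. a \<in> (+) xb ` dir_nhd \<epsilon> \<delta> u \<Longrightarrow> y \<in> sol_map f g a \<inter> \<Omega> \<Longrightarrow> b \<in> (+) xb ` dir_nhd \<epsilon> \<delta> u \<Longrightarrow>
      y' \<in> ball y \<epsilon> \<Longrightarrow> val_fun f g b \<le> ereal (f (b, y') + C * viol g (b, y'))"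
    by (rule penalty, rule that)
  define N where "N = (+) xb ` dir_nhd \<epsilon> \<delta> u"
  interpret lower_level_penalty f df g dg xb u yb \<Omega> C \<epsilon> N \<delta>
    by unfold_locales (fact C(1-3) N_def C(4,5)[folded N_def])+
  note fg = frechet_derivative_C1_vec[OF dg] and fG = frechet_derivative_C1_vec[OF dG]
  \<comment> \<open>Every directional solution yields the same maximum \<open>d\<close>, so
    \<open>M\<close> is constant and the minimum is attained at any of them.\<close>
  have part3: "\<exists>(M :: real^'m \<Rightarrow> real) d.
         (\<forall>y \<in> dir_sol f g xb u.
            is_maximum ((\<lambda>l. grad_x (lagrangian f g l) xb y \<bullet> u) ` multipliers f g xb y) (M y))
         \<and> is_minimum (M ` dir_sol f g xb u) d
         \<and> dir_deriv (val_fun f g) xb u = ereal d"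
    using dir_sol_maximum dir_sol_nonempty dir_deriv_d
    by (intro exI[of _ "\<lambda>_. d"] exI[of _ d]) (auto simp: is_minimum_def)
  have part5: "\<exists>(lV :: real) (lg :: real^'p) (lG :: real^'q).
            0 \<in> {grad F (xb, yb) + lV *\<^sub>R grad f (xb, yb) - lV *\<^sub>R (\<xi>, 0)
                   + adjoint (frechet_derivative g (at (xb, yb))) lg
                   + adjoint (frechet_derivative G (at (xb, yb))) lG
                   | \<xi>. \<xi> \<in> convex hull Theta f g \<Omega> xb u}
            \<and> lV \<ge> 0
            \<and> lg \<ge> 0 \<and> orthogonal lg (g (xb, yb))
            \<and> orthogonal lg (frechet_derivative g (at (xb, yb)) (u, vd))
            \<and> lG \<ge> 0 \<and> orthogonal lG (G (xb, yb))
            \<and> orthogonal lG (frechet_derivative G (at (xb, yb)) (u, vd))"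
    if crit: "(u, vd) \<in> critical_cone F f g G xb yb"
      and nonab: "\<not> (\<exists>(\<alpha> :: real) (\<nu>g :: real^'p) (\<nu>G :: real^'q).
               (\<alpha>, \<nu>g, \<nu>G) \<noteq> 0 \<and> \<alpha> \<ge> 0 \<and> \<nu>g \<ge> 0 \<and> \<nu>G \<ge> 0
               \<and> 0 \<in> {\<alpha> *\<^sub>R grad f (xb, yb) - \<alpha> *\<^sub>R (\<xi>, 0)
                      + adjoint (frechet_derivative g (at (xb, yb))) \<nu>g
                      + adjoint (frechet_derivative G (at (xb, yb))) \<nu>G
                      | \<xi>. \<xi> \<in> convex hull Theta f g \<Omega> xb u}
               \<and> orthogonal \<nu>g (g (xb, yb))
               \<and> orthogonal \<nu>g (frechet_derivative g (at (xb, yb)) (u, vd))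
               \<and> orthogonal \<nu>G (G (xb, yb))
               \<and> orthogonal \<nu>G (frechet_derivative G (at (xb, yb)) (u, vd))
               \<and> (\<exists>(t :: nat \<Rightarrow> real) us vs.
                    (\<forall>k. t k > 0) \<and> t \<longlonglongrightarrow> 0 \<and> (\<lambda>k. (us k, vs k)) \<longlonglongrightarrow> (u, vd)
                    \<and> (\<forall>k.
                         (\<alpha> > 0 \<longrightarrow>
                            ereal \<alpha> * (ereal (f (xb + t k *\<^sub>R us k, yb + t k *\<^sub>R vs k))
                                       - val_fun f g (xb + t k *\<^sub>R us k)) > 0)
                         \<and> (\<forall>i \<in> active g (xb, yb). \<nu>g $ i > 0 \<longrightarrow>
                              g (xb + t k *\<^sub>R us k, yb + t k *\<^sub>R vs k) $ i > 0)
                         \<and> (\<forall>i \<in> active G (xb, yb). \<nu>G $ i > 0 \<longrightarrow>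
                              G (xb + t k *\<^sub>R us k, yb + t k *\<^sub>R vs k) $ i > 0))))"
    for vd
  proof -
    \<comment> \<open>The sum type indexes the constraints of both levels; its two halves are
      separated again into multipliers for \<open>g\<close> and \<open>G\<close>.\<close>
    define h :: "'p + 'q \<Rightarrow> _" where "h = case_sum (\<lambda>i z. g z $ i) (\<lambda>j z. G z $ j)"
    define dh where "dh = case_sum dg dG"
    have hs [simp]: "h (Inl i) z = g z $ i" "h (Inr j) z = G z $ j" "dh (Inl i) = dg i" "dh (Inr j) = dG j" for i j z
      by (simp_all add: h_def dh_def)
    obtain e0 where e0: "e0 > 0" "\<And>z. z \<in> bilevel_feasible f g G \<Longrightarrow> z \<in> ball (xb, yb) e0 \<Longrightarrow> F (xb, yb) \<le> F z"
      using assms(5) unfolding bilevel_local_min_def by blast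
    interpret bilevel f df g dg xb u yb \<Omega> C \<epsilon> N \<delta> F dF h dh vd e0
    proof unfold_locales
      show "C1 F dF" by (rule dF)
      show "C1 (h c) (dh c)" for c by (cases c) (simp_all add: h_def dh_def dg dG)
      show "h c (xb, yb) \<le> 0" for c
        using sol_mapD(1)[OF ybS] GS by (cases c) (auto simp: less_eq_vec_def)
      show "e0 > 0" by (rule e0)
      show "F (xb, yb) \<le> F z" if z: "fst z \<in> N" "dist z (xb, yb) < e0" "f z \<le> v (fst z)" "\<And>c. h c z \<le> 0" for z
      \<comment> \<open>A point with \<open>g z \<le> 0\<close> and
        \<open>f z \<le> v (fst z)\<close> over \<open>N\<close> is a lower level solution, so local
        minimality in the bilevel program applies.\<close>
      proof (rule e0(2))
        have gz: "g z $ i \<le> 0" and Gz: "G z $ j \<le> 0" for i j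
          using z(4)[of "Inl i"] z(4)[of "Inr j"] by simp_all
        have "snd z \<in> sol_map f g (fst z)"
          using gz z(3) by (intro sol_mapI) (simp_all add: feas_map_iff val_N[OF z(1)])
        moreover have "G z \<le> 0" using Gz by (simp add: less_eq_vec_def)
        ultimately show "z \<in> bilevel_feasible f g G" by (auto simp: bilevel_feasible_def split_beta)
        show "z \<in> ball (xb, yb) e0" using z(2) by (simp add: dist_commute)
      qed
      show "dF (xb, yb) \<bullet> (u, vd) \<le> 0" "df (xb, yb) \<bullet> (u, vd) \<le> d"
        using crit by (simp_all add: critical_cone_def dir_deriv_d frechet_derivative_C1[OF dF] frechet_derivative_C1[OF df])
      show "dh c (xb, yb) \<bullet> (u, vd) \<le> 0" if "h c (xb, yb) = 0" for c
        using crit that by (cases c) (auto simp: critical_cone_def fg fG active_def)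
    qed
    \<comment> \<open>Both the excluded and the asserted multiplier rule are stated with
      \<open>Theta\<close>, and the gradients found lie in the smaller set.\<close>
    have hull: "convex hull W_limits \<subseteq> convex hull Theta f g \<Omega> xb u" by (rule hull_mono[OF W_limits_subset])
    have grads: "grad F zb = dF zb" "grad f zb = df zb" using grad_C1[OF dF] grad_C1[OF df] by auto
    have adj: "adjoint (frechet_derivative g (at zb)) (\<chi> i. \<nu> (Inl i)) + adjoint (frechet_derivative G (at zb)) (\<chi> j. \<nu> (Inr j))
        = (\<Sum>c\<in>UNIV. \<nu> c *\<^sub>R dh c zb)" for \<nu>
      unfolding fg fG adjoint_vec sum_Inl_Inr by simp
    have orth: "orthogonal (\<chi> i. \<nu> (Inl i)) (g zb)" "orthogonal (\<chi> i. \<nu> (Inl i)) (frechet_derivative g (at zb) dir)"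
        "orthogonal (\<chi> j. \<nu> (Inr j)) (G zb)" "orthogonal (\<chi> j. \<nu> (Inr j)) (frechet_derivative G (at zb) dir)"
      if \<nu>: "\<And>c. \<nu> c \<ge> 0" "\<forall>c. \<nu> c > 0 \<longrightarrow> h c zb = 0 \<and> dh c zb \<bullet> dir = 0" for \<nu>
    proof -
      have c: "\<nu> c = 0 \<or> h c zb = 0 \<and> dh c zb \<bullet> dir = 0" for c using \<nu>(1)[of c] \<nu>(2) by (cases "\<nu> c = 0") auto
      have "\<nu> (Inl i) * g zb $ i = 0" "\<nu> (Inl i) * (dg i zb \<bullet> dir) = 0" for i using c[of "Inl i"] by auto
      moreover have "\<nu> (Inr j) * G zb $ j = 0" "\<nu> (Inr j) * (dG j zb \<bullet> dir) = 0" for j using c[of "Inr j"] by auto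
      ultimately show "orthogonal (\<chi> i. \<nu> (Inl i)) (g zb)" "orthogonal (\<chi> i. \<nu> (Inl i)) (frechet_derivative g (at zb) dir)"
        "orthogonal (\<chi> j. \<nu> (Inr j)) (G zb)" "orthogonal (\<chi> j. \<nu> (Inr j)) (frechet_derivative G (at zb) dir)"
        by (simp_all add: orthogonal_def inner_vec_def fg fG sum.neutral del: mult_eq_0_iff)
    qed
    \<comment> \<open>Either the residual is an exact penalty on some sector, or every constant
      fails on every sector and an abnormal multiplier arises, which \<open>nonab\<close>
      excludes.\<close>
    have "\<exists>c1>0. \<exists>\<eta>>0. \<forall>t D'. 0 < t \<longrightarrow> t < \<eta> \<longrightarrow> norm (D' - dir) < \<eta> \<longrightarrow>
        F zb \<le> F (zb + t *\<^sub>R D') + c1 * P (zb + t *\<^sub>R D')"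
    proof (rule ccontr)
      assume no: "\<not> ?thesis"
      have not: "\<exists>t D'. 0 < t \<and> t < \<eta> \<and> norm (D' - dir) < \<eta> \<and> F (zb + t *\<^sub>R D') + c1 * P (zb + t *\<^sub>R D') < F zb"
        if "c1 > 0" "\<eta> > 0" for c1 \<eta>
        using no that by (meson linorder_not_le)
      obtain \<nu>0 \<nu> \<xi> t D where \<nu>: "\<nu>0 \<ge> 0" "\<And>c. \<nu> c \<ge> 0" "\<nu>0 \<noteq> 0 \<or> (\<exists>c. \<nu> c \<noteq> 0)" "\<xi> \<in> convex hull W_limits"
        "\<nu>0 *\<^sub>R (df zb - (\<xi>, 0)) + (\<Sum>c\<in>UNIV. \<nu> c *\<^sub>R dh c zb) = 0"
        "\<And>c. \<nu> c > 0 \<Longrightarrow> h c zb = 0 \<and> dh c zb \<bullet> dir = 0"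
        and t: "\<And>k. t k > 0" "t \<longlonglongrightarrow> 0" "D \<longlonglongrightarrow> dir" "\<And>k. fst (zb + t k *\<^sub>R D k) \<in> N"
        "\<And>k. \<nu>0 > 0 \<Longrightarrow> \<phi> (zb + t k *\<^sub>R D k) > 0" "\<And>k c. \<nu> c > 0 \<Longrightarrow> h c (zb + t k *\<^sub>R D k) > 0"
        by (rule abnormal_multiplier[OF not], assumption+, rule that)
      define \<nu>g :: "real^'p" where "\<nu>g = (\<chi> i. \<nu> (Inl i))"
      define \<nu>G :: "real^'q" where "\<nu>G = (\<chi> j. \<nu> (Inr j))"
      have zD: "zb + t k *\<^sub>R D k = (xb + t k *\<^sub>R fst (D k), yb + t k *\<^sub>R snd (D k))" for k
        by (simp add: prod_eq_iff)
      have nz: "(\<nu>0, \<nu>g, \<nu>G) \<noteq> 0"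
      proof
        assume "(\<nu>0, \<nu>g, \<nu>G) = 0"
        then have "\<nu>0 = 0" "\<And>i. \<nu> (Inl i) = 0" "\<And>j. \<nu> (Inr j) = 0"
          by (auto simp: zero_prod_def \<nu>g_def \<nu>G_def vec_eq_iff)
        then have "\<nu> c = 0" for c by (cases c) auto
        then show False using \<nu>(3) \<open>\<nu>0 = 0\<close> by blast
      qed
      have nn: "\<nu>g \<ge> 0" "\<nu>G \<ge> 0" using \<nu>(2) by (auto simp: \<nu>g_def \<nu>G_def less_eq_vec_def)
      have stat: "0 = \<nu>0 *\<^sub>R grad f zb - \<nu>0 *\<^sub>R (\<xi>, 0) + adjoint (frechet_derivative g (at zb)) \<nu>g
          + adjoint (frechet_derivative G (at zb)) \<nu>G"
        using \<nu>(5) adj[of \<nu>] unfolding \<nu>g_def \<nu>G_def grads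
        by (simp only: scaleR_right_diff_distrib add.assoc)
      \<comment> \<open>The first components lie in \<open>N\<close>, where the extended value
        equals the real \<open>v\<close>, so positivity of \<open>\<phi>\<close> transfers.\<close>
      have val: "ereal \<nu>0 * (ereal (f (xb + t k *\<^sub>R fst (D k), yb + t k *\<^sub>R snd (D k))) - val_fun f g (xb + t k *\<^sub>R fst (D k))) > 0"
        if "\<nu>0 > 0" for k
        using t(4)[of k] t(5)[OF that, of k] that unfolding zD by (simp add: val_N \<phi>_def)
      have gpos: "g (xb + t k *\<^sub>R fst (D k), yb + t k *\<^sub>R snd (D k)) $ i > 0" if "\<nu>g $ i > 0" for i k
        using t(6)[of "Inl i" k] that unfolding zD by (simp add: \<nu>g_def)
      have Gpos: "G (xb + t k *\<^sub>R fst (D k), yb + t k *\<^sub>R snd (D k)) $ j > 0" if "\<nu>G $ j > 0" for j k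
        using t(6)[of "Inr j" k] that unfolding zD by (simp add: \<nu>G_def)
      have "\<xi> \<in> convex hull Theta f g \<Omega> xb u" using hull \<nu>(4) by blast
      note \<xi> = this
      have "\<forall>c. \<nu> c > 0 \<longrightarrow> h c zb = 0 \<and> dh c zb \<bullet> dir = 0" using \<nu>(6) by blast
      note orth' = orth[OF \<nu>(2) this, folded \<nu>g_def \<nu>G_def]
      have Dl: "(\<lambda>k. (fst (D k), snd (D k))) \<longlonglongrightarrow> (u, vd)" using t(3) by simp
      show False
        by (rule notE[OF nonab], rule exI[of _ \<nu>0], rule exI[of _ \<nu>g], rule exI[of _ \<nu>G], intro conjI,
            rule nz, rule \<nu>(1), rule nn(1), rule nn(2), rule CollectI, rule exI[of _ \<xi>], rule conjI, rule stat, rule \<xi>,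
            rule orth'(1), rule orth'(2), rule orth'(3), rule orth'(4),
            rule exI[of _ t], rule exI[of _ "\<lambda>k. fst (D k)"], rule exI[of _ "\<lambda>k. snd (D k)"], intro conjI allI impI ballI,
            rule t(1), rule t(2), rule Dl, rule val, assumption, rule gpos, assumption, rule Gpos, assumption)
    qed
    then obtain c1 \<eta> where c1: "c1 > 0" "\<eta> > 0" and exact: "\<And>t D'. 0 < t \<Longrightarrow> t < \<eta> \<Longrightarrow> norm (D' - dir) < \<eta> \<Longrightarrow>
        F zb \<le> F (zb + t *\<^sub>R D') + c1 * P (zb + t *\<^sub>R D')" by blast
    obtain \<nu>0 \<nu> \<xi> where \<nu>: "\<nu>0 \<ge> 0" "\<And>c. \<nu> c \<ge> 0" "\<xi> \<in> convex hull W_limits"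
      "dF zb + \<nu>0 *\<^sub>R (df zb - (\<xi>, 0)) + (\<Sum>c\<in>UNIV. \<nu> c *\<^sub>R dh c zb) = 0"
      "\<And>c. \<nu> c > 0 \<Longrightarrow> h c zb = 0 \<and> dh c zb \<bullet> dir = 0"
      by (rule normal_multiplier[OF c1 exact], assumption+, rule that)
    have stat: "0 = grad F zb + \<nu>0 *\<^sub>R grad f zb - \<nu>0 *\<^sub>R (\<xi>, 0)
        + adjoint (frechet_derivative g (at zb)) (\<chi> i. \<nu> (Inl i)) + adjoint (frechet_derivative G (at zb)) (\<chi> j. \<nu> (Inr j))"
      using \<nu>(4) adj[of \<nu>] unfolding grads by (simp only: scaleR_right_diff_distrib add.assoc add_diff_eq)
    have nn: "(\<chi> i. \<nu> (Inl i)) \<ge> 0" "(\<chi> j. \<nu> (Inr j)) \<ge> 0" using \<nu>(2) by (auto simp: less_eq_vec_def)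
    have "\<xi> \<in> convex hull Theta f g \<Omega> xb u" using hull \<nu>(3) by blast
    note \<xi> = this
    have "\<forall>c. \<nu> c > 0 \<longrightarrow> h c zb = 0 \<and> dh c zb \<bullet> dir = 0" using \<nu>(5) by blast
    note orth' = orth[OF \<nu>(2) this]
    show ?thesis
      by (rule exI[of _ \<nu>0], rule exI[of _ "\<chi> i. \<nu> (Inl i)"], rule exI[of _ "\<chi> j. \<nu> (Inr j)"], intro conjI,
          rule CollectI, rule exI[of _ \<xi>], rule conjI, rule stat, rule \<xi>, rule \<nu>(1), rule nn(1),
          rule orth'(1), rule orth'(2), rule nn(2), rule orth'(3), rule orth'(4))
  qed
  show ?thesis
    using dir_lipschitz_val has_dir_deriv_d part3 limiting_subdiff_subset part5
    unfolding dir_differentiable_def by blast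
qed

end
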